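(* Assume the Strong Exponential Time Hypothesis (SETH). Then for every $\varepsilon > 0$, $(7/4-\varepsilon)$-approximating Diameter on undirected unweighted $n$-vertex graphs with $\tilde{O}(n)$ edges requires $n^{4/3-o(1)}$ time. That is: for every $\varepsilon>0$ there is a constant $c>0$ such that for every $\delta>0$ there is no algorithm that, given any undirected unweighted graph $G$ with $n$ vertices and at most $c\,n(\log n)^{c}$ edges, $n\ge 2$, runs in time $O(n^{4/3-\delta})$ and outputs a $(7/4-\varepsilon)$-approximation of $\mathrm{diam}(G)$.
   Context: SETH: for every $\varepsilon>0$ there is an integer $k$ such that $k$-SAT on $n$-variable instances cannot be solved in time $O((2-\varepsilon)^n)$. Graphs are finite. For an undirected unweighted graph $G$, $d_G(u,v)$ is the number of edges in a shortest path between $u$ and $v$ ($+\infty$ if there is none), and $\mathrm{diam}(G)=\max_{u,v\in V(G)} d_G(u,v)$. The problem Diameter asks, given $G$, for $\mathrm{diam}(G)$. For a real $r$, an $r$-approximation of $\mathrm{diam}(G)$ is a value $\hat D\in[0,+\infty]$ with $\hat D\le \mathrm{diam}(G)\le r\,\hat D$. The notation $\tilde O(\cdot)$ suppresses polylogarithmic factors. Running time is measured in the standard word-RAM model with words of $O(\log n)$ bits. *)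

theory Defs
  imports
    "HOL-Library.Landau_Symbols"
    "Graph_Theory.Pair_Digraph"
    "Graph_Theory.Shortest_Path"
begin

unbundle bit_operations_syntax

section \<open>The word RAM\<close>

text \<open>
  A deterministic word RAM with word size \<open>w\<close>. A program is a finite list of instructions, so it
  mentions only finitely many registers. Every register and memory cell holds a number below
  \<open>2 ^ w\<close>, memory is addressed by words, and each instruction costs one time unit. The machine
  halts when the program counter leaves the program.
\<close>

datatype binop = ADD | SUB | MUL | DIV | MOD | BAND | BOR | BXOR | SHL | SHR

datatype instr =
    Const nat nat             \<comment> \<open>\<open>Const r c\<close>: register \<open>r\<close> := \<open>c\<close>\<close>
  | Arith binop nat nat nat   \<comment> \<open>\<open>Arith f r a b\<close>: register \<open>r\<close> := register \<open>a\<close> \<open>f\<close> register \<open>b\<close>\<close>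
  | Load nat nat              \<comment> \<open>\<open>Load r a\<close>: register \<open>r\<close> := memory at the address in register \<open>a\<close>\<close>
  | Store nat nat             \<comment> \<open>\<open>Store a r\<close>: memory at the address in register \<open>a\<close> := register \<open>r\<close>\<close>
  | Jump nat
  | JumpIfLess nat nat nat    \<comment> \<open>\<open>JumpIfLess a b l\<close>: jump to \<open>l\<close> if register \<open>a\<close> < register \<open>b\<close>\<close>

type_synonym program = "instr list"

record ram_state =
  pc :: nat
  regs :: "nat \<Rightarrow> nat"
  mem :: "nat \<Rightarrow> nat"

text \<open>Arithmetic is modulo \<open>2 ^ w\<close>; division by zero follows the conventions of HOL.\<close>

fun binop_val :: "nat \<Rightarrow> binop \<Rightarrow> nat \<Rightarrow> nat \<Rightarrow> nat" where
  "binop_val w ADD a b = take_bit w (a + b)"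
| "binop_val w SUB a b = take_bit w (2 ^ w + a - b)"
| "binop_val w MUL a b = take_bit w (a * b)"
| "binop_val w DIV a b = a div b"
| "binop_val w MOD a b = a mod b"
| "binop_val w BAND a b = a AND b"
| "binop_val w BOR a b = a OR b"
| "binop_val w BXOR a b = a XOR b"
| "binop_val w SHL a b = take_bit w (push_bit b a)"
| "binop_val w SHR a b = drop_bit b a"

fun exec_instr :: "nat \<Rightarrow> instr \<Rightarrow> ram_state \<Rightarrow> ram_state" where
  "exec_instr w (Const r c) s =
     s\<lparr>pc := pc s + 1, regs := (regs s)(r := take_bit w c)\<rparr>"
| "exec_instr w (Arith f r a b) s =
     s\<lparr>pc := pc s + 1, regs := (regs s)(r := binop_val w f (regs s a) (regs s b))\<rparr>"
| "exec_instr w (Load r a) s =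
     s\<lparr>pc := pc s + 1, regs := (regs s)(r := mem s (regs s a))\<rparr>"
| "exec_instr w (Store a r) s =
     s\<lparr>pc := pc s + 1, mem := (mem s)(regs s a := regs s r)\<rparr>"
| "exec_instr w (Jump l) s = s\<lparr>pc := l\<rparr>"
| "exec_instr w (JumpIfLess a b l) s =
     s\<lparr>pc := if regs s a < regs s b then l else pc s + 1\<rparr>"

definition halted :: "program \<Rightarrow> ram_state \<Rightarrow> bool" where
  "halted P s \<longleftrightarrow> length P \<le> pc s"

definition step :: "program \<Rightarrow> nat \<Rightarrow> ram_state \<Rightarrow> ram_state" where
  "step P w s = (if halted P s then s else exec_instr w (P ! pc s) s)"

text \<open>
  The input occupies memory from address 0 on. Its entries are truncated to \<open>w\<close> bits, so an input
  whose entries do not fit into words is not handed over intact.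
\<close>

definition init_state :: "nat \<Rightarrow> nat list \<Rightarrow> ram_state" where
  "init_state w xs =
     \<lparr>pc = 0, regs = (\<lambda>_. 0), mem = (\<lambda>i. if i < length xs then take_bit w (xs ! i) else 0)\<rparr>"

text \<open>
  Halted states are fixed points of \<^const>\<open>step\<close>, so being halted after \<open>t\<close> steps means having
  halted within \<open>t\<close> steps, and the state reached is the final state. The output is read off the
  registers.
\<close>

definition run_state :: "program \<Rightarrow> nat \<Rightarrow> nat \<Rightarrow> nat list \<Rightarrow> ram_state" where
  "run_state P w t xs = (step P w ^^ t) (init_state w xs)"

definition computes_within ::
  "program \<Rightarrow> nat \<Rightarrow> nat \<Rightarrow> nat list \<Rightarrow> ((nat \<Rightarrow> nat) \<Rightarrow> bool) \<Rightarrow> bool" where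
  "computes_within P w t xs ok \<longleftrightarrow>
     halted P (run_state P w t xs) \<and> ok (regs (run_state P w t xs))"


section \<open>Satisfiability and the Strong Exponential Time Hypothesis\<close>

text \<open>The literal \<open>(v, s)\<close> is variable \<open>v\<close> if \<open>s\<close> holds, and its negation otherwise.\<close>

type_synonym literal = "nat \<times> bool"
type_synonym cnf = "literal list list"

text \<open>
  Clauses are sets of literals and formulas are sets of clauses, listed without repetition. Without
  this the length of an instance would not be bounded in terms of \<open>n\<close>, and no algorithm could even
  read its input in time depending on \<open>n\<close> only.
\<close>

definition kcnf :: "nat \<Rightarrow> nat \<Rightarrow> cnf \<Rightarrow> bool" where
  "kcnf k n F \<longleftrightarrow>
     (\<forall>C\<in>set F. distinct C \<and> length C \<le> k \<and> (\<forall>(v, s)\<in>set C. v < n)) \<and>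
     distinct (map set F)"

definition satisfiable :: "cnf \<Rightarrow> bool" where
  "satisfiable F \<longleftrightarrow> (\<exists>\<sigma> :: nat \<Rightarrow> bool. \<forall>C\<in>set F. \<exists>(v, s)\<in>set C. \<sigma> v = s)"

definition encode_literal :: "literal \<Rightarrow> nat" where
  "encode_literal = (\<lambda>(v, s). 2 * v + of_bool s)"

definition encode_cnf :: "nat \<Rightarrow> cnf \<Rightarrow> nat list" where
  "encode_cnf n F =
     n # length F # concat (map (\<lambda>C. length C # map encode_literal C) F)"

text \<open>
  Words have \<open>O(n)\<close> bits here, that is, logarithmically many in the exponential time scale
  \<open>2 ^ n\<close>; with fewer bits an exponential-time algorithm could not address its memory. The \<open>+ 1\<close>
  avoids empty words for \<open>n = 0\<close>.
\<close>

definition decides_ksat :: "nat \<Rightarrow> program \<Rightarrow> nat \<Rightarrow> (nat \<Rightarrow> nat) \<Rightarrow> bool" where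
  "decides_ksat k P b T \<longleftrightarrow>
     (\<forall>n F. kcnf k n F \<longrightarrow>
        computes_within P (b * (n + 1)) (T n) (encode_cnf n F)
          (\<lambda>R. R 0 \<noteq> 0 \<longleftrightarrow> satisfiable F))"

text \<open>
  The restriction \<open>\<epsilon> < 2\<close> is essential: \<open>O\<close> compares absolute values, and for \<open>\<epsilon> > 4\<close> the
  function \<open>(2 - \<epsilon>) ^ n\<close> exceeds \<open>2 ^ n\<close> in absolute value by an exponential factor, so that
  brute force would refute the hypothesis.
\<close>

definition SETH :: bool where
  "SETH \<longleftrightarrow>
     (\<forall>\<epsilon> :: real. 0 < \<epsilon> \<and> \<epsilon> < 2 \<longrightarrow>
        (\<exists>k. \<not> (\<exists>P b T. decides_ksat k P b T \<and>
           (\<lambda>n. real (T n)) \<in> O(\<lambda>n. (2 - \<epsilon>) ^ n))))"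


section \<open>Approximating the diameter\<close>

text \<open>
  An undirected simple graph is a \<^locale>\<open>pair_graph\<close>: a finite, loop-free digraph in which every
  arc comes with its reverse. Its undirected edges are the endpoint sets of its arcs.
\<close>

definition uedges :: "'a pair_pre_digraph \<Rightarrow> 'a set set" where
  "uedges G = (\<lambda>(u, v). {u, v}) ` parcs G"

definition graph_dist :: "'a pair_pre_digraph \<Rightarrow> 'a \<Rightarrow> 'a \<Rightarrow> ereal" where
  "graph_dist G u v = wf_digraph.\<mu> (with_proj G) (\<lambda>_. 1) u v"

definition diam :: "'a pair_pre_digraph \<Rightarrow> ereal" where
  "diam G = Max {graph_dist G u v | u v. u \<in> pverts G \<and> v \<in> pverts G}"

definition is_diam_approx :: "real \<Rightarrow> 'a pair_pre_digraph \<Rightarrow> ereal \<Rightarrow> bool" where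
  "is_diam_approx r G D \<longleftrightarrow> 0 \<le> D \<and> D \<le> diam G \<and> diam G \<le> ereal r * D"

text \<open>Each undirected edge is listed exactly once, in an arbitrary order and orientation.\<close>

definition lists_edges :: "'a pair_pre_digraph \<Rightarrow> ('a \<times> 'a) list \<Rightarrow> bool" where
  "lists_edges G es \<longleftrightarrow>
     distinct (map (\<lambda>(u, v). {u, v}) es) \<and> set (map (\<lambda>(u, v). {u, v}) es) = uedges G"

definition encode_graph :: "nat \<Rightarrow> (nat \<times> nat) list \<Rightarrow> nat list" where
  "encode_graph n es = n # length es # concat (map (\<lambda>(u, v). [u, v]) es)"

text \<open>Values in \<open>[0, \<infinity>]\<close> are output as fractions; denominator 0 stands for \<open>\<infinity>\<close>.\<close>

definition fraction_val :: "nat \<Rightarrow> nat \<Rightarrow> ereal" where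
  "fraction_val p q = (if q = 0 then \<infinity> else ereal (real p / real q))"

definition approximates_diam_sparse ::
  "real \<Rightarrow> real \<Rightarrow> program \<Rightarrow> nat \<Rightarrow> (nat \<Rightarrow> nat) \<Rightarrow> bool" where
  "approximates_diam_sparse c r P b T \<longleftrightarrow>
     (\<forall>n\<ge>2. \<forall>G es.
        pair_graph G \<and> pverts G = {0..<n} \<and>
        real (card (uedges G)) \<le> c * real n * log 2 (real n) powr c \<and>
        lists_edges G es \<longrightarrow>
        computes_within P (b * nat \<lceil>log 2 (real n)\<rceil>) (T n) (encode_graph n es)
          (\<lambda>R. is_diam_approx r G (fraction_val (R 0) (R 1))))"

end

theory Submission
  imports Defs "HOL-Real_Asymp.Real_Asymp"
begin

text \<open>
  The variables of a \<open>k\<close>-CNF formula are split into four groups. A partial assignment of one group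
  becomes a 0/1 vector indexed by the clauses, with 1 where it satisfies no literal of the clause; four
  guard coordinates force four vectors without a common 1 to come from different groups. Hence the
  formula is satisfiable iff some four of the \<open>N \<approx> 2 ^ (n / 4)\<close> vectors are orthogonal, that is,
  have no common 1.

  The graph has a vertex for each triple of vectors, and triples are joined through arrays of seven
  coordinates. If any four vectors have a common 1, then a suitable array joins any two triples and
  the diameter is at most 4. If \<open>a, b, c, d\<close> are orthogonal, then the balls of radius 3 around the
  triples \<open>a b c\<close> and \<open>d c b\<close> are disjoint, and the diameter is at least 7. A
  \<open>(7/4 - \<epsilon>)\<close>-approximation tells 4 from 7.

  The graph has \<open>N ^ 3\<close> vertices up to factors polynomial in \<open>n\<close>, so time
  \<open>O(n ^ (4/3 - \<delta>))\<close> turns into \<open>2 ^ ((1 - 3 \<delta> / 4) n)\<close> up to such factors. Extra vertices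
  hung on two hubs ensure that the number of vertices is a power of two proportional to the bound
  on the number of edges. No sparsification of the formula is needed, since a \<open>k\<close>-CNF formula
  has polynomially many clauses. The reduction runs on the word RAM: it lists the edges in linear
  time and then executes the given program, whose words are shorter, under a mask.
\<close>

section \<open>Walks and the diameter\<close>

text \<open>The exponent 4/3 arises because a solution consists of four vectors while a vertex holds
  three of them. Arrays act as certificates: neighbouring vertices on the intended path share an
  array up to reversal, and each vertex or edge checks it only against the few vectors it knows. No
  vertex knows all four, so the tests have to overlap: when a walk of length 3 from
  \<open>TV a b c\<close> meets one from \<open>TV d c b\<close>, the tests passed on both sides
  must add up to a single coordinate at which \<open>a\<close>, \<open>b\<close>, \<open>c\<close>
  and \<open>d\<close> are all on. This requirement dictates which vectors are tested at which of
  the seven slots. An edge involves at most three vectors and two arrays. For fixed \<open>k\<close>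
  the number of arrays is polynomial in the number of variables, so pairs of arrays are affordable.
  The given program has words of \<open>b\<close> times the rounded-up logarithm of the number of
  vertices. With \<open>2 ^ B\<close> vertices nothing is rounded, and the number of its addresses
  is the \<open>b\<close>-th power of the number of vertices, which the reduction can compute by
  multiplication.\<close>

lemma awalk_relpow:
  assumes wf: "wf_digraph (with_proj G)"
  shows "(\<exists>p. pre_digraph.awalk (with_proj G) u p v \<and> length p = k) \<longleftrightarrow>
    u \<in> pverts G \<and> (u, v) \<in> parcs G ^^ k"
proof -
  interpret wf_digraph "with_proj G" by (rule wf)
  have V: "x \<in> pverts G \<and> y \<in> pverts G" if "(x, y) \<in> parcs G" for x y
    using that wellformed[of "(x, y)"] by simp
  show ?thesis
  proof (induction k arbitrary: u)
    case 0
    then show ?case by (auto simp: awalk_Nil_iff)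
  next
    case (Suc k)
    have "(\<exists>p. awalk u p v \<and> length p = Suc k) \<longleftrightarrow>
      (\<exists>x. (u, x) \<in> parcs G \<and> (\<exists>p. awalk x p v \<and> length p = k))"
    proof
      assume "\<exists>p. awalk u p v \<and> length p = Suc k"
      then obtain e p where "awalk u (e # p) v" "length p = k"
        by (metis length_Suc_conv)
      then show "\<exists>x. (u, x) \<in> parcs G \<and> (\<exists>p. awalk x p v \<and> length p = k)"
        by (cases e) (auto simp: awalk_Cons_iff)
    next
      assume "\<exists>x. (u, x) \<in> parcs G \<and> (\<exists>p. awalk x p v \<and> length p = k)"
      then obtain x p where "(u, x) \<in> parcs G" "awalk x p v" "length p = k" by auto
      then show "\<exists>p. awalk u p v \<and> length p = Suc k"
        by (intro exI[of _ "(u, x) # p"]) (auto simp: awalk_Cons_iff)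
    qed
    also have "\<dots> \<longleftrightarrow> (\<exists>x. (u, x) \<in> parcs G \<and> (x, v) \<in> parcs G ^^ k)"
      using Suc.IH V by blast
    also have "\<dots> \<longleftrightarrow> u \<in> pverts G \<and> (u, v) \<in> parcs G ^^ Suc k"
      using V by (metis relpow_Suc_D2 relpow_Suc_I2)
    finally show ?case .
  qed
qed

lemma (in wf_digraph) awalk_cost_one: "awalk_cost (\<lambda>_. 1) p = real (length p)"
  by (induct p) auto

lemma diam_le:
  assumes wf: "wf_digraph (with_proj G)" and fin: "finite (pverts G)" "pverts G \<noteq> {}"
    and walks: "\<And>u v. u \<in> pverts G \<Longrightarrow> v \<in> pverts G \<Longrightarrow> \<exists>k\<le>d. (u, v) \<in> parcs G ^^ k"
  shows "diam G \<le> ereal (real d)"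
proof -
  interpret wf_digraph "with_proj G" by (rule wf)
  have le: "graph_dist G u v \<le> ereal (real d)" if uv: "u \<in> pverts G" "v \<in> pverts G" for u v
  proof -
    obtain k where k: "k \<le> d" "(u, v) \<in> parcs G ^^ k" using walks uv by blast
    then obtain p where p: "awalk u p v" "length p = k"
      using awalk_relpow[OF wf] uv by metis
    have "graph_dist G u v \<le> ereal (awalk_cost (\<lambda>_. 1) p)"
      unfolding graph_dist_def by (rule min_cost_le_walk_cost[OF p(1)])
    also have "\<dots> \<le> ereal (real d)" using k p by (simp add: awalk_cost_one)
    finally show ?thesis .
  qed
  have "{graph_dist G u v |u v. u \<in> pverts G \<and> v \<in> pverts G}
      = (\<lambda>(u, v). graph_dist G u v) ` (pverts G \<times> pverts G)" by auto
  then show ?thesis unfolding diam_def using fin le by (subst Max_le_iff) auto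
qed

lemma diam_ge:
  assumes wf: "wf_digraph (with_proj G)" and fin: "finite (pverts G)"
    and uv: "u \<in> pverts G" "v \<in> pverts G"
    and walks: "\<And>k. k < d \<Longrightarrow> (u, v) \<notin> parcs G ^^ k"
  shows "ereal (real d) \<le> diam G"
proof -
  interpret wf_digraph "with_proj G" by (rule wf)
  have "ereal (real d) \<le> graph_dist G u v"
    unfolding graph_dist_def \<mu>_def
  proof (rule INF_greatest)
    fix p assume "p \<in> {p. awalk u p v}"
    then have "(u, v) \<in> parcs G ^^ length p" using awalk_relpow[OF wf, of u v "length p"] by auto
    then have "d \<le> length p" using walks by (meson not_le)
    then show "ereal (real d) \<le> ereal (awalk_cost (\<lambda>_. 1) p)" by (simp add: awalk_cost_one)
  qed
  also have "\<dots> \<le> diam G"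
  proof -
    have "{graph_dist G u v |u v. u \<in> pverts G \<and> v \<in> pverts G}
      = (\<lambda>(u, v). graph_dist G u v) ` (pverts G \<times> pverts G)" by auto
    then have "finite {graph_dist G u v |u v. u \<in> pverts G \<and> v \<in> pverts G}" using fin by simp
    then show ?thesis unfolding diam_def using uv by (intro Max_ge) auto
  qed
  finally show ?thesis .
qed

text \<open>Turns a statement about all slots of an array into seven conjuncts with numerals, which
  \<open>simp\<close> can rewrite one by one.\<close>

lemma all_less_7: "(\<forall>i<7::nat. P i) \<longleftrightarrow> P 0 \<and> P 1 \<and> P 2 \<and> P 3 \<and> P 4 \<and> P 5 \<and> P 6"
proof -
  have "i < 7 \<longleftrightarrow> i = 0 \<or> i = 1 \<or> i = 2 \<or> i = 3 \<or> i = 4 \<or> i = 5 \<or> i = 6" for i :: nat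
    by arith
  then show ?thesis by (simp only: imp_disjL all_conj_distrib simp_thms)
qed

section \<open>The gadget graph\<close>

datatype vtx = HB bool | TV nat nat nat | PV nat nat nat | MV nat nat nat | JV nat

text \<open>The dominating vector \<open>unit\<close> is a neutral partner: placed next to any
  vector it passes every test that the other vector passes. The hubs reach the triples through
  it.\<close>

locale gadget =
  fixes on :: "nat \<Rightarrow> nat \<Rightarrow> bool" and slot :: "nat \<Rightarrow> nat \<Rightarrow> nat"
    and N D W unit :: nat and marked :: "nat \<Rightarrow> bool" and junk :: "nat set"
  assumes on_less: "a < N \<Longrightarrow> on a x \<Longrightarrow> x < D"
    and unit: "unit < N" "a < N \<Longrightarrow> on a x \<Longrightarrow> on unit x"
    and array: "(\<And>i. i < 7 \<Longrightarrow> f i < D) \<Longrightarrow> \<exists>X<W. \<forall>i<7. slot X i = f i"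
begin

text \<open>
  The intended path of length 4 is \<open>TV a b c\<close>, \<open>PV a b X\<close>, \<open>MV a d X\<close>, \<open>PV d e Y\<close>, \<open>TV d e f\<close>, where
  \<open>Y\<close> is the reverse of \<open>X\<close>. Accordingly the slots of \<open>X\<close> hold common coordinates of \<open>a b c\<close>,
  \<open>a b c e\<close>, \<open>a b c d\<close>, \<open>a b d e\<close>, \<open>a d e f\<close>, \<open>b d e f\<close> and \<open>d e f\<close>.
\<close>

definition okP :: "nat \<Rightarrow> nat \<Rightarrow> nat \<Rightarrow> bool" where
  "okP a b X \<longleftrightarrow> (\<forall>i\<in>{0,1,2,3,4}. on a (slot X i)) \<and> (\<forall>i\<in>{0,1,2,3,5}. on b (slot X i))"

text \<open>The condition is invariant under reversing the array and exchanging the two vectors.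
  Hence a middle vertex serves both ends of the intended path alike.\<close>

definition okM :: "nat \<Rightarrow> nat \<Rightarrow> nat \<Rightarrow> bool" where
  "okM a b X \<longleftrightarrow> (\<forall>i\<in>{0,1,2,3,4}. on a (slot X i)) \<and> (\<forall>i\<in>{2,3,4,5,6}. on b (slot X i))"

definition okT :: "nat \<Rightarrow> nat \<Rightarrow> bool" where
  "okT c X \<longleftrightarrow> (\<forall>i\<in>{0,1,2}. on c (slot X i))"

definition reversed :: "nat \<Rightarrow> nat \<Rightarrow> bool" where
  "reversed X Y \<longleftrightarrow> (\<forall>i<7. slot Y i = slot X (6 - i))"

definition flat :: "nat \<Rightarrow> bool" where
  "flat X \<longleftrightarrow> (\<forall>i<7. slot X i = slot X 0)"

text \<open>
  \<open>PM_switch\<close> carries a coordinate from one array to another. The hubs keep the junk vertices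
  within distance 4 of everything; there are two of them, told apart by \<open>marked\<close>, so that they do
  not shorten the distance between \<open>TV a b c\<close> and \<open>TV d c b\<close> when exactly one of \<open>a\<close> and \<open>d\<close> is marked.
\<close>

inductive edge :: "vtx \<Rightarrow> vtx \<Rightarrow> bool" where
  PT: "\<lbrakk>a < N; b < N; c < N; X < W; okP a b X; okT c X\<rbrakk> \<Longrightarrow> edge (PV a b X) (TV a b c)"
| PM: "\<lbrakk>a < N; b < N; c < N; X < W; okP a b X; okM a c X\<rbrakk> \<Longrightarrow> edge (PV a b X) (MV a c X)"
| PM_rev: "\<lbrakk>a < N; b < N; c < N; X < W; Y < W; okP a b X; okM c a Y; reversed X Y\<rbrakk>
    \<Longrightarrow> edge (PV a b X) (MV c a Y)"
| PP: "\<lbrakk>a < N; b < N; X < W; Y < W; okP a b X; okP a b Y; X < Y\<rbrakk> \<Longrightarrow> edge (PV a b X) (PV a b Y)"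
| PM_switch: "\<lbrakk>a < N; b < N; X < W; Y < W; okP a b X; okM a b Y; slot X 0 = slot Y 3\<rbrakk>
    \<Longrightarrow> edge (PV a b X) (MV a b Y)"
| HM: "\<lbrakk>a < N; X < W; okM unit a X; flat X\<rbrakk> \<Longrightarrow> edge (HB (marked a)) (MV unit a X)"
| HP: "\<lbrakk>X < W; okP unit unit X; flat X\<rbrakk> \<Longrightarrow> edge (HB h) (PV unit unit X)"
| HJ: "j \<in> junk \<Longrightarrow> edge (HB h) (JV j)"

definition vertices :: "vtx set" where
  "vertices = range HB \<union> {TV a b c | a b c. a < N \<and> b < N \<and> c < N}
    \<union> {PV a b X | a b X. a < N \<and> b < N \<and> X < W \<and> okP a b X}
    \<union> {MV a b X | a b X. a < N \<and> b < N \<and> X < W \<and> okM a b X} \<union> JV ` junk"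

definition adj :: "(vtx \<times> vtx) set" where
  "adj = {(u, v). edge u v \<or> edge v u}"

lemma edge_vertices: "edge u v \<Longrightarrow> u \<in> vertices \<and> v \<in> vertices"
  by (induction rule: edge.induct) (auto simp: vertices_def unit)

lemma adj_sym: "(u, v) \<in> adj \<Longrightarrow> (v, u) \<in> adj"
  by (auto simp: adj_def)

section \<open>Diameter at most 4 when every four vectors share a coordinate\<close>

definition near :: "nat \<Rightarrow> vtx \<Rightarrow> vtx \<Rightarrow> bool" where
  "near d u v \<longleftrightarrow> (\<exists>k\<le>d. (u, v) \<in> adj ^^ k)"

lemma near_refl: "near d u u"
  unfolding near_def by (intro exI[of _ 0]) auto

lemma near_edge: "edge u v \<or> edge v u \<Longrightarrow> near (Suc 0) u v"
  unfolding near_def by (intro exI[of _ 1]) (auto simp: adj_def)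

lemma near_edge1: "edge u v \<Longrightarrow> near (Suc 0) u v"
  and near_edge2: "edge v u \<Longrightarrow> near (Suc 0) u v"
  by (auto intro: near_edge)

lemma near_trans:
  assumes "near d u v" "near e v w" "d + e \<le> f"
  shows "near f u w"
proof -
  obtain k l where "k \<le> d" "l \<le> e" "(u, v) \<in> adj ^^ k" "(v, w) \<in> adj ^^ l"
    using assms unfolding near_def by auto
  then show ?thesis
    unfolding near_def using assms(3) by (intro exI[of _ "k + l"]) (auto simp: relpow_add)
qed

lemma near_mono: "near d u v \<Longrightarrow> d \<le> e \<Longrightarrow> near e u v"
  unfolding near_def by (meson order_trans)

lemma relpow_adj_sym: "(u, v) \<in> adj ^^ k \<Longrightarrow> (v, u) \<in> adj ^^ k"
proof (induction k arbitrary: v)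
  case (Suc k)
  then obtain w where "(u, w) \<in> adj ^^ k" "(w, v) \<in> adj" by auto
  then have "(v, w) \<in> adj" "(w, u) \<in> adj ^^ k" using Suc adj_sym by auto
  then show ?case by (rule relpow_Suc_I2)
qed auto

lemma near_sym: "near d u v \<Longrightarrow> near d v u"
  unfolding near_def using relpow_adj_sym by blast

text \<open>Ports hide the kind of a vertex: one array joins any two ports by a path of length 4.\<close>

definition port :: "vtx \<Rightarrow> nat \<Rightarrow> nat \<Rightarrow> nat \<Rightarrow> nat \<Rightarrow> bool" where
  "port v a b c x \<longleftrightarrow> a < N \<and> b < N \<and> c < N \<and> on a x \<and> on b x \<and> on c x \<and>
     (\<forall>X<W. okP a b X \<longrightarrow> okT c X \<longrightarrow> slot X 0 = x \<longrightarrow> near (Suc 0) v (PV a b X))"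

lemma near_PP:
  assumes "a < N" "b < N" "X < W" "Y < W" "okP a b X" "okP a b Y"
  shows "near (Suc 0) (PV a b X) (PV a b Y)"
proof (cases X Y rule: linorder_cases)
  case equal
  with assms show ?thesis by (simp add: near_refl)
next
  case less
  with assms show ?thesis by (intro near_edge1 PP)
next
  case greater
  with assms show ?thesis by (intro near_edge2 PP)
qed

text \<open>Both vectors of \<open>MV a b X\<close> are on at the middle slot 3, so the vertex acts
  like the degenerate triple \<open>a b b\<close>. The switch edges move the coordinate of slot 3 to
  slot 0 of any fitting array, which is where ports need it.\<close>

lemma port_MV: "\<lbrakk>a < N; b < N; X < W; okM a b X\<rbrakk> \<Longrightarrow> port (MV a b X) a b b (slot X 3)"
  unfolding port_def
  by (intro conjI allI impI near_edge2 PM_switch) (simp_all, simp_all add: okM_def)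

lemma port_PV: "\<lbrakk>a < N; b < N; X < W; okP a b X\<rbrakk> \<Longrightarrow> port (PV a b X) a b b (slot X 0)"
  unfolding port_def by (intro conjI allI impI near_PP) (simp_all, simp_all add: okP_def)

lemma port_TV: "\<lbrakk>a < N; b < N; c < N; on a x; on b x; on c x\<rbrakk> \<Longrightarrow> port (TV a b c) a b c x"
  unfolding port_def by (intro conjI allI impI near_edge2 PT) simp_all

lemma array7:
  assumes "x0 < D" "x1 < D" "x2 < D" "x3 < D" "x4 < D" "x5 < D" "x6 < D"
  shows "\<exists>X<W. slot X 0 = x0 \<and> slot X 1 = x1 \<and> slot X 2 = x2 \<and> slot X 3 = x3 \<and> slot X 4 = x4
    \<and> slot X 5 = x5 \<and> slot X 6 = x6"
proof -
  define f where "f i = (if i = 0 then x0 else if i = 1 then x1 else if i = 2 then x2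
    else if i = 3 then x3 else if i = 4 then x4 else if i = 5 then x5 else x6)" for i :: nat
  have "\<exists>X<W. \<forall>i<7. slot X i = f i" by (rule array) (use assms in \<open>auto simp: f_def\<close>)
  then show ?thesis unfolding all_less_7 by (simp add: f_def)
qed

lemma flat_array: "x < D \<Longrightarrow> \<exists>X<W. \<forall>i<7. slot X i = x"
  using array[of "\<lambda>_. x"] by blast

lemma reversed_array:
  assumes "\<forall>i<7. slot X i < D"
  shows "\<exists>Y<W. reversed Y X \<and> reversed X Y"
proof -
  obtain Y where "Y < W" "\<forall>i<7. slot Y i = slot X (6 - i)"
    using array[of "\<lambda>i. slot X (6 - i)"] assms by auto
  then show ?thesis by (intro exI[of _ Y]) (auto simp: reversed_def)
qed

text \<open>The second half of the intended path is the first half read from the other end: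
  reversing the array exchanges the roles of the two triples.\<close>

lemma near_M_port:
  assumes v: "port v d e f x" and "d < N" "a < N" "X < W" "okM a d X"
    and "\<forall>i<7. slot X i < D"
    and e: "\<forall>i\<in>{6,5,4,3,1}. on e (slot X i)" and f: "\<forall>i\<in>{6,5,4}. on f (slot X i)"
    and x: "slot X 6 = x"
  shows "near 2 (MV a d X) v"
proof -
  obtain Y where Y: "Y < W" "reversed Y X" "reversed X Y"
    using reversed_array assms by blast
  have [simp]: "slot Y 0 = slot X 6" "slot Y (Suc 0) = slot X 5" "slot Y 2 = slot X 4" "slot Y 3 = slot X 3"
    "slot Y 4 = slot X 2" "slot Y 5 = slot X 1" "slot Y 6 = slot X 0"
    using Y(3) unfolding reversed_def all_less_7 by simp_all
  have ok: "okP d e Y" "okT f Y" using assms unfolding okP_def okM_def okT_def by auto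
  have "near (Suc 0) (MV a d X) (PV d e Y)"
    using assms Y ok by (intro near_edge2 PM_rev) (auto simp: port_def)
  moreover have "near (Suc 0) (PV d e Y) v"
    using v ok Y x by (auto simp: port_def intro: near_sym)
  ultimately show ?thesis by (rule near_trans) simp
qed

text \<open>The common coordinate of the three vectors of a port, repeated in all slots, passes
  every test together with \<open>unit\<close>. The hub with the mark of \<open>d\<close> enters at
  \<open>MV unit d X\<close>; the other hub spends one more step on
  \<open>PV unit unit X\<close>.\<close>

lemma near_unit_port:
  assumes v: "port v d e f x"
  shows "near 3 (HB (marked d)) v" "near 4 (HB h) v"
proof -
  have d: "d < N" "e < N" "f < N" "on d x" "on e x" "on f x" using v by (auto simp: port_def)
  then have x: "x < D" "on unit x" using on_less unit by blast+
  then obtain X where X: "X < W" "\<forall>i<7. slot X i = x" using flat_array by blast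
  have 1: "flat X" "okM unit d X" "okP unit unit X"
    using X d x unfolding flat_def okM_def okP_def all_less_7 by simp_all
  have 2: "near 2 (MV unit d X) v"
    using X d x unit 1(2) unfolding all_less_7 by (intro near_M_port[OF v]) (simp_all add: all_less_7)
  have 3: "near 3 (HB (marked d)) v"
    using HM[OF d(1) X(1) 1(2,1)] by (intro near_trans[OF near_edge 2]) auto
  have "near (Suc 0) (PV unit unit X) (MV unit d X)"
    using X d unit 1 by (intro near_edge1 PM)
  then have "near 3 (PV unit unit X) v" by (rule near_trans[OF _ 2]) simp
  then have 4: "near 4 (HB h) v"
    by (rule near_trans[OF near_edge[OF disjI1[OF HP[OF X(1) 1(3,1)]]]]) simp
  show "near 3 (HB (marked d)) v" "near 4 (HB h) v" by fact+
qed

text \<open>Every vertex other than hubs and junk is a port. Two ports are joined by an array that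
  carries their own coordinates in the outer slots and, in between, coordinates common to four of
  the six vectors involved. Hubs and junk vertices use \<open>near_unit_port\<close> towards
  ports.\<close>

lemma near_4:
  assumes common: "\<And>a b c d. \<lbrakk>a < N; b < N; c < N; d < N\<rbrakk>
      \<Longrightarrow> \<exists>x. on a x \<and> on b x \<and> on c x \<and> on d x"
    and "u \<in> vertices" "v \<in> vertices"
  shows "near 4 u v"
proof -
  have ports: "near 4 u v" if u: "port u a b c x" and v: "port v d e f y" for u v a b c x d e f y
  proof -
    have le: "a < N" "b < N" "c < N" "d < N" "e < N" "f < N"
      and on: "on a x" "on b x" "on c x" "on d y" "on e y" "on f y"
      using u v by (auto simp: port_def)
    obtain x1 where x1: "on a x1" "on b x1" "on c x1" "on e x1" using common le by blast
    obtain x2 where x2: "on a x2" "on b x2" "on c x2" "on d x2" using common le by blast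
    obtain x3 where x3: "on a x3" "on b x3" "on d x3" "on e x3" using common le by blast
    obtain x4 where x4: "on a x4" "on d x4" "on e x4" "on f x4" using common le by blast
    obtain x5 where x5: "on b x5" "on d x5" "on e x5" "on f x5" using common le by blast
    have "x < D" "x1 < D" "x2 < D" "x3 < D" "x4 < D" "x5 < D" "y < D"
      using on x1 x2 x3 x4 x5 on_less le by blast+
    from array7[OF this] obtain X where X: "X < W" "slot X 0 = x" "slot X 1 = x1"
      "slot X 2 = x2" "slot X 3 = x3" "slot X 4 = x4" "slot X 5 = x5" "slot X 6 = y" by auto
    have D: "\<forall>i<7. slot X i < D"
      using X \<open>x < D\<close> \<open>x1 < D\<close> \<open>x2 < D\<close> \<open>x3 < D\<close> \<open>x4 < D\<close> \<open>x5 < D\<close> \<open>y < D\<close>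
      unfolding all_less_7 by simp
    have ok: "okP a b X" "okT c X" "okM a d X"
      using X on x1 x2 x3 x4 x5 by (auto simp: okP_def okT_def okM_def)
    have "near (Suc 0) u (PV a b X)" using u X ok by (auto simp: port_def)
    moreover have "near (Suc 0) (PV a b X) (MV a d X)" using le X ok by (intro near_edge1 PM) simp_all
    moreover have "near 2 (MV a d X) v"
      using le X D ok on x1 x2 x3 x4 x5 by (intro near_M_port[OF v]) auto
    ultimately have "near 2 u (MV a d X)" "near 2 (MV a d X) v" by (auto intro: near_trans)
    then show ?thesis by (rule near_trans) simp
  qed
  have port_ex: "(\<exists>a b c x. port w a b c x) \<or> w \<in> range HB \<or> w \<in> JV ` junk" if w: "w \<in> vertices" for w
  proof -
    have "\<exists>x. port (TV a b c) a b c x" if "a < N" "b < N" "c < N" for a b c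
      using common[OF that that(1)] port_TV that by blast
    note TV = this
    consider "w \<in> range HB \<or> w \<in> JV ` junk"
      | a b c where "w = TV a b c" "a < N" "b < N" "c < N"
      | a b X where "w = PV a b X" "a < N" "b < N" "X < W" "okP a b X"
      | a b X where "w = MV a b X" "a < N" "b < N" "X < W" "okM a b X"
      using w by (auto simp: vertices_def)
    then show ?thesis
    proof cases
      case 2 then show ?thesis using TV by metis
    next
      case 3 then show ?thesis using port_PV by metis
    next
      case 4 then show ?thesis using port_MV by metis
    qed simp
  qed
  have HJ': "near (Suc 0) (HB h) (JV j)" if "j \<in> junk" for h j using HJ[OF that] near_edge by auto
  have hub: "near 4 w v" if "w \<in> range HB \<or> w \<in> JV ` junk" "port v a b c x" for w v a b c x
  proof -
    note * = near_unit_port[OF that(2)]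
    \<comment> \<open>A junk vertex is adjacent to both hubs, so the walk may choose the one at
      distance 3 from the port.\<close>
    have "near 4 (JV j) v" if "j \<in> junk" for j
      by (rule near_trans[OF near_sym[OF HJ'[OF that]] *(1)]) simp
    then show ?thesis using that * by auto
  qed
  have HH: "near 4 (HB h) (HB h')" for h h'
  proof -
    obtain x where x: "on unit x" using common unit by blast
    then obtain X where X: "X < W" "\<forall>i<7. slot X i = x" using flat_array on_less unit by blast
    then have "edge (HB h) (PV unit unit X)" for h
      using x unfolding all_less_7 by (intro HP) (simp_all add: flat_def okP_def all_less_7)
    then have "near (Suc 0) (HB h) (PV unit unit X)" "near (Suc 0) (PV unit unit X) (HB h')"
      using near_edge by blast+
    then show ?thesis by (rule near_trans) simp
  qed
  have JJ: "near 4 (JV j) (JV j')" if "j \<in> junk" "j' \<in> junk" for j j'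
    by (rule near_trans[OF near_sym[OF HJ'[OF that(1)]] HJ'[OF that(2)]]) simp
  have HJ4: "near 4 (HB h) (JV j)" if "j \<in> junk" for h j
    by (rule near_mono[OF HJ'[OF that]]) simp
  consider (pp) "\<exists>a b c x. port u a b c x" "\<exists>d e f y. port v d e f y"
    | (hp) "u \<in> range HB \<or> u \<in> JV ` junk" "\<exists>d e f y. port v d e f y"
    | (ph) "v \<in> range HB \<or> v \<in> JV ` junk" "\<exists>d e f y. port u d e f y"
    | (hh) "u \<in> range HB \<or> u \<in> JV ` junk" "v \<in> range HB \<or> v \<in> JV ` junk"
    using port_ex[OF assms(2)] port_ex[OF assms(3)] by blast
  then show ?thesis
  proof cases
    case pp then show ?thesis using ports by blast
  next
    case hp then show ?thesis using hub by blast
  next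
    case ph then show ?thesis using near_sym[OF hub] by blast
  next
    case hh
    then show ?thesis
      by (elim disjE imageE) (simp_all add: HH JJ HJ4 near_sym[OF HJ4])
  qed
qed

end

section \<open>Disjoint balls of radius 3 around an orthogonal quadruple\<close>

context gadget begin

text \<open>Supersets of the balls around \<open>TV a b c\<close> of radius 1, 2 and 3.\<close>

definition full :: "nat \<Rightarrow> nat \<Rightarrow> nat \<Rightarrow> nat \<Rightarrow> bool" where
  "full a b c x \<longleftrightarrow> on a x \<and> on b x \<and> on c x"

fun ball1 :: "nat \<Rightarrow> nat \<Rightarrow> nat \<Rightarrow> vtx \<Rightarrow> bool" where
  "ball1 a b c (TV p q r) \<longleftrightarrow> p = a \<and> q = b \<and> r = c"
| "ball1 a b c (PV p q X) \<longleftrightarrow> okP p q X \<and> p = a \<and> q = b \<and> okT c X"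
| "ball1 a b c _ \<longleftrightarrow> False"

text \<open>The three alternatives for \<open>MV\<close> correspond to the rules \<open>PM\<close>,
  \<open>PM_rev\<close> and \<open>PM_switch\<close> by which the vertex is reached; in the last one
  slot 0 of the previous array, on which \<open>a\<close>, \<open>b\<close>, \<open>c\<close> are
  all on, has become slot 3.\<close>

fun ball2 :: "nat \<Rightarrow> nat \<Rightarrow> nat \<Rightarrow> vtx \<Rightarrow> bool" where
  "ball2 a b c (TV p q r) \<longleftrightarrow> p = a \<and> q = b"
| "ball2 a b c (PV p q X) \<longleftrightarrow> okP p q X \<and> p = a \<and> q = b"
| "ball2 a b c (MV p q X) \<longleftrightarrow> okM p q X \<and>
     (p = a \<and> on b (slot X 3) \<and> (\<forall>i\<in>{0,1,2}. full a b c (slot X i)) \<or>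
      q = a \<and> on b (slot X 3) \<and> (\<forall>i\<in>{6,5,4}. full a b c (slot X i)) \<or>
      p = a \<and> q = b \<and> full a b c (slot X 3))"
| "ball2 a b c _ \<longleftrightarrow> False"

text \<open>For \<open>PV\<close> the identity of the two vectors is forgotten as soon as the slots
  carry enough information about \<open>a\<close>, \<open>b\<close>, \<open>c\<close>. The fourth
  alternative stems from a switch edge, which forgets the array and keeps only one coordinate of
  it.\<close>

fun ball3 :: "nat \<Rightarrow> nat \<Rightarrow> nat \<Rightarrow> vtx \<Rightarrow> bool" where
  "ball3 a b c (TV p q r) \<longleftrightarrow> p = a \<and> q = b"
| "ball3 a b c (PV p q X) \<longleftrightarrow> okP p q X \<and>
     (p = a \<and> q = b \<or>
      (\<forall>i\<in>{0,1,2}. full a b c (slot X i)) \<and> (\<forall>i\<in>{0,1,2,3,4}. on a (slot X i)) \<or>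
      (\<forall>i\<in>{6,5,4}. full a b c (slot X i)) \<and> (\<forall>i\<in>{6,5,4,3,2}. on a (slot X i)) \<or>
      (\<exists>x. full a b c x \<and> (p = a \<and> on q x \<or> q = a \<and> on p x)) \<or>
      full a b c (slot X 3))"
| "ball3 a b c (MV p q X) \<longleftrightarrow> okM p q X \<and>
     ((p = a \<or> q = a) \<and> on b (slot X 3) \<or> p = a \<and> q = b)"
| "ball3 a b c (HB h) \<longleftrightarrow> h = marked a"
| "ball3 a b c (JV j) \<longleftrightarrow> False"

lemmas ok_defs = full_def okP_def okT_def okM_def

lemma ball1_step: "(TV a b c, v) \<in> adj \<Longrightarrow> ball1 a b c v"
  unfolding adj_def mem_Collect_eq split_conv by (elim disjE; erule edge.cases; simp)

text \<open>From the vertices of \<open>ball1\<close> a hub can only be reached through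
  \<open>PV unit unit X\<close>; this is what \<open>a \<noteq> unit\<close> rules out.\<close>

lemma ball2_step:
  assumes "a \<noteq> unit" "ball1 a b c u" "(u, v) \<in> adj"
  shows "ball2 a b c v"
  using assms unfolding adj_def mem_Collect_eq split_conv
  by (elim disjE; elim edge.cases; simp; auto simp: ok_defs reversed_def all_less_7)

lemma ball3_PM:
  assumes "ball2 a b c (MV p q X)" "okP p r X"
  shows "ball3 a b c (PV p r X)"
proof -
  consider "p = a" "\<forall>i\<in>{0,1,2}. full a b c (slot X i)" | "q = a" "\<forall>i\<in>{6,5,4}. full a b c (slot X i)"
    | "full a b c (slot X 3)" using assms(1) by auto
  then show ?thesis using assms by cases (simp_all add: okM_def)
qed

lemma ball3_PM_rev:
  assumes "ball2 a b c (MV p q X)" "okP q r Y" "reversed Y X"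
  shows "ball3 a b c (PV q r Y)"
proof -
  have rev: "slot Y 0 = slot X 6" "slot Y 1 = slot X 5" "slot Y 2 = slot X 4" "slot Y 3 = slot X 3"
    "slot Y 4 = slot X 2" "slot Y 5 = slot X 1" "slot Y 6 = slot X 0"
    using assms(3) unfolding reversed_def all_less_7 by simp_all
  consider "p = a" "\<forall>i\<in>{0,1,2}. full a b c (slot X i)" | "q = a" "\<forall>i\<in>{6,5,4}. full a b c (slot X i)"
    | "full a b c (slot X 3)" using assms(1) by auto
  then show ?thesis
    using assms(1,2) unfolding ball2.simps ball3.simps okM_def by cases (simp_all add: rev[simplified])
qed

lemma ball3_PM_switch:
  assumes "ball2 a b c (MV p q X)" "okP p q Y"
  shows "ball3 a b c (PV p q Y)"
proof -
  consider "p = a" "full a b c (slot X 2)" "on q (slot X 2)" | "q = a" "full a b c (slot X 4)" "on p (slot X 4)"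
    | "p = a" "q = b" using assms(1) by (auto simp: okM_def)
  then show ?thesis using assms(2) by cases auto
qed

text \<open>A hub is entered from some \<open>MV unit q X\<close>. Since
  \<open>a \<noteq> unit\<close>, the description of \<open>ball2\<close> leaves only
  \<open>q = a\<close>, so it is the hub with the mark of \<open>a\<close>.\<close>

lemma ball3_step:
  assumes "a \<noteq> unit" "ball2 a b c u" "(u, v) \<in> adj"
  shows "ball3 a b c v"
proof -
  consider "edge u v" | "edge v u" using assms(3) by (auto simp: adj_def)
  then show ?thesis
  proof cases
    case 1
    then show ?thesis using assms(1,2)
      by (elim edge.cases) (simp, auto simp: okP_def okM_def reversed_def all_less_7)
  next
    case 2
    then show ?thesis using assms(1,2)
    proof cases
      case PM
      then show ?thesis using ball3_PM assms(2) by blast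
    next
      case PM_rev
      then show ?thesis using ball3_PM_rev assms(2) by blast
    next
      case PM_switch
      then show ?thesis using ball3_PM_switch assms(2) by blast
    qed (use assms(1,2) in auto)
  qed
qed

text \<open>Either the two descriptions name different vectors for the same position, or they yield
  a coordinate at which all four vectors are on. For \<open>MV\<close> this is slot 3: the two
  vectors of the vertex must be \<open>a\<close> and \<open>d\<close>, both on there by
  \<open>okM\<close>, and the balls contribute \<open>b\<close> and \<open>c\<close>. For
  \<open>PV\<close> the coordinate depends on the pair of alternatives; slots 4 and 5 are both kept
  because only the first vector is tested at slot 4 and only the second at slot 5.\<close>

lemma balls_disjoint:
  assumes orth: "\<And>x. \<not> (on a x \<and> on b x \<and> on c x \<and> on d x)"
    and ne: "a \<noteq> b" "a \<noteq> c" "a \<noteq> d" "b \<noteq> c" "b \<noteq> d" "c \<noteq> d"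
    and marked: "marked a \<noteq> marked d"
  shows "\<not> (ball3 a b c v \<and> ball3 d c b v)"
proof (cases v)
  case (PV p q X)
  note o = orth[of "slot X 0"] orth[of "slot X 2"] orth[of "slot X 3"] orth[of "slot X 4"] orth[of "slot X 5"]
  show ?thesis
  proof
    assume asm: "ball3 a b c v \<and> ball3 d c b v"
    then have ok: "on p (slot X 0)" "on p (slot X 2)" "on p (slot X 3)" "on p (slot X 4)"
      "on q (slot X 0)" "on q (slot X 2)" "on q (slot X 3)" "on q (slot X 5)"
      by (auto simp: PV okP_def)
    consider (A1) "p = a" "q = b" | (A2) "full a b c (slot X 0)" "full a b c (slot X 2)" "on a (slot X 3)" "on a (slot X 4)"
      | (A3) "full a b c (slot X 4)" "full a b c (slot X 5)" "on a (slot X 2)" "on a (slot X 3)"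
      | (A4) x where "full a b c x" "p = a \<and> on q x \<or> q = a \<and> on p x"
      | (A5) "full a b c (slot X 3)"
      using asm PV by auto
    note A = this
    consider (B1) "p = d" "q = c" | (B2) "full d c b (slot X 0)" "full d c b (slot X 2)" "on d (slot X 3)" "on d (slot X 4)"
      | (B3) "full d c b (slot X 4)" "full d c b (slot X 5)" "on d (slot X 2)" "on d (slot X 3)"
      | (B4) y where "full d c b y" "p = d \<and> on q y \<or> q = d \<and> on p y"
      | (B5) "full d c b (slot X 3)"
      using asm PV by auto
    note B = this
    show False
    proof (rule A)
      assume "p = a" "q = b"
      then show False using ne ok o by - (rule B; auto simp: full_def)
    next
      assume "full a b c (slot X 0)" "full a b c (slot X 2)" "on a (slot X 3)" "on a (slot X 4)"
      then show False using ne ok o by - (rule B; auto simp: full_def)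
    next
      assume "full a b c (slot X 4)" "full a b c (slot X 5)" "on a (slot X 2)" "on a (slot X 3)"
      then show False using ne ok o by - (rule B; auto simp: full_def)
    next
      fix x assume "full a b c x" "p = a \<and> on q x \<or> q = a \<and> on p x"
      then show False using ne ok o orth[of x] by - (rule B; auto simp: full_def)
    next
      assume "full a b c (slot X 3)"
      then show False using ne ok o by - (rule B; auto simp: full_def)
    qed
  qed
next
  case (MV p q X)
  show ?thesis
    using orth[of "slot X 3"] ne unfolding MV ball3.simps by (auto simp: okM_def)
qed (use ne marked in auto)

text \<open>A walk of at most six steps contains a vertex within three steps of both ends, which
  would lie in both balls.\<close>

lemma far:
  assumes orth: "\<And>x. \<not> (on a x \<and> on b x \<and> on c x \<and> on d x)"
    and ne: "a \<noteq> b" "a \<noteq> c" "a \<noteq> d" "b \<noteq> c" "b \<noteq> d" "c \<noteq> d" "a \<noteq> unit" "d \<noteq> unit"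
    and marked: "marked a \<noteq> marked d"
    and "k < 7"
  shows "(TV a b c, TV d c b) \<notin> adj ^^ k"
proof
  have ball: "ball3 a b c v" if a: "a \<noteq> unit" and k: "k \<le> 3" and v: "(TV a b c, v) \<in> adj ^^ k" for a b c k v
  proof -
    have 12: "ball1 a b c u \<Longrightarrow> ball2 a b c u" "ball2 a b c u \<Longrightarrow> ball3 a b c u" for u
      by (cases u; auto simp: okP_def)+
    have 0: "ball1 a b c (TV a b c)" by simp
    consider "k = 0" | "k = 1" | "k = 2" | "k = 3" using k by linarith
    then show ?thesis
    proof cases
      case 1
      then show ?thesis using v 0 12 by auto
    next
      case 2
      then show ?thesis using v ball1_step 12 by auto
    next
      case 3
      then show ?thesis using v ball1_step ball2_step[OF a] 12 by (auto simp: numeral_2_eq_2) blast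
    next
      case 4
      then show ?thesis using v ball1_step ball2_step[OF a] ball3_step[OF a]
        by (auto simp: numeral_3_eq_3) blast
    qed
  qed
  assume walk: "(TV a b c, TV d c b) \<in> adj ^^ k"
  obtain i j where ij: "k = i + j" "i \<le> 3" "j \<le> 3"
    using \<open>k < 7\<close> that[of "min k 3" "k - min k 3"] by auto
  then obtain w where "(TV a b c, w) \<in> adj ^^ i" "(w, TV d c b) \<in> adj ^^ j"
    using walk by (auto simp: relpow_add)
  then have "ball3 a b c w" "ball3 d c b w"
    using ball ij ne relpow_adj_sym by blast+
  then show False using balls_disjoint[OF orth ne(1-6) marked] by blast
qed

end

section \<open>A structured language for the word RAM\<close>

type_synonym store = "nat \<Rightarrow> nat"

datatype expr = Cn nat | Vr nat | Op binop expr expr | Ld expr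

fun ev :: "nat \<Rightarrow> store \<Rightarrow> store \<Rightarrow> expr \<Rightarrow> nat" where
  "ev w s m (Cn c) = take_bit w c"
| "ev w s m (Vr x) = s x"
| "ev w s m (Op f a b) = binop_val w f (ev w s m a) (ev w s m b)"
| "ev w s m (Ld a) = m (ev w s m a)"

datatype com = Skip | Assign nat expr | Sto expr expr | Seq com com | If expr com com | While expr com

fun elen :: "expr \<Rightarrow> nat" where
  "elen (Cn c) = 1"
| "elen (Vr x) = 1"
| "elen (Op f a b) = elen a + elen b + 1"
| "elen (Ld a) = elen a + 1"

text \<open>The number is the exact step count of the compiled code: the guard costs two
  instructions beyond its expression, and a taken branch or loop body ends with one more
  jump.\<close>

inductive big :: "nat \<Rightarrow> com \<Rightarrow> store \<Rightarrow> store \<Rightarrow> nat \<Rightarrow> store \<Rightarrow> store \<Rightarrow> bool"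
  for w where
  Skip: "big w Skip s m 0 s m"
| Assign: "big w (Assign x e) s m (elen e + 1) (s(x := ev w s m e)) m"
| Sto: "big w (Sto a e) s m (elen a + elen e + 1) s (m(ev w s m a := ev w s m e))"
| Seq: "big w c s m t s' m' \<Longrightarrow> big w d s' m' t' s'' m'' \<Longrightarrow> big w (Seq c d) s m (t + t') s'' m''"
| IfT: "ev w s m e \<noteq> 0 \<Longrightarrow> big w c s m t s' m' \<Longrightarrow> big w (If e c d) s m (elen e + 3 + t) s' m'"
| IfF: "ev w s m e = 0 \<Longrightarrow> big w d s m t s' m' \<Longrightarrow> big w (If e c d) s m (elen e + 2 + t) s' m'"
| WhileF: "ev w s m e = 0 \<Longrightarrow> big w (While e c) s m (elen e + 2) s m"
| WhileT: "ev w s m e \<noteq> 0 \<Longrightarrow> big w c s m t s' m' \<Longrightarrow> big w (While e c) s' m' t' s'' m'' \<Longrightarrow>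
    big w (While e c) s m (elen e + 3 + t + t') s'' m''"

text \<open>
  Registers 0 and 1 are the variables 0 and 1; the other variables and the temporaries live
  beyond the \<open>K\<close> registers reserved for the simulated program.
\<close>

definition var :: "nat \<Rightarrow> nat \<Rightarrow> nat" where
  "var K x = (if x < 2 then x else K + 2 * x)"

definition tmp :: "nat \<Rightarrow> nat \<Rightarrow> nat" where
  "tmp K j = K + 2 * j + 1"

section \<open>Compilation to machine code\<close>

fun comp_expr :: "nat \<Rightarrow> expr \<Rightarrow> nat \<Rightarrow> instr list" where
  "comp_expr K (Cn c) j = [Const (tmp K j) c]"
| "comp_expr K (Vr x) j = [Arith BOR (tmp K j) (var K x) (var K x)]"
| "comp_expr K (Op f a b) j =
     comp_expr K a j @ comp_expr K b (j + 1) @ [Arith f (tmp K j) (tmp K j) (tmp K (j + 1))]"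
| "comp_expr K (Ld a) j = comp_expr K a j @ [Load (tmp K j) (tmp K j)]"

fun clen :: "com \<Rightarrow> nat" where
  "clen Skip = 0"
| "clen (Assign x e) = elen e + 1"
| "clen (Sto a e) = elen a + elen e + 1"
| "clen (Seq c d) = clen c + clen d"
| "clen (If e c d) = elen e + clen c + clen d + 3"
| "clen (While e c) = elen e + clen c + 3"

text \<open>The position \<open>p\<close> is a parameter because jump targets are absolute. The
  machine only compares with \<open><\<close>, so a guard is tested for being less than 1, and
  \<open>BOR\<close> of a register with itself serves as a move.\<close>

fun comp :: "nat \<Rightarrow> nat \<Rightarrow> com \<Rightarrow> instr list" where
  "comp K p Skip = []"
| "comp K p (Assign x e) = comp_expr K e 0 @ [Arith BOR (var K x) (tmp K 0) (tmp K 0)]"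
| "comp K p (Sto a e) = comp_expr K a 0 @ comp_expr K e 1 @ [Store (tmp K 0) (tmp K 1)]"
| "comp K p (Seq c d) = comp K p c @ comp K (p + clen c) d"
| "comp K p (If e c d) = comp_expr K e 0 @
     [Const (tmp K 1) 1, JumpIfLess (tmp K 0) (tmp K 1) (p + elen e + clen c + 3)] @
     comp K (p + elen e + 2) c @ [Jump (p + elen e + clen c + clen d + 3)] @
     comp K (p + elen e + clen c + 3) d"
| "comp K p (While e c) = comp_expr K e 0 @
     [Const (tmp K 1) 1, JumpIfLess (tmp K 0) (tmp K 1) (p + elen e + clen c + 3)] @
     comp K (p + elen e + 2) c @ [Jump p]"

lemma length_comp_expr [simp]: "length (comp_expr K e j) = elen e"
  by (induction K e j rule: comp_expr.induct) auto

lemma length_comp [simp]: "length (comp K p c) = clen c"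
  by (induction K p c rule: comp.induct) auto

definition code_at :: "program \<Rightarrow> nat \<Rightarrow> instr list \<Rightarrow> bool" where
  "code_at P p is \<longleftrightarrow> (\<forall>i<length is. p + i < length P \<and> P ! (p + i) = is ! i)"

lemma code_at_Nil [simp]: "code_at P p []"
  by (simp add: code_at_def)

lemma code_at_append [simp]:
  "code_at P p (is @ js) \<longleftrightarrow> code_at P p is \<and> code_at P (p + length is) js"
proof -
  have *: "(\<forall>i<length is + length js. Q i) \<longleftrightarrow> (\<forall>i<length is. Q i) \<and> (\<forall>i<length js. Q (length is + i))" for Q
  proof (intro iffI conjI allI impI)
    fix i assume *: "(\<forall>i<length is. Q i) \<and> (\<forall>i<length js. Q (length is + i))" "i < length is + length js"
    show "Q i"
    proof (cases "i < length is")
      case False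
      then have "i - length is < length js" "i = length is + (i - length is)" using *(2) by auto
      then show ?thesis using *(1) by metis
    qed (use * in auto)
  qed auto
  show ?thesis unfolding code_at_def length_append * by (simp add: nth_append add.assoc)
qed

lemma code_at_Cons [simp]:
  "code_at P p (i # is) \<longleftrightarrow> p < length P \<and> P ! p = i \<and> code_at P (p + 1) is"
  using code_at_append[of P p "[i]" "is"] by (simp add: code_at_def)

lemma code_at_self: "code_at (xs @ is @ ys) (length xs) is"
  by (auto simp: code_at_def nth_append)

definition reach :: "program \<Rightarrow> nat \<Rightarrow> nat \<Rightarrow> ram_state \<Rightarrow> ram_state \<Rightarrow> bool" where
  "reach P w t st st' \<longleftrightarrow> (step P w ^^ t) st = st'"

lemma reach_0 [intro]: "reach P w 0 st st"
  by (simp add: reach_def)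

lemma reach_trans: "reach P w t st st' \<Longrightarrow> reach P w t' st' st'' \<Longrightarrow> reach P w (t + t') st st''"
  unfolding reach_def by (metis add.commute comp_apply funpow_add)

lemma reach_step: "pc st < length P \<Longrightarrow> P ! pc st = i \<Longrightarrow> reach P w 1 st (exec_instr w i st)"
  by (simp add: reach_def step_def halted_def)

lemma exec_instr_fields [simp]:
  "pc (exec_instr w (Const r c) st) = pc st + 1" "mem (exec_instr w (Const r c) st) = mem st"
  "regs (exec_instr w (Const r c) st) = (regs st)(r := take_bit w c)"
  "pc (exec_instr w (Arith f r a b) st) = pc st + 1" "mem (exec_instr w (Arith f r a b) st) = mem st"
  "regs (exec_instr w (Arith f r a b) st) = (regs st)(r := binop_val w f (regs st a) (regs st b))"
  "pc (exec_instr w (Load r a) st) = pc st + 1" "mem (exec_instr w (Load r a) st) = mem st"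
  "regs (exec_instr w (Load r a) st) = (regs st)(r := mem st (regs st a))"
  "pc (exec_instr w (Store a r) st) = pc st + 1"
  "mem (exec_instr w (Store a r) st) = (mem st)(regs st a := regs st r)"
  "regs (exec_instr w (Store a r) st) = regs st"
  "pc (exec_instr w (Jump l) st) = l" "mem (exec_instr w (Jump l) st) = mem st"
  "regs (exec_instr w (Jump l) st) = regs st"
  "pc (exec_instr w (JumpIfLess a b l) st) = (if regs st a < regs st b then l else pc st + 1)"
  "mem (exec_instr w (JumpIfLess a b l) st) = mem st" "regs (exec_instr w (JumpIfLess a b l) st) = regs st"
  by simp_all

declare exec_instr.simps [simp del]

definition agree :: "nat \<Rightarrow> store \<Rightarrow> store \<Rightarrow> bool" where
  "agree K s R \<longleftrightarrow> (\<forall>x. R (var K x) = s x)"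

text \<open>The simulated program must find its registers at their initial value, so compiled code
  has to leave the reserved ones alone. Registers 0 and 1 are exempt, being variables.\<close>

definition same_low :: "nat \<Rightarrow> store \<Rightarrow> store \<Rightarrow> bool" where
  "same_low K R R' \<longleftrightarrow> (\<forall>r. 2 \<le> r \<longrightarrow> r < K \<longrightarrow> R' r = R r)"

context
  fixes K :: nat
  assumes K: "2 \<le> K"
begin

lemma tmp_inj [simp]: "tmp K i = tmp K j \<longleftrightarrow> i = j"
  by (simp add: tmp_def)

lemma var_inj [simp]: "var K x = var K y \<longleftrightarrow> x = y"
  using K by (auto simp: var_def)

lemma var_neq_tmp [simp]: "var K x \<noteq> tmp K j"
proof -
  have "K + 2 * x \<noteq> K + 2 * j + 1" by presburger
  then show ?thesis using K by (auto simp: var_def tmp_def)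
qed

lemma tmp_neq_var [simp]: "tmp K j \<noteq> var K x"
  using var_neq_tmp[of x j] by metis

lemma same_low_tmp [simp]: "same_low K R (R'(tmp K j := v)) \<longleftrightarrow> same_low K R R'"
  by (auto simp: same_low_def tmp_def)

lemma same_low_var [simp]: "same_low K R (R'(var K x := v)) \<longleftrightarrow> same_low K R R'"
  using K by (auto simp: same_low_def var_def)

lemma agreeD: "agree K s (regs st) \<Longrightarrow> regs st (var K x) = s x"
  by (simp add: agree_def)

lemma agree_tmp [simp]: "agree K s (R(tmp K j := v)) \<longleftrightarrow> agree K s R"
  by (simp add: agree_def)

lemma agree_var: "agree K s R \<Longrightarrow> agree K (s(x := v)) (R(var K x := v))"
  by (simp add: agree_def)

lemma same_low_refl [simp]: "same_low K R R"
  by (simp add: same_low_def)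

lemma same_low_trans: "same_low K R R' \<Longrightarrow> same_low K R' R'' \<Longrightarrow> same_low K R R''"
  by (simp add: same_low_def)

definition expr_result where
  "expr_result P w s e j st st' \<longleftrightarrow> reach P w (elen e) st st' \<and> pc st' = pc st + elen e \<and>
    mem st' = mem st \<and> regs st' (tmp K j) = ev w s (mem st) e \<and> agree K s (regs st') \<and>
    same_low K (regs st) (regs st') \<and> (\<forall>i<j. regs st' (tmp K i) = regs st (tmp K i))"

definition com_result where
  "com_result P w t c s' m' st st' \<longleftrightarrow> reach P w t st st' \<and> pc st' = pc st + clen c \<and> mem st' = m' \<and>
    agree K s' (regs st') \<and> same_low K (regs st) (regs st')"

text \<open>Temporaries form a stack: evaluation at depth \<open>j\<close> preserves those below
  \<open>j\<close>, so the left operand survives while the right one is computed.\<close>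

lemma comp_expr_correct:
  assumes "code_at P (pc st) (comp_expr K e j)" "agree K s (regs st)"
  shows "\<exists>st'. expr_result P w s e j st st'"
  using assms
proof (induction e arbitrary: j st)
  case (Cn c)
  have "reach P w 1 st (exec_instr w (Const (tmp K j) c) st)"
    by (rule reach_step) (use Cn in auto)
  then show ?case using Cn
    by (intro exI[of _ "exec_instr w (Const (tmp K j) c) st"], unfold expr_result_def) (simp_all add: agreeD agree_var)
next
  case (Vr x)
  let ?i = "Arith BOR (tmp K j) (var K x) (var K x)"
  have "reach P w 1 st (exec_instr w ?i st)"
    by (rule reach_step) (use Vr in auto)
  then show ?case using Vr
    by (intro exI[of _ "exec_instr w ?i st"], unfold expr_result_def) (simp_all add: agreeD agree_var)
next
  case (Op f a b)
  from Op.prems have code: "code_at P (pc st) (comp_expr K a j)"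
    "code_at P (pc st + elen a) (comp_expr K b (j + 1))"
    "pc st + elen a + elen b < length P"
    "P ! (pc st + elen a + elen b) = Arith f (tmp K j) (tmp K j) (tmp K (j + 1))" by (auto simp: add.assoc)
  let ?i = "Arith f (tmp K j) (tmp K j) (tmp K (j + 1))"
  from Op.IH(1)[OF code(1) Op.prems(2)] obtain st1 where
    1: "reach P w (elen a) st st1" "pc st1 = pc st + elen a" "mem st1 = mem st"
    "regs st1 (tmp K j) = ev w s (mem st) a" "agree K s (regs st1)" "same_low K (regs st) (regs st1)"
    "\<forall>i<j. regs st1 (tmp K i) = regs st (tmp K i)" unfolding expr_result_def by blast
  have "code_at P (pc st1) (comp_expr K b (j + 1))" using code(2) 1(2) by simp
  from Op.IH(2)[OF this 1(5)] obtain st2 where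
    2: "reach P w (elen b) st1 st2" "pc st2 = pc st1 + elen b" "mem st2 = mem st1"
    "regs st2 (tmp K (j + 1)) = ev w s (mem st1) b" "agree K s (regs st2)" "same_low K (regs st1) (regs st2)"
    "\<forall>i<j + 1. regs st2 (tmp K i) = regs st1 (tmp K i)" unfolding expr_result_def by blast
  have "reach P w 1 st2 (exec_instr w ?i st2)"
    by (rule reach_step) (use 1 2 code in auto)
  from reach_trans[OF reach_trans[OF 1(1) 2(1)] this]
  have "reach P w (elen (Op f a b)) st (exec_instr w ?i st2)" by simp
  then show ?case using 1 2 same_low_trans[OF 1(6) 2(6)]
    by (intro exI[of _ "exec_instr w ?i st2"], unfold expr_result_def) (simp_all add: agreeD agree_var)
next
  case (Ld a)
  let ?i = "Load (tmp K j) (tmp K j)"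
  from Ld.prems have code: "code_at P (pc st) (comp_expr K a j)"
    "pc st + elen a < length P" "P ! (pc st + elen a) = ?i" by auto
  from Ld.IH[OF code(1) Ld.prems(2)] obtain st1 where
    1: "reach P w (elen a) st st1" "pc st1 = pc st + elen a" "mem st1 = mem st"
    "regs st1 (tmp K j) = ev w s (mem st) a" "agree K s (regs st1)" "same_low K (regs st) (regs st1)"
    "\<forall>i<j. regs st1 (tmp K i) = regs st (tmp K i)" unfolding expr_result_def by blast
  have "reach P w 1 st1 (exec_instr w ?i st1)"
    by (rule reach_step) (use 1 code in auto)
  from reach_trans[OF 1(1) this]
  have "reach P w (elen (Ld a)) st (exec_instr w ?i st1)" by simp
  then show ?case using 1
    by (intro exI[of _ "exec_instr w ?i st1"], unfold expr_result_def) (simp_all add: agreeD agree_var)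
qed

lemma comp_guard:
  assumes "code_at P (pc st) (comp_expr K e 0)"
    "code_at P (pc st + elen e) [Const (tmp K 1) 1, JumpIfLess (tmp K 0) (tmp K 1) l]"
    "agree K s (regs st)" "1 \<le> w"
  shows "\<exists>st'. reach P w (elen e + 2) st st' \<and>
    pc st' = (if ev w s (mem st) e = 0 then l else pc st + elen e + 2) \<and> mem st' = mem st \<and>
    agree K s (regs st') \<and> same_low K (regs st) (regs st')"
proof -
  from comp_expr_correct[OF assms(1,3)] obtain st1 where
    1: "reach P w (elen e) st st1" "pc st1 = pc st + elen e" "mem st1 = mem st"
    "regs st1 (tmp K 0) = ev w s (mem st) e" "agree K s (regs st1)" "same_low K (regs st) (regs st1)"
    unfolding expr_result_def by blast
  define st2 where "st2 = exec_instr w (Const (tmp K 1) 1) st1"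
  define st3 where "st3 = exec_instr w (JumpIfLess (tmp K 0) (tmp K 1) l) st2"
  have 2: "reach P w 1 st1 st2"
    unfolding st2_def by (rule reach_step) (use 1 assms(2) in auto)
  have 3: "reach P w 1 st2 st3"
    unfolding st3_def by (rule reach_step) (use 1 assms(2) in \<open>auto simp: st2_def\<close>)
  have "take_bit w (Suc 0) = 1" using \<open>1 \<le> w\<close> by (simp add: take_bit_Suc_0)
  then have "pc st3 = (if ev w s (mem st) e = 0 then l else pc st + elen e + 2)"
    using 1 by (simp add: st3_def st2_def)
  moreover have "mem st3 = mem st" "agree K s (regs st3)" "same_low K (regs st) (regs st3)"
    using 1 by (simp_all add: st3_def st2_def)
  moreover from reach_trans[OF 1(1) reach_trans[OF 2 3]]
  have "reach P w (elen e + 2) st st3" by simp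
  ultimately show ?thesis by blast
qed

lemma comp_correct:
  assumes "big w c s m t s' m'" and "1 \<le> w"
    and "code_at P (pc st) (comp K (pc st) c)" "agree K s (regs st)" "mem st = m"
  shows "\<exists>st'. com_result P w t c s' m' st st'"
  using assms
proof (induction arbitrary: st rule: big.induct)
  case (Skip s m)
  then show ?case by (intro exI[of _ st]) (simp add: com_result_def reach_0)
next
  case (Assign x e s m)
  let ?i = "Arith BOR (var K x) (tmp K 0) (tmp K 0)"
  from Assign have code: "code_at P (pc st) (comp_expr K e 0)" "pc st + elen e < length P"
    "P ! (pc st + elen e) = ?i" by auto
  from comp_expr_correct[OF code(1) Assign(3)] obtain st1 where
    1: "reach P w (elen e) st st1" "pc st1 = pc st + elen e" "mem st1 = mem st"
    "regs st1 (tmp K 0) = ev w s (mem st) e" "agree K s (regs st1)" "same_low K (regs st) (regs st1)"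
    unfolding expr_result_def by blast
  have "reach P w 1 st1 (exec_instr w ?i st1)"
    by (rule reach_step) (use 1 code in auto)
  from reach_trans[OF 1(1) this] have "reach P w (elen e + 1) st (exec_instr w ?i st1)" .
  then show ?case using 1 Assign(4)
    by (intro exI[of _ "exec_instr w ?i st1"], unfold com_result_def) (simp_all add: agreeD agree_var)
next
  case (Sto a e s m)
  let ?i = "Store (tmp K 0) (tmp K 1)"
  from Sto have code: "code_at P (pc st) (comp_expr K a 0)" "code_at P (pc st + elen a) (comp_expr K e 1)"
    "pc st + elen a + elen e < length P"
    "P ! (pc st + elen a + elen e) = ?i" by (auto simp: add.assoc)
  from comp_expr_correct[OF code(1) Sto(3)] obtain st1 where
    1: "reach P w (elen a) st st1" "pc st1 = pc st + elen a" "mem st1 = mem st"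
    "regs st1 (tmp K 0) = ev w s (mem st) a" "agree K s (regs st1)" "same_low K (regs st) (regs st1)"
    unfolding expr_result_def by blast
  have "code_at P (pc st1) (comp_expr K e 1)" using code(2) 1(2) by simp
  from comp_expr_correct[OF this 1(5)] obtain st2 where
    2: "reach P w (elen e) st1 st2" "pc st2 = pc st1 + elen e" "mem st2 = mem st1"
    "regs st2 (tmp K 1) = ev w s (mem st1) e" "agree K s (regs st2)" "same_low K (regs st1) (regs st2)"
    "\<forall>i<1. regs st2 (tmp K i) = regs st1 (tmp K i)" unfolding expr_result_def by blast
  have "reach P w 1 st2 (exec_instr w ?i st2)"
    by (rule reach_step) (use 1 2 code in auto)
  from reach_trans[OF reach_trans[OF 1(1) 2(1)] this]
  have "reach P w (elen a + elen e + 1) st (exec_instr w ?i st2)" .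
  then show ?case using 1 2 Sto(4) same_low_trans[OF 1(6) 2(6)]
    by (intro exI[of _ "exec_instr w ?i st2"], unfold com_result_def) (simp_all add: agreeD agree_var)
next
  case (Seq c s m t s' m' d t' s'' m'')
  from Seq.prems have code: "code_at P (pc st) (comp K (pc st) c)"
    "code_at P (pc st + clen c) (comp K (pc st + clen c) d)" by auto
  from Seq.IH(1)[OF \<open>1 \<le> w\<close> code(1) Seq.prems(3,4)] obtain st1 where
    1: "reach P w t st st1" "pc st1 = pc st + clen c" "mem st1 = m'" "agree K s' (regs st1)"
    "same_low K (regs st) (regs st1)" unfolding com_result_def by blast
  have "code_at P (pc st1) (comp K (pc st1) d)" using code(2) 1(2) by simp
  from Seq.IH(2)[OF \<open>1 \<le> w\<close> this 1(4,3)] obtain st2 where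
    2: "reach P w t' st1 st2" "pc st2 = pc st1 + clen d" "mem st2 = m''" "agree K s'' (regs st2)"
    "same_low K (regs st1) (regs st2)" unfolding com_result_def by blast
  show ?case using reach_trans[OF 1(1) 2(1)] 1 2 same_low_trans[OF 1(5) 2(5)]
    by (intro exI[of _ st2], unfold com_result_def) simp
next
  case (IfT s m e c t s' m' d)
  let ?q = "pc st + elen e"
  have code: "code_at P (pc st) (comp_expr K e 0)" "code_at P ?q [Const (tmp K 1) 1,
      JumpIfLess (tmp K 0) (tmp K 1) (pc st + elen e + clen c + 3)]"
    "code_at P (?q + 2) (comp K (?q + 2) c)"
    "?q + 2 + clen c < length P" "P ! (?q + 2 + clen c) = Jump (pc st + elen e + clen c + clen d + 3)"
    using IfT.prems(2) by (auto simp: add.assoc)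
  from comp_guard[OF code(1,2) IfT.prems(3,1)] obtain st1 where
    1: "reach P w (elen e + 2) st st1"
    "pc st1 = (if ev w s (mem st) e = 0 then pc st + elen e + clen c + 3 else ?q + 2)"
    "mem st1 = mem st" "agree K s (regs st1)" "same_low K (regs st) (regs st1)" by blast
  have pc1: "pc st1 = ?q + 2" using 1(2) IfT by simp
  have "code_at P (pc st1) (comp K (pc st1) c)" using code(3) pc1 by simp
  have "mem st1 = m" using 1(3) IfT.prems(4) by simp
  from IfT.IH[OF \<open>1 \<le> w\<close> \<open>code_at P (pc st1) _\<close> 1(4) this] obtain st2 where
    2: "reach P w t st1 st2" "pc st2 = pc st1 + clen c" "mem st2 = m'" "agree K s' (regs st2)"
    "same_low K (regs st1) (regs st2)" unfolding com_result_def by blast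
  let ?i = "Jump (pc st + elen e + clen c + clen d + 3)"
  have "reach P w 1 st2 (exec_instr w ?i st2)"
    by (rule reach_step) (use pc1 2 code in auto)
  from reach_trans[OF reach_trans[OF 1(1) 2(1)] this]
  have "reach P w (elen e + 3 + t) st (exec_instr w ?i st2)" by (simp add: algebra_simps numeral_3_eq_3)
  then show ?case using 2 same_low_trans[OF 1(5) 2(5)]
    by (intro exI[of _ "exec_instr w ?i st2"], unfold com_result_def) auto
next
  case (IfF s m e d t s' m' c)
  let ?q = "pc st + elen e"
  have code: "code_at P (pc st) (comp_expr K e 0)" "code_at P ?q [Const (tmp K 1) 1,
      JumpIfLess (tmp K 0) (tmp K 1) (pc st + elen e + clen c + 3)]"
    "code_at P (?q + clen c + 3) (comp K (?q + clen c + 3) d)"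
    using IfF.prems(2) by (auto simp: algebra_simps numeral_3_eq_3)
  from comp_guard[OF code(1,2) IfF.prems(3,1)] obtain st1 where
    1: "reach P w (elen e + 2) st st1"
    "pc st1 = (if ev w s (mem st) e = 0 then pc st + elen e + clen c + 3 else ?q + 2)"
    "mem st1 = mem st" "agree K s (regs st1)" "same_low K (regs st) (regs st1)" by blast
  have pc1: "pc st1 = ?q + clen c + 3" using 1(2) IfF by simp
  have "code_at P (pc st1) (comp K (pc st1) d)" using code(3) pc1 by simp
  have "mem st1 = m" using 1(3) IfF.prems(4) by simp
  from IfF.IH[OF \<open>1 \<le> w\<close> \<open>code_at P (pc st1) _\<close> 1(4) this] obtain st2 where
    2: "reach P w t st1 st2" "pc st2 = pc st1 + clen d" "mem st2 = m'" "agree K s' (regs st2)"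
    "same_low K (regs st1) (regs st2)" unfolding com_result_def by blast
  from reach_trans[OF 1(1) 2(1)] show ?case using 2 pc1 same_low_trans[OF 1(5) 2(5)]
    by (intro exI[of _ st2], unfold com_result_def) auto
next
  case (WhileF s m e c)
  let ?q = "pc st + elen e"
  have code: "code_at P (pc st) (comp_expr K e 0)" "code_at P ?q [Const (tmp K 1) 1,
      JumpIfLess (tmp K 0) (tmp K 1) (pc st + elen e + clen c + 3)]"
    using WhileF.prems(2) by auto
  from comp_guard[OF code(1,2) WhileF.prems(3,1)] obtain st1 where
    1: "reach P w (elen e + 2) st st1"
    "pc st1 = (if ev w s (mem st) e = 0 then pc st + elen e + clen c + 3 else ?q + 2)"
    "mem st1 = mem st" "agree K s (regs st1)" "same_low K (regs st) (regs st1)" by blast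
  then show ?case using WhileF by (intro exI[of _ st1], unfold com_result_def) auto
next
  case (WhileT s m e c t s' m' t' s'' m'')
  let ?q = "pc st + elen e"
  have code: "code_at P (pc st) (comp_expr K e 0)" "code_at P ?q [Const (tmp K 1) 1,
      JumpIfLess (tmp K 0) (tmp K 1) (pc st + elen e + clen c + 3)]"
    "code_at P (?q + 2) (comp K (?q + 2) c)"
    "?q + 2 + clen c < length P" "P ! (?q + 2 + clen c) = Jump (pc st)"
    using WhileT.prems(2) by (auto simp: add.assoc)
  from comp_guard[OF code(1,2) WhileT.prems(3,1)] obtain st1 where
    1: "reach P w (elen e + 2) st st1"
    "pc st1 = (if ev w s (mem st) e = 0 then pc st + elen e + clen c + 3 else ?q + 2)"
    "mem st1 = mem st" "agree K s (regs st1)" "same_low K (regs st) (regs st1)" by blast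
  have pc1: "pc st1 = ?q + 2" using 1(2) WhileT by simp
  have "code_at P (pc st1) (comp K (pc st1) c)" using code(3) pc1 by simp
  have "mem st1 = m" using 1(3) WhileT.prems(4) by simp
  from WhileT.IH(1)[OF \<open>1 \<le> w\<close> \<open>code_at P (pc st1) _\<close> 1(4) this] obtain st2 where
    2: "reach P w t st1 st2" "pc st2 = pc st1 + clen c" "mem st2 = m'" "agree K s' (regs st2)"
    "same_low K (regs st1) (regs st2)" unfolding com_result_def by blast
  define st3 where "st3 = exec_instr w (Jump (pc st)) st2"
  have 3: "reach P w 1 st2 st3"
    unfolding st3_def by (rule reach_step) (use pc1 2 code in auto)
  have "code_at P (pc st3) (comp K (pc st3) (While e c))" "agree K s' (regs st3)" "mem st3 = m'"
    using WhileT.prems(2) 2 by (simp_all add: st3_def)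
  from WhileT.IH(2)[OF \<open>1 \<le> w\<close> this] obtain st4 where
    4: "reach P w t' st3 st4" "pc st4 = pc st3 + clen (While e c)" "mem st4 = m''" "agree K s'' (regs st4)"
    "same_low K (regs st3) (regs st4)" unfolding com_result_def by blast
  from reach_trans[OF reach_trans[OF reach_trans[OF 1(1) 2(1)] 3] 4(1)]
  have "reach P w (elen e + 3 + t + t') st st4" by (simp add: algebra_simps numeral_3_eq_3)
  moreover have "same_low K (regs st) (regs st4)"
    using same_low_trans[OF same_low_trans[OF 1(5) 2(5)]] 4(5) by (simp add: st3_def)
  ultimately show ?case using 4 by (intro exI[of _ st4], unfold com_result_def) (simp add: st3_def)
qed

end

section \<open>Simulating a program with shorter words\<close>

fun instr_regs :: "instr \<Rightarrow> nat set" where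
  "instr_regs (Const r c) = {r}"
| "instr_regs (Arith f r a b) = {r, a, b}"
| "instr_regs (Load r a) = {r, a}"
| "instr_regs (Store a r) = {a, r}"
| "instr_regs (Jump l) = {}"
| "instr_regs (JumpIfLess a b l) = {a, b}"

lemma regs_bound: "\<exists>K\<ge>2. \<forall>i\<in>set P. instr_regs i \<subseteq> {..<K}"
proof (induction P)
  case (Cons i P)
  then obtain K where K: "2 \<le> K" "\<forall>i\<in>set P. instr_regs i \<subseteq> {..<K}" by auto
  have "finite (instr_regs i)" by (cases i) auto
  then obtain K' where "instr_regs i \<subseteq> {..<K'}" using finite_nat_iff_bounded by auto
  then have "\<forall>j\<in>set (i # P). instr_regs j \<subseteq> {..<max K K'}" using K
    by (auto simp: less_max_iff_disj subset_iff)
  then show ?case using K(1) by (intro exI[of _ "max K K'"]) auto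
qed auto

text \<open>Every instruction becomes exactly two, padded by an unreachable jump or a harmless
  operation, so that target \<open>q\<close> lies at \<open>p + 2 * q\<close>. Targets beyond the
  program are clamped to its end, whereby halting turns into falling through to the code that
  follows.\<close>

fun sim_instr :: "nat \<Rightarrow> nat \<Rightarrow> nat \<Rightarrow> nat \<Rightarrow> nat \<Rightarrow> instr \<Rightarrow> instr list" where
  "sim_instr K p l mk pb (Const r c) = [Const r c, Arith BAND r r (var K mk)]"
| "sim_instr K p l mk pb (Arith f r a b) = [Arith f r a b, Arith BAND r r (var K mk)]"
| "sim_instr K p l mk pb (Load r a) = [Arith ADD (tmp K 0) a (var K pb), Load r (tmp K 0)]"
| "sim_instr K p l mk pb (Store a r) = [Arith ADD (tmp K 0) a (var K pb), Store (tmp K 0) r]"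
| "sim_instr K p l mk pb (Jump q) = [Jump (p + 2 * min q l), Jump 0]"
| "sim_instr K p l mk pb (JumpIfLess a b q) =
     [JumpIfLess a b (p + 2 * min q l), Arith BAND (tmp K 0) (tmp K 0) (tmp K 0)]"

definition sim_prog :: "nat \<Rightarrow> nat \<Rightarrow> nat \<Rightarrow> nat \<Rightarrow> program \<Rightarrow> program" where
  "sim_prog K p mk pb P = concat (map (sim_instr K p (length P) mk pb) P)"

lemma length_sim_instr [simp]: "length (sim_instr K p l mk pb i) = 2"
  by (cases i) auto

lemma length_sim_prog [simp]: "length (sim_prog K p mk pb P) = 2 * length P"
  unfolding sim_prog_def by (induction P) (auto simp: sum_list_triv length_concat comp_def)

lemma code_at_sim:
  assumes "code_at Q p (concat (map f P))" "\<And>i. length (f i) = 2" "k < length P"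
  shows "code_at Q (p + 2 * k) (f (P ! k))"
  using assms(1,3)
proof (induction P arbitrary: p k)
  case (Cons i P)
  then have c: "code_at Q p (f i)" "code_at Q (p + 2) (concat (map f P))" using assms(2) by auto
  show ?case
  proof (cases k)
    case 0
    then show ?thesis using c by simp
  next
    case (Suc j)
    then show ?thesis using Cons.IH[OF c(2), of j] Cons.prems(2) by simp
  qed
qed simp

lemma and_mask:
  "x AND (2 ^ w - 1 :: nat) = take_bit w x" "x AND (2 ^ w - Suc 0 :: nat) = take_bit w x"
  by (simp_all only: One_nat_def[symmetric] take_bit_eq_mask mask_eq_exp_minus_1)

lemma take_bit_id: "x < 2 ^ w \<Longrightarrow> take_bit w x = (x :: nat)"
  by (simp add: take_bit_nat_eq_self)

text \<open>Sums, products, left shifts and bitwise operations commute with truncation, and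
  quotients, remainders and right shifts do not exceed an operand that is already short. Only
  \<open>SUB\<close> mentions the word size; there \<open>2 ^ w2\<close> and \<open>2 ^ w1\<close>
  differ by a multiple of \<open>2 ^ w1\<close>.\<close>

lemma take_bit_binop_val:
  assumes "a < 2 ^ w1" "b < 2 ^ w1" "w1 \<le> w2"
  shows "take_bit w1 (binop_val w2 f a b) = binop_val w1 f a b"
proof (cases f)
  case SUB
  obtain k where k: "w2 = w1 + k" using assms(3) le_Suc_ex by blast
  have "(1 :: nat) \<le> 2 ^ k" by simp
  then obtain j where j: "(2 :: nat) ^ k = j + 1" by (metis add.commute le_Suc_ex)
  have "2 ^ w2 + a - b = j * 2 ^ w1 + (2 ^ w1 + a - b)"
    using assms(2) by (simp add: k power_add j algebra_simps)
  then show ?thesis using SUB assms(3) by (simp add: take_bit_eq_mod min_def mod_mod_cancel le_imp_power_dvd)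
next
  case DIV
  show ?thesis using DIV take_bit_id[OF le_less_trans[OF div_le_dividend assms(1)]] by simp
next
  case MOD
  show ?thesis using MOD take_bit_id[OF le_less_trans[OF mod_less_eq_dividend assms(1)]] by simp
next
  case SHR
  have "drop_bit b a \<le> a" by (simp add: drop_bit_eq_div)
  from take_bit_id[OF le_less_trans[OF this assms(1)]] show ?thesis using SHR by simp
qed (use assms in \<open>simp_all add: take_bit_id\<close>)

text \<open>The bounds by \<open>2 ^ w1\<close> belong to the invariant because they confine
  simulated addresses to the memory window that starts at \<open>Z\<close>.\<close>

definition simrel where
  "simrel K p l mk pb w1 Z st st2 \<longleftrightarrow>
     pc st2 = p + 2 * min (pc st) l \<and>
     (\<forall>r<K. regs st2 r = regs st r \<and> regs st r < 2 ^ w1) \<and>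
     (\<forall>i<2 ^ w1. mem st2 (Z + i) = mem st i \<and> mem st i < 2 ^ w1) \<and>
     regs st2 (var K mk) = 2 ^ w1 - 1 \<and> regs st2 (var K pb) = Z"

lemma reach_2:
  assumes "code_at Q (pc st) [i, j]" "pc (exec_instr w i st) = pc st + 1"
  shows "reach Q w 2 st (exec_instr w j (exec_instr w i st))"
  using reach_trans[OF reach_step[of st Q i w] reach_step[of "exec_instr w i st" Q j w]] assms
  by (auto simp: numeral_2_eq_2)

lemma sim_step:
  assumes K: "2 \<le> K" and vars: "2 \<le> mk" "2 \<le> pb"
    and code: "code_at Q p (sim_prog K p mk pb P)"
    and regs: "\<forall>i\<in>set P. instr_regs i \<subseteq> {..<K}"
    and w: "w1 \<le> w2" "Z + 2 ^ w1 \<le> 2 ^ w2"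
    and rel: "simrel K p (length P) mk pb w1 Z st st2"
  shows "\<exists>t\<le>2. \<exists>st2'. reach Q w2 t st2 st2' \<and> simrel K p (length P) mk pb w1 Z (step P w1 st) st2'"
proof (cases "halted P st")
  case True
  then show ?thesis using rel by (auto simp: step_def intro!: exI[of _ 0] exI[of _ st2])
next
  case False
  define k where "k = pc st"
  have k: "k < length P" using False by (simp add: halted_def k_def)
  define i where "i = P ! k"
  have ir: "instr_regs i \<subseteq> {..<K}" using regs k by (simp add: i_def)
  have pc: "pc st2 = p + 2 * k" using rel k by (simp add: simrel_def k_def min_def)
  have code_i: "code_at Q (pc st2) (sim_instr K p (length P) mk pb i)"
    using code_at_sim[OF code[unfolded sim_prog_def] _ k] by (simp add: pc i_def)
  have step: "step P w1 st = exec_instr w1 i st" using False by (simp add: step_def i_def k_def)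
  have R: "regs st2 r = regs st r" "regs st r < 2 ^ w1" if "r < K" for r
    using rel that by (auto simp: simrel_def)
  have M: "mem st2 (Z + j) = mem st j" "mem st j < 2 ^ w1" if "j < 2 ^ w1" for j
    using rel that by (auto simp: simrel_def)
  have mk: "regs st2 (var K mk) = 2 ^ w1 - 1" and pb: "regs st2 (var K pb) = Z"
    using rel by (auto simp: simrel_def)
  have ge: "K \<le> var K mk" "K \<le> var K pb" "K < tmp K 0" using vars by (auto simp: var_def tmp_def)
  have ne: "var K mk \<noteq> tmp K 0" "var K pb \<noteq> tmp K 0" using var_neq_tmp[OF K] by auto
  have min: "min (k + 1) (length P) = k + 1" using k by simp
  have bounds: "take_bit w1 (x :: nat) < 2 ^ w1" for x by (simp add: take_bit_nat_less_exp)
  show ?thesis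
  proof (cases i)
    case (Const r c)
    let ?st = "exec_instr w2 (Arith BAND r r (var K mk)) (exec_instr w2 (Const r c) st2)"
    have r: "r < K" "var K mk \<noteq> r" "var K pb \<noteq> r" using ir ge Const by auto
    have "reach Q w2 2 st2 ?st" using code_i Const by (intro reach_2) simp_all
    moreover have "simrel K p (length P) mk pb w1 Z (exec_instr w1 i st) ?st"
      unfolding simrel_def Const exec_instr_fields
      using R M mk pb r ge pc min w bounds
      by (auto simp: k_def and_mask)
    ultimately show ?thesis unfolding step by blast
  next
    case (Arith f r a b)
    let ?st = "exec_instr w2 (Arith BAND r r (var K mk)) (exec_instr w2 (Arith f r a b) st2)"
    have r: "r < K" "a < K" "b < K" "var K mk \<noteq> r" "var K pb \<noteq> r" using ir ge Arith by auto
    have "reach Q w2 2 st2 ?st" using code_i Arith by (intro reach_2) simp_all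
    moreover have v: "take_bit w1 (binop_val w2 f (regs st a) (regs st b)) = binop_val w1 f (regs st a) (regs st b)"
      using take_bit_binop_val R r w by blast
    moreover have "simrel K p (length P) mk pb w1 Z (exec_instr w1 i st) ?st"
      unfolding simrel_def Arith exec_instr_fields
      using R M mk pb r ge pc min bounds v[symmetric]
      by (auto simp: k_def and_mask)
    ultimately show ?thesis unfolding step by blast
  next
    case (Load r a)
    let ?st = "exec_instr w2 (Load r (tmp K 0)) (exec_instr w2 (Arith ADD (tmp K 0) a (var K pb)) st2)"
    have r: "r < K" "a < K" "var K mk \<noteq> r" "var K pb \<noteq> r" "r \<noteq> tmp K 0" using ir ge Load by auto
    have "reach Q w2 2 st2 ?st" using code_i Load by (intro reach_2) simp_all
    moreover have "take_bit w2 (regs st a + Z) = Z + regs st a"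
      using R(2)[OF r(2)] w by (subst take_bit_id) auto
    then have "simrel K p (length P) mk pb w1 Z (exec_instr w1 i st) ?st"
      unfolding simrel_def Load exec_instr_fields
      using R M mk pb r ge pc min ne by (auto simp: k_def)
    ultimately show ?thesis unfolding step by blast
  next
    case (Store a r)
    let ?st = "exec_instr w2 (Store (tmp K 0) r) (exec_instr w2 (Arith ADD (tmp K 0) a (var K pb)) st2)"
    have r: "r < K" "a < K" "r \<noteq> tmp K 0" using ir ge Store by auto
    have "reach Q w2 2 st2 ?st" using code_i Store by (intro reach_2) simp_all
    moreover have "take_bit w2 (regs st a + Z) = Z + regs st a"
      using R(2)[OF r(2)] w by (subst take_bit_id) auto
    then have "simrel K p (length P) mk pb w1 Z (exec_instr w1 i st) ?st"
      unfolding simrel_def Store exec_instr_fields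
      using R M mk pb r ge pc min ne by (auto simp: k_def)
    ultimately show ?thesis unfolding step by blast
  next
    case (Jump q)
    let ?st = "exec_instr w2 (Jump (p + 2 * min q (length P))) st2"
    have "reach Q w2 1 st2 ?st" using code_i Jump by (intro reach_step) simp_all
    moreover have "simrel K p (length P) mk pb w1 Z (exec_instr w1 i st) ?st"
      unfolding simrel_def Jump exec_instr_fields using R M mk pb by auto
    ultimately show ?thesis unfolding step by (metis one_le_numeral)
  next
    case (JumpIfLess a b q)
    let ?st1 = "exec_instr w2 (JumpIfLess a b (p + 2 * min q (length P))) st2"
    have r: "a < K" "b < K" using ir JumpIfLess by auto
    have 1: "reach Q w2 1 st2 ?st1" using code_i JumpIfLess by (intro reach_step) simp_all
    show ?thesis
    proof (cases "regs st a < regs st b")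
      case True
      then have "simrel K p (length P) mk pb w1 Z (exec_instr w1 i st) ?st1"
        unfolding simrel_def JumpIfLess exec_instr_fields using R M mk pb r by auto
      then show ?thesis unfolding step using 1 by (metis one_le_numeral)
    next
      case False
      let ?st2 = "exec_instr w2 (Arith BAND (tmp K 0) (tmp K 0) (tmp K 0)) ?st1"
      have "reach Q w2 2 st2 ?st2" using code_i JumpIfLess False r R by (intro reach_2) simp_all
      moreover have "simrel K p (length P) mk pb w1 Z (exec_instr w1 i st) ?st2"
        unfolding simrel_def JumpIfLess exec_instr_fields
        using R M mk pb r False pc min ne ge by (auto simp: k_def)
      ultimately show ?thesis unfolding step by blast
    qed
  qed
qed

lemma sim_run:
  assumes "2 \<le> K" "2 \<le> mk" "2 \<le> pb" "code_at Q p (sim_prog K p mk pb P)"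
    and "\<forall>i\<in>set P. instr_regs i \<subseteq> {..<K}" "w1 \<le> w2" "Z + 2 ^ w1 \<le> 2 ^ w2"
    and "simrel K p (length P) mk pb w1 Z st st2"
  shows "\<exists>t\<le>2 * T. \<exists>st2'. reach Q w2 t st2 st2' \<and>
    simrel K p (length P) mk pb w1 Z ((step P w1 ^^ T) st) st2'"
proof (induction T)
  case 0
  then show ?case using assms(8) by auto
next
  case (Suc T)
  then obtain t st3 where 1: "t \<le> 2 * T" "reach Q w2 t st2 st3"
    "simrel K p (length P) mk pb w1 Z ((step P w1 ^^ T) st) st3" by blast
  from sim_step[OF assms(1-7) 1(3)] obtain t' st4 where 2: "t' \<le> 2" "reach Q w2 t' st3 st4"
    "simrel K p (length P) mk pb w1 Z (step P w1 ((step P w1 ^^ T) st)) st4" by blast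
  show ?case using reach_trans[OF 1(2) 2(2)] 1(1) 2(1,3)
    by (intro exI[of _ "t + t'"] conjI exI[of _ st4]) auto
qed

section \<open>Running times of commands\<close>

fun loopfree :: "com \<Rightarrow> bool" where
  "loopfree (Seq c d) \<longleftrightarrow> loopfree c \<and> loopfree d"
| "loopfree (If e c d) \<longleftrightarrow> loopfree c \<and> loopfree d"
| "loopfree (While e c) \<longleftrightarrow> False"
| "loopfree _ \<longleftrightarrow> True"

text \<open>Loop-free code is executed symbolically by the simplifier. The value at
  \<open>While\<close> is a dummy that \<open>loopfree\<close> excludes.\<close>

fun den :: "nat \<Rightarrow> com \<Rightarrow> store \<times> store \<Rightarrow> store \<times> store" where
  "den w Skip (s, m) = (s, m)"
| "den w (Assign x e) (s, m) = (s(x := ev w s m e), m)"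
| "den w (Sto a e) (s, m) = (s, m(ev w s m a := ev w s m e))"
| "den w (Seq c d) (s, m) = den w d (den w c (s, m))"
| "den w (If e c d) (s, m) = (if ev w s m e \<noteq> 0 then den w c (s, m) else den w d (s, m))"
| "den w (While e c) (s, m) = (s, m)"

fun cost :: "com \<Rightarrow> nat" where
  "cost Skip = 0"
| "cost (Assign x e) = elen e + 1"
| "cost (Sto a e) = elen a + elen e + 1"
| "cost (Seq c d) = cost c + cost d"
| "cost (If e c d) = elen e + 3 + cost c + cost d"
| "cost (While e c) = 0"

definition wp :: "nat \<Rightarrow> com \<Rightarrow> nat \<Rightarrow> (store \<Rightarrow> store \<Rightarrow> bool) \<Rightarrow>
    store \<Rightarrow> store \<Rightarrow> bool" where
  "wp w c T Q s m \<longleftrightarrow> (\<exists>t s' m'. big w c s m t s' m' \<and> t \<le> T \<and> Q s' m')"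

lemma big_den:
  "loopfree c \<Longrightarrow> den w c (s, m) = (s', m') \<Longrightarrow> \<exists>t\<le>cost c. big w c s m t s' m'"
proof (induction c arbitrary: s m s' m')
  case (Seq c d)
  obtain s1 m1 where 1: "den w c (s, m) = (s1, m1)" by fastforce
  then have 2: "den w d (s1, m1) = (s', m')" using Seq.prems by simp
  obtain t1 where t1: "t1 \<le> cost c" "big w c s m t1 s1 m1"
    using Seq.IH(1)[OF _ 1] Seq.prems by auto
  obtain t2 where t2: "t2 \<le> cost d" "big w d s1 m1 t2 s' m'"
    using Seq.IH(2)[OF _ 2] Seq.prems by auto
  show ?case using big.Seq[OF t1(2) t2(2)] t1 t2 by (intro exI[of _ "t1 + t2"]) auto
next
  case (If e c d)
  show ?case
  proof (cases "ev w s m e = 0")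
    case True
    then obtain t where "t \<le> cost d" "big w d s m t s' m'" using If.IH(2)[of s m s' m'] If.prems by auto
    then show ?thesis using big.IfF[OF True] by (intro exI[of _ "elen e + 2 + t"]) auto
  next
    case False
    then obtain t where "t \<le> cost c" "big w c s m t s' m'" using If.IH(1)[of s m s' m'] If.prems by auto
    then show ?thesis using big.IfT[OF False] by (intro exI[of _ "elen e + 3 + t"]) auto
  qed
next
  case (Assign x e)
  then show ?case using big.Assign[of w x e s m] by (intro exI[of _ "elen e + 1"]) auto
next
  case (Sto a e)
  then show ?case using big.Sto[of w a e s m] by (intro exI[of _ "elen a + elen e + 1"]) auto
qed (auto intro: big.intros)

lemma wp_den:
  assumes "loopfree c" "den w c (s, m) = (s', m')" "Q s' m'" "cost c \<le> T"
  shows "wp w c T Q s m"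
  using big_den[OF assms(1,2)] assms(3,4) unfolding wp_def by (meson order_trans)

lemma wp_mono: "wp w c T Q s m \<Longrightarrow> T \<le> T' \<Longrightarrow> (\<And>s m. Q s m \<Longrightarrow> Q' s m) \<Longrightarrow> wp w c T' Q' s m"
  unfolding wp_def by (meson order_trans)

lemma wp_Seq:
  assumes "wp w c T Q s m" "\<And>s m. Q s m \<Longrightarrow> wp w d T' R s m"
  shows "wp w (Seq c d) (T + T') R s m"
proof -
  obtain t s1 m1 where 1: "big w c s m t s1 m1" "t \<le> T" "Q s1 m1" using assms(1) by (auto simp: wp_def)
  obtain t' s2 m2 where 2: "big w d s1 m1 t' s2 m2" "t' \<le> T'" "R s2 m2"
    using assms(2)[OF 1(3)] by (auto simp: wp_def)
  show ?thesis unfolding wp_def using big.Seq[OF 1(1) 2(1)] 1 2 add_mono by blast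
qed

lemma wp_IfT:
  assumes "ev w s m e \<noteq> 0" "wp w c T Q s m" "elen e + 3 + T \<le> T'"
  shows "wp w (If e c d) T' Q s m"
proof -
  obtain t s1 m1 where 1: "big w c s m t s1 m1" "t \<le> T" "Q s1 m1" using assms(2) by (auto simp: wp_def)
  show ?thesis unfolding wp_def using big.IfT[OF assms(1) 1(1)] 1 assms(3)
    by (intro exI[of _ "elen e + 3 + t"] exI[of _ s1] exI[of _ m1]) auto
qed

lemma wp_IfF:
  assumes "ev w s m e = 0" "wp w d T Q s m" "elen e + 2 + T \<le> T'"
  shows "wp w (If e c d) T' Q s m"
proof -
  obtain t s1 m1 where 1: "big w d s m t s1 m1" "t \<le> T" "Q s1 m1" using assms(2) by (auto simp: wp_def)
  show ?thesis unfolding wp_def using big.IfF[OF assms(1) 1(1)] 1 assms(3)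
    by (intro exI[of _ "elen e + 2 + t"] exI[of _ s1] exI[of _ m1]) auto
qed

text \<open>The number of iterations is fixed beforehand, so the invariant is indexed by the
  iterations done; the induction is on those that remain.\<close>

lemma wp_While:
  assumes step: "\<And>i s m. i < k \<Longrightarrow> I i s m \<Longrightarrow> ev w s m e \<noteq> 0 \<and> wp w c T (I (Suc i)) s m"
    and exit: "\<And>s m. I k s m \<Longrightarrow> ev w s m e = 0"
    and init: "I 0 s m"
  shows "wp w (While e c) (k * (T + elen e + 3) + elen e + 2) (I k) s m"
proof -
  have "wp w (While e c) (j * (T + elen e + 3) + elen e + 2) (I k) s m" if "j \<le> k" "I (k - j) s m" for j s m
    using that
  proof (induction j arbitrary: s m)
    case 0
    then have "big w (While e c) s m (elen e + 2) s m" using exit big.WhileF by simp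
    then show ?case using 0 unfolding wp_def
      by (intro exI[of _ "elen e + 2"] exI[of _ s] exI[of _ m]) simp
  next
    case (Suc j)
    then have "k - Suc j < k" "Suc (k - Suc j) = k - j" by auto
    with step[OF _ Suc.prems(2)] have 1: "ev w s m e \<noteq> 0" "wp w c T (I (k - j)) s m" by auto
    then obtain t s1 m1 where t: "big w c s m t s1 m1" "t \<le> T" "I (k - j) s1 m1" by (auto simp: wp_def)
    obtain t' s2 m2 where t': "big w (While e c) s1 m1 t' s2 m2" "t' \<le> j * (T + elen e + 3) + elen e + 2" "I k s2 m2"
      using Suc.IH[OF _ t(3)] Suc.prems by (auto simp: wp_def)
    show ?case unfolding wp_def using big.WhileT[OF 1(1) t(1) t'(1)] t t'
      by (intro exI[of _ "elen e + 3 + t + t'"] exI[of _ s2] exI[of _ m2]) auto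
  qed
  from this[of k s m] init show ?thesis by simp
qed

section \<open>Comparisons and arithmetic without overflow\<close>

definition seqs :: "com list \<Rightarrow> com" where
  "seqs cs = foldr Seq cs Skip"

lemma seqs_simps [simp]: "seqs [] = Skip" "seqs (c # cs) = Seq c (seqs cs)"
  by (auto simp: seqs_def)

text \<open>Truth values as expressions; modular arithmetic cannot spoil them, as \<open>1 div 0 = 0\<close>.\<close>

definition eq_expr :: "expr \<Rightarrow> expr \<Rightarrow> expr" where
  "eq_expr a b = Op DIV (Cn 1) (Op ADD (Cn 1) (Op BXOR a b))"

definition not_expr :: "expr \<Rightarrow> expr" where
  "not_expr a = eq_expr a (Cn 0)"

text \<open>\<open>b div (a + 1)\<close> is nonzero exactly if \<open>a < b\<close>. If
  \<open>a + 1\<close> wraps around to 0, the quotient is 0 by convention, which is right because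
  \<open>a\<close> is then the largest word.\<close>

definition less_expr :: "expr \<Rightarrow> expr \<Rightarrow> expr" where
  "less_expr a b = not_expr (eq_expr (Op DIV b (Op ADD a (Cn 1))) (Cn 0))"

lemma ev_and:
  "ev w s m a = of_bool p \<Longrightarrow> ev w s m c = of_bool q \<Longrightarrow> ev w s m (Op BAND a c) = of_bool (p \<and> q)"
  by (cases p; cases q) simp_all

definition conj_expr :: "expr list \<Rightarrow> expr" where
  "conj_expr es = foldr (Op BAND) es (Cn 1)"

context
  fixes w :: nat and s m :: "nat \<Rightarrow> nat"
  assumes w: "1 \<le> w"
begin

lemma ev_Cn_1 [simp]: "ev w s m (Cn 1) = 1" "ev w s m (Cn (Suc 0)) = 1"
  using w by (simp_all add: take_bit_Suc_0)

lemma ev_eq_expr: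
  assumes "ev w s m a < 2 ^ w" "ev w s m b < 2 ^ w"
  shows "ev w s m (eq_expr a b) = of_bool (ev w s m a = ev w s m b)"
proof -
  let ?x = "ev w s m a XOR ev w s m b"
  have x0: "?x = 0 \<longleftrightarrow> ev w s m a = ev w s m b" by (metis xor.assoc xor.left_neutral xor_self_eq xor.right_neutral)
  have "take_bit w ?x = ?x" using assms by (simp add: take_bit_nat_eq_self)
  then have "?x < 2 ^ w" by (metis take_bit_nat_less_exp)
  have *: "ev w s m (eq_expr a b) = 1 div take_bit w (1 + ?x)"
    unfolding eq_expr_def by (simp del: ev.simps(1) take_bit_Suc_0)
  show ?thesis
  proof (cases "?x = 0")
    case True
    then show ?thesis using * x0 w by (simp add: take_bit_Suc_0)
  next
    case False
    have "take_bit w (1 + ?x) \<noteq> 1"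
    proof (cases "1 + ?x = 2 ^ w")
      case True
      then show ?thesis by (simp add: take_bit_eq_mod)
    next
      case ne: False
      then have "1 + ?x < 2 ^ w" using \<open>?x < 2 ^ w\<close> by simp
      then show ?thesis using False by (simp add: take_bit_nat_eq_self)
    qed
    then have "1 div take_bit w (1 + ?x) = 0" by (metis div_by_0 div_eq_0_iff less_one linorder_neqE_nat)
    then show ?thesis using * x0 False by simp
  qed
qed

lemma ev_not_expr: "ev w s m a = of_bool p \<Longrightarrow> ev w s m (not_expr a) = of_bool (\<not> p)"
proof -
  assume a: "ev w s m a = of_bool p"
  have "(2 :: nat) ^ 1 \<le> 2 ^ w" using w by (intro power_increasing) auto
  then have "ev w s m a < 2 ^ w" using a by (cases p) auto
  then show ?thesis unfolding not_expr_def using ev_eq_expr[of a "Cn 0"] a by (cases p) simp_all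
qed

lemma ev_less_expr:
  assumes "ev w s m a < 2 ^ w" "ev w s m b < 2 ^ w"
  shows "ev w s m (less_expr a b) = of_bool (ev w s m a < ev w s m b)"
proof -
  let ?q = "Op DIV b (Op ADD a (Cn 1))"
  have q: "ev w s m ?q = ev w s m b div take_bit w (ev w s m a + 1)"
    by (simp del: ev.simps(1))
  then have "ev w s m ?q \<le> ev w s m b" by simp
  then have "ev w s m ?q < 2 ^ w" using assms(2) by (rule le_less_trans)
  then have *: "ev w s m (eq_expr ?q (Cn 0)) = of_bool (ev w s m ?q = 0)"
    using ev_eq_expr[of ?q "Cn 0"] by simp
  have "ev w s m ?q = 0 \<longleftrightarrow> \<not> ev w s m a < ev w s m b"
  proof (cases "ev w s m a + 1 = 2 ^ w")
    case True
    then show ?thesis unfolding q using assms by (simp add: take_bit_eq_mod)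
  next
    case False
    then have "take_bit w (ev w s m a + 1) = ev w s m a + 1"
      using assms by (intro take_bit_nat_eq_self) auto
    then show ?thesis unfolding q by (simp add: div_eq_0_iff not_less less_Suc_eq_le)
  qed
  then show ?thesis unfolding less_expr_def using ev_not_expr[OF *] by simp
qed

lemma ev_conj_expr:
  assumes "list_all2 (\<lambda>e p. ev w s m e = of_bool p) es ps"
  shows "ev w s m (conj_expr es) = of_bool (\<forall>p\<in>set ps. p)"
  using assms by (induction es ps rule: list_all2_induct) (auto simp: conj_expr_def simp del: ev.simps(1))

end

fun nev :: "store \<Rightarrow> expr \<Rightarrow> nat" where
  "nev s (Cn c) = c"
| "nev s (Vr x) = s x"
| "nev s (Op ADD a b) = nev s a + nev s b"
| "nev s (Op MUL a b) = nev s a * nev s b"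
| "nev s _ = 0"

fun poly_expr :: "expr \<Rightarrow> bool" where
  "poly_expr (Cn c) \<longleftrightarrow> True"
| "poly_expr (Vr x) \<longleftrightarrow> True"
| "poly_expr (Op ADD a b) \<longleftrightarrow> poly_expr a \<and> poly_expr b"
| "poly_expr (Op MUL a b) \<longleftrightarrow> poly_expr a \<and> poly_expr b"
| "poly_expr _ \<longleftrightarrow> False"

lemma ev_poly_mod: "poly_expr e \<Longrightarrow> ev w s m e mod 2 ^ w = nev s e mod 2 ^ w"
proof (induction e rule: poly_expr.induct)
  case (3 a b)
  then show ?case by (simp add: take_bit_eq_mod) (metis mod_add_eq)
next
  case (4 a b)
  then show ?case by (simp add: take_bit_eq_mod) (metis mod_mult_eq)
qed (auto simp: take_bit_eq_mod)

text \<open>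
  Sums and products need no intermediate overflow checks: all operations are exact modulo
  \<open>2 ^ w\<close>, so it suffices that the final value is a word.
\<close>

lemma ev_poly:
  assumes "poly_expr e" "nev s e < 2 ^ w"
  shows "ev w s m e = nev s e"
proof (cases "\<exists>x. e = Vr x")
  case False
  then have "ev w s m e < 2 ^ w"
    using assms(1) by (cases e rule: poly_expr.cases) (auto simp: take_bit_nat_less_exp)
  then show ?thesis using ev_poly_mod[OF assms(1), of w s m] assms(2) by simp
qed auto

fun pow_expr :: "expr \<Rightarrow> nat \<Rightarrow> expr" where
  "pow_expr e 0 = Cn 1"
| "pow_expr e (Suc k) = Op MUL e (pow_expr e k)"

lemma poly_pow_expr [simp]: "poly_expr e \<Longrightarrow> poly_expr (pow_expr e k)"
  by (induction k) auto

lemma nev_pow_expr [simp]: "nev s (pow_expr e k) = nev s e ^ k"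
  by (induction k) auto

section \<open>Listing the edges\<close>

text \<open>A candidate is an ordered pair with a condition. Different loop indices produce the same
  edge, while \<open>lists_edges\<close> demands each edge once.\<close>

definition add_edge :: "bool \<times> nat \<times> nat \<Rightarrow> (nat \<times> nat) list \<Rightarrow> (nat \<times> nat) list" where
  "add_edge = (\<lambda>(p, u, v) es. if p \<and> (u, v) \<notin> set es then es @ [(u, v)] else es)"

lemma set_fold_add_edge:
  "set (fold add_edge cs es) = set es \<union> {(u, v). (True, u, v) \<in> set cs}"
proof (induction cs arbitrary: es)
  case (Cons c cs)
  obtain p u v where "c = (p, u, v)" by (cases c)
  then show ?case using Cons by (auto simp: add_edge_def)
qed auto

lemma distinct_fold_add_edge: "distinct es \<Longrightarrow> distinct (fold add_edge cs es)"
proof (induction cs arbitrary: es)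
  case (Cons c cs)
  then show ?case by (cases c) (auto simp: add_edge_def)
qed auto

lemma length_fold_add_edge: "length (fold add_edge cs es) \<le> length es + length cs"
proof (induction cs arbitrary: es)
  case (Cons c cs)
  have "length (add_edge c es) \<le> length es + 1" by (cases c) (auto simp: add_edge_def)
  then show ?case using Cons[of "add_edge c es"] by simp
qed auto

definition flatten :: "(nat \<times> nat) list \<Rightarrow> nat list" where
  "flatten es = concat (map (\<lambda>(u, v). [u, v]) es)"

lemma length_flatten [simp]: "length (flatten es) = 2 * length es"
  by (induction es) (auto simp: flatten_def)

lemma flatten_snoc [simp]: "flatten (es @ [(u, v)]) = flatten es @ [u, v]"
  by (simp add: flatten_def)

text \<open>
  The memory above the input is divided into three segments of size \<open>Z\<close>: the memory of the
  simulated program from \<open>Z\<close> on, the incidence table from \<open>2 * Z\<close> on, and marks for the edges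
  already listed from \<open>3 * Z\<close> on.
\<close>

locale enumeration =
  fixes w w1 b h N D U :: nat and on :: "nat \<Rightarrow> nat \<Rightarrow> bool"
  assumes N: "0 < N" and D: "1 < D" and U: "U < N"
    and w1: "2 ^ w1 = (4 * (N ^ 3 * D ^ 7 * D ^ 7)) ^ b"
    and w: "4 * (4 * (N ^ 3 * D ^ 7 * D ^ 7)) ^ (b + 3) < 2 ^ w" and h: "h < 2 ^ w"
begin

definition W where "W = D ^ 7"
definition S where "S = N ^ 3 * W * W"
definition Nv where "Nv = 4 * S"
text \<open>One size fits all three segments: \<open>Nv ^ b\<close> words of simulated memory, the
  list of edges, and \<open>Nv ^ 2\<close> marks. The exponent 3 leaves slack for constant
  factors.\<close>

definition Z where "Z = Nv ^ (b + 3)"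
definition slot where "slot X i = X div D ^ i mod D"

text \<open>
  Further variables: 2 the number \<open>n\<close> of propositional variables, 3 the number \<open>m\<close> of clauses,
  17 the loop counter, 18 to 22 the scan of a clause, 23 to 27 the decoded \<open>a, b, c, X, Y\<close>,
  29 to 31 the endpoints of an edge and the number of edges, 33 \<open>N * D\<close>, 34 \<open>m + 4\<close>, from 40 on
  the slots of \<open>X\<close>, from 50 on those of \<open>Y\<close>.
\<close>

definition base :: "store \<Rightarrow> bool" where
  "base s \<longleftrightarrow> s 0 = 0 \<and> s 1 = 0 \<and> s 4 = h \<and> s 5 = N \<and> s 6 = D \<and> s 7 = W \<and> s 8 = N ^ 2 \<and> s 9 = N ^ 3 \<and>
     s 10 = S \<and> s 11 = Nv \<and> s 12 = 2 ^ w1 - 1 \<and> s 13 = Z \<and> s 14 = 2 * Z \<and> s 15 = 3 * Z \<and> s 16 = U"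

text \<open>Memory starts at zero, so marks need no initialisation, and the two header cells at
  \<open>Z\<close> stay 0 until the number of edges is known. Listed endpoints are truncated to
  \<open>w1\<close> bits because the initial state of the simulated machine truncates its input in
  the same way.\<close>

definition lay :: "(nat \<times> nat) list \<Rightarrow> nat \<Rightarrow> nat" where
  "lay es a =
    (if a < 2 * Z then
       if a < Z + 2 then 0
       else if a < Z + 2 + 2 * length es then take_bit w1 (flatten es ! (a - Z - 2)) else 0
     else if a < 3 * Z then
       if a < 2 * Z + N * D then of_bool (on ((a - 2 * Z) div D) ((a - 2 * Z) mod D)) else 0
     else of_bool (\<exists>(u, v)\<in>set es. a = 3 * Z + u * Nv + v))"

definition laid :: "(nat \<times> nat) list \<Rightarrow> store \<Rightarrow> bool" where
  "laid es m \<longleftrightarrow> (\<forall>a\<ge>Z. m a = lay es a) \<and> set es \<subseteq> {..<Nv} \<times> {..<Nv}"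

lemma W_pos: "0 < W" using D by (simp add: W_def)
lemma D_le_W: "D \<le> W" unfolding W_def using D by (intro self_le_power) auto
lemma S_pos: "0 < S" using N W_pos by (simp add: S_def)
lemma Nv_ge: "4 \<le> Nv" using S_pos by (simp add: Nv_def)
lemma Nv_less_Z: "Nv ^ 3 \<le> Z" "Nv ^ 2 \<le> Z" "Nv \<le> Z"
  unfolding Z_def using Nv_ge by (auto intro!: power_increasing self_le_power)
lemma w1_eq: "2 ^ w1 = Nv ^ b"
  using w1 by (simp add: Nv_def S_def W_def)
lemma Z_less: "4 * Z < 2 ^ w"
  using w by (simp add: Z_def Nv_def S_def W_def)
lemma w1_le_Z: "2 ^ w1 \<le> Z"
  unfolding w1_eq Z_def using Nv_ge by (intro power_increasing) auto
lemma S_less: "4 * S \<le> Z" "S < Z" "S < 2 ^ w"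
  using Nv_less_Z(3) S_pos Z_less by (auto simp: Nv_def)
lemma ND_le: "N * D \<le> S"
proof -
  have "N \<le> N ^ 3" using N by (intro self_le_power) auto
  then have "N * D \<le> N ^ 3 * W" using D_le_W by (rule mult_le_mono)
  also have "N ^ 3 * W \<le> N ^ 3 * W * W" using W_pos by simp
  finally have "N * D \<le> N ^ 3 * W * W" .
  then show ?thesis by (simp add: S_def)
qed
lemma w_ge: "6 \<le> w"
proof -
  have "4 ^ 3 \<le> Nv ^ 3" using Nv_ge by (rule power_mono) simp
  then have "(2 :: nat) ^ 6 < 2 ^ w" using Nv_less_Z(1) Z_less by simp
  then show ?thesis using power_less_imp_less_exp by (metis less_imp_le one_less_numeral_iff semiring_norm(76))
qed

lemma ev_Cn: "c < 64 \<Longrightarrow> ev w s m (Cn c) = c"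
proof -
  assume "c < 64"
  also have "(64 :: nat) \<le> 2 ^ w" using power_increasing[OF w_ge, of "2 :: nat"] by simp
  finally show ?thesis by (simp add: take_bit_nat_eq_self)
qed

definition mark_addr :: expr where
  "mark_addr = Op ADD (Vr 15) (Op ADD (Op MUL (Vr 29) (Vr 11)) (Vr 30))"

definition out_addr :: "nat \<Rightarrow> expr" where
  "out_addr k = Op ADD (Vr 13) (Op ADD (Op MUL (Cn 2) (Vr 31)) (Cn k))"

definition emit :: "expr \<times> expr \<times> expr \<Rightarrow> com" where
  "emit = (\<lambda>(p, u, v). If p (seqs [Assign 29 u, Assign 30 v,
     If (Ld mark_addr) Skip (seqs [Sto mark_addr (Cn 1), Sto (out_addr 2) (Op BAND (Vr 29) (Vr 12)),
       Sto (out_addr 3) (Op BAND (Vr 30) (Vr 12)), Assign 31 (Op ADD (Vr 31) (Cn 1))])]) Skip)"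

lemma pair_bound: "u < Nv \<Longrightarrow> v < Nv \<Longrightarrow> u * Nv + v < Nv ^ 2"
proof -
  assume "u < Nv" "v < Nv"
  then have "u * Nv + v < u * Nv + Nv" "(u + 1) * Nv \<le> Nv * Nv"
    using mult_le_mono1[of "u + 1" Nv Nv] by auto
  then show ?thesis by (simp add: power2_eq_square)
qed

lemma pair_inj: "v < Nv \<Longrightarrow> v' < Nv \<Longrightarrow> u * Nv + v = u' * Nv + v' \<longleftrightarrow> u = u' \<and> v = v'"
proof
  assume v: "v < Nv" "v' < Nv" and eq: "u * Nv + v = u' * Nv + v'"
  have "(u * Nv + v) div Nv = u" "(u * Nv + v) mod Nv = v" "(u' * Nv + v') div Nv = u'" "(u' * Nv + v') mod Nv = v'"
    using v by auto
  then show "u = u' \<and> v = v'" using eq by metis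
qed auto

lemma laid_mark:
  assumes "laid es m" "u < Nv" "v < Nv"
  shows "m (3 * Z + u * Nv + v) = of_bool ((u, v) \<in> set es)"
proof -
  have "(\<exists>(x, y)\<in>set es. 3 * Z + u * Nv + v = 3 * Z + x * Nv + y) \<longleftrightarrow> (u, v) \<in> set es"
  proof
    assume "\<exists>(x, y)\<in>set es. 3 * Z + u * Nv + v = 3 * Z + x * Nv + y"
    then obtain x y where xy: "(x, y) \<in> set es" "u * Nv + v = x * Nv + y" by auto
    then have "y < Nv" using assms(1) by (auto simp: laid_def)
    then show "(u, v) \<in> set es" using xy pair_inj[OF assms(3)] by metis
  qed auto
  then show ?thesis using assms Nv_less_Z unfolding laid_def lay_def by simp
qed

lemma laid_snoc:
  assumes "laid es m" "u < Nv" "v < Nv" "2 * length es + 4 < Z"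
  shows "laid (es @ [(u, v)]) (m(3 * Z + u * Nv + v := 1, Z + 2 * length es + 2 := take_bit w1 u,
    Z + 2 * length es + 3 := take_bit w1 v))"
  unfolding laid_def
proof (intro conjI allI impI)
  fix a assume a: "Z \<le> a"
  then have m: "m a = lay es a" using assms by (simp add: laid_def)
  consider "a = Z + 2 * length es + 2" | "a = Z + 2 * length es + 3"
    | "a < Z + 2 * length es + 2" | "Z + 2 * length es + 3 < a" "a < 2 * Z" | "2 * Z \<le> a" "a < 3 * Z" | "3 * Z \<le> a" by linarith
  then show "(m(3 * Z + u * Nv + v := 1, Z + 2 * length es + 2 := take_bit w1 u,
    Z + 2 * length es + 3 := take_bit w1 v)) a = lay (es @ [(u, v)]) a"
  proof cases
    case 1
    then show ?thesis using assms(4) by (simp add: lay_def nth_append)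
  next
    case 2
    then show ?thesis using assms(4) by (simp add: lay_def nth_append)
  next
    case 3
    then show ?thesis using assms(4) m a by (auto simp: lay_def nth_append)
  next
    case 4
    then show ?thesis using assms(4) m a by (auto simp: lay_def)
  next
    case 5
    then show ?thesis using assms(4) m a by (auto simp: lay_def)
  next
    case 6
    then show ?thesis using assms(4) m a by (auto simp: lay_def add.assoc)
  qed
qed (use assms in \<open>auto simp: laid_def\<close>)

text \<open>Variables 29 to 31 are the only ones that \<open>emit\<close> assigns; an invariant
  insensitive to them survives it.\<close>

definition keeps :: "(store \<Rightarrow> bool) \<Rightarrow> bool" where
  "keeps I \<longleftrightarrow> (\<forall>s. I s \<longrightarrow> base s) \<and>
     (\<forall>s x y z. I s \<longrightarrow> I (s(29 := x)) \<and> I (s(30 := y)) \<and> I (s(31 := z)))"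

text \<open>The mark of the pair decides in constant time whether it is already listed. The second
  endpoint is evaluated after variable 29 has been overwritten, hence the updated store in its
  premise.\<close>

lemma emit_correct:
  assumes I: "keeps I" "I s" and laid: "laid es m" and cnt: "s 31 = length es"
    and size: "2 * length es + 4 < Z"
    and p: "ev w s m pe = of_bool p" and uv: "p \<Longrightarrow> u < Nv \<and> v < Nv"
    and u: "p \<Longrightarrow> ev w s m ue = u" and v: "p \<Longrightarrow> ev w (s(29 := u)) m ve = v"
  shows "\<exists>s' m'. den w (emit (pe, ue, ve)) (s, m) = (s', m') \<and> I s' \<and> laid (add_edge (p, u, v) es) m' \<and>
    s' 31 = length (add_edge (p, u, v) es)"
proof (cases p)
  case False
  then show ?thesis using assms by (auto simp: emit_def add_edge_def)
next
  case True
  define s1 where "s1 = s(29 := u, 30 := v)"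
  have s1: "I s1" using I unfolding keeps_def s1_def by blast
  then have b: "base s1" using I unfolding keeps_def by blast
  have v29: "s1 29 = u" "s1 30 = v" "s1 31 = length es" using cnt by (auto simp: s1_def)
  have uv': "u < Nv" "v < Nv" using uv True by auto
  have b': "s1 15 = 3 * Z" "s1 11 = Nv" "s1 13 = Z" "s1 12 = 2 ^ w1 - 1" using b by (auto simp: base_def)
  have bound: "3 * Z + (u * Nv + v) < 2 ^ w"
    using pair_bound[OF uv'] Nv_less_Z(2) Z_less by linarith
  have mark: "ev w s1 m' mark_addr = 3 * Z + u * Nv + v" for m'
    unfolding mark_addr_def using bound by (subst ev_poly) (auto simp: v29 b')
  have out: "ev w s1 m' (out_addr 2) = Z + 2 * length es + 2" "ev w s1 m' (out_addr 3) = Z + 2 * length es + 3" for m'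
    unfolding out_addr_def using size Z_less by (subst ev_poly; auto simp: v29 b')+
  have cnt1: "ev w s1 m' (Op ADD (Vr 31) (Cn 1)) = length es + 1" for m'
    using size Z_less by (subst ev_poly) (auto simp: v29)
  have masks: "ev w s1 m' (Op BAND (Vr 29) (Vr 12)) = take_bit w1 u"
    "ev w s1 m' (Op BAND (Vr 30) (Vr 12)) = take_bit w1 v" for m'
    by (simp_all add: v29 b' and_mask)
  have one: "ev w s1 m' (Cn 1) = 1" for m' by (rule ev_Cn) simp
  have "den w (emit (pe, ue, ve)) (s, m) = den w (If (Ld mark_addr) Skip (seqs [Sto mark_addr (Cn 1), Sto (out_addr 2) (Op BAND (Vr 29) (Vr 12)),
       Sto (out_addr 3) (Op BAND (Vr 30) (Vr 12)), Assign 31 (Op ADD (Vr 31) (Cn 1))])) (s1, m)"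
    using True p u v by (simp add: emit_def s1_def del: ev.simps)
  also have "\<dots> = (if (u, v) \<in> set es then (s1, m) else (s1(31 := length es + 1), m(3 * Z + u * Nv + v := 1, Z + 2 * length es + 2 := take_bit w1 u,
    Z + 2 * length es + 3 := take_bit w1 v)))"
    using laid_mark[OF laid uv'] mark out cnt1 masks one
    by (simp del: ev.simps add: ev.simps(4))
  finally show ?thesis
    using laid_snoc[OF laid uv' size] laid s1 v29 True I unfolding keeps_def
    by (auto simp: add_edge_def)
qed

lemma loopfree_emit [simp]: "loopfree (emit c)"
  by (cases c) (simp add: emit_def)

text \<open>The premise on the candidates ranges over all stores, memories and lists, because every
  emitted edge changes all three before the next candidate is evaluated.\<close>

lemma emits_correct:
  assumes I: "keeps I"
    and c: "list_all2 (\<lambda>(pe, ue, ve) (p, u, v). \<forall>s m es. I s \<longrightarrow> laid es m \<longrightarrow> ev w s m pe = of_bool p \<and>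
      (p \<longrightarrow> u < Nv \<and> v < Nv \<and> ev w s m ue = u \<and> ev w s m ve = v)) ces cs"
    and "I s" "laid es m" "s 31 = length es" "2 * (length es + length cs) + 4 < Z"
  shows "\<exists>s' m'. den w (seqs (map emit ces)) (s, m) = (s', m') \<and> I s' \<and> laid (fold add_edge cs es) m' \<and>
    s' 31 = length (fold add_edge cs es)"
  using c assms(3-)
proof (induction ces cs arbitrary: s m es rule: list_all2_induct)
  case (Cons ce ces c cs)
  obtain pe ue ve p u v where [simp]: "ce = (pe, ue, ve)" "c = (p, u, v)" by (metis prod_cases3)
  have s29: "I (s(29 := u))" using I Cons.prems unfolding keeps_def by blast
  note hyp = Cons.hyps(1)[unfolded \<open>ce = _\<close> \<open>c = _\<close> prod.case, rule_format]
  have a: "ev w s m pe = of_bool p" "p \<Longrightarrow> u < Nv \<and> v < Nv" "p \<Longrightarrow> ev w s m ue = u"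
    "p \<Longrightarrow> ev w (s(29 := u)) m ve = v"
    using hyp[OF Cons.prems(1,2)] hyp[OF s29 Cons.prems(2)] by blast+
  have size: "2 * length es + 4 < Z" using Cons.prems(4) by simp
  from emit_correct[OF I Cons.prems(1,2,3) size a] obtain s1 m1 where 1: "den w (emit (pe, ue, ve)) (s, m) = (s1, m1)" "I s1" "laid (add_edge (p, u, v) es) m1"
    "s1 31 = length (add_edge (p, u, v) es)"
    by blast
  have "length (add_edge (p, u, v) es) \<le> length es + 1" by (auto simp: add_edge_def)
  then have "2 * (length (add_edge (p, u, v) es) + length cs) + 4 < Z" using Cons.prems(4) by simp
  from Cons.IH[OF 1(2,3,4) this] show ?case using 1(1) by simp
qed auto

end

text \<open>Used twice: digits in base \<open>D\<close> make a number an array of coordinates, and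
  digits in base 2 make it a partial assignment.\<close>

lemma digits_exist:
  fixes D :: nat and f :: "nat \<Rightarrow> nat"
  assumes D: "1 < D" and "\<And>i. i < k \<Longrightarrow> f i < D"
  shows "\<exists>X<D ^ k. \<forall>i<k. X div D ^ i mod D = f i"
  using assms(2)
proof (induction k)
  case (Suc k)
  then obtain X where X: "X < D ^ k" "\<forall>i<k. X div D ^ i mod D = f i" by auto
  have fk: "f k < D" using Suc.prems by simp
  have D0: "0 < D" using D by simp
  have "X + f k * D ^ k < D ^ k + f k * D ^ k" "(f k + 1) * D ^ k \<le> D * D ^ k"
    using X fk mult_le_mono1[of "f k + 1" D "D ^ k"] by auto
  then have "X + f k * D ^ k < D ^ Suc k" by simp
  moreover have "(X + f k * D ^ k) div D ^ i mod D = f i" if "i < Suc k" for i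
  proof (cases "i = k")
    case True
    then show ?thesis using X fk D0 by simp
  next
    case False
    then have i: "i < k" using that by simp
    then obtain l where l: "k = Suc (i + l)" using less_iff_Suc_add by auto
    have eq: "f k * D ^ k = (f k * D ^ l * D) * D ^ i"
      by (simp add: l power_add algebra_simps)
    have "(X + f k * D ^ k) div D ^ i = f k * D ^ l * D + X div D ^ i"
      unfolding eq by (rule div_mult_self1) (use D0 in simp)
    then show ?thesis using X i by simp
  qed
  ultimately show ?case by blast
qed auto

section \<open>Numbering of vertices and edge candidates\<close>

locale reduction = enumeration w w1 bw h N D U on
  for w w1 bw h N D U :: nat and on :: "nat \<Rightarrow> nat \<Rightarrow> bool" +
  assumes on_less: "a < N \<Longrightarrow> on a x \<Longrightarrow> x < D"
    and on_unit: "a < N \<Longrightarrow> on a x \<Longrightarrow> on U x"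
begin

text \<open>Group 3 is the last of the four groups of variables. In an orthogonal quadruple ordered
  by groups, exactly one of the two outer vectors is therefore marked.\<close>

definition marked :: "nat \<Rightarrow> bool" where "marked a \<longleftrightarrow> a div 2 ^ h = 3"

fun code :: "vtx \<Rightarrow> nat" where
  "code (HB g) = of_bool g"
| "code (PV a b X) = 1 * S + (a + N * b + N ^ 3 * X)"
| "code (MV a b X) = 2 * S + (a + N * b + N ^ 3 * X)"
| "code (TV a b c) = 3 * S + (a + N * b + N ^ 2 * c)"
| "code (JV j) = j"

text \<open>The junk is a parameter of the gadget and consists of the codes left over by the other
  vertices, so these have to be described before the gadget is instantiated.\<close>

definition core :: "vtx set" where
  "core = range HB \<union> {TV a b c | a b c. a < N \<and> b < N \<and> c < N}
    \<union> {PV a b X | a b X. a < N \<and> b < N \<and> X < W \<and> gadget.okP on slot a b X}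
    \<union> {MV a b X | a b X. a < N \<and> b < N \<and> X < W \<and> gadget.okM on slot a b X}"

definition junk :: "nat set" where "junk = {..<4 * S} - code ` core"

sublocale gadget on slot N D W U marked junk
proof
  fix f :: "nat \<Rightarrow> nat"
  assume "\<And>i. i < 7 \<Longrightarrow> f i < D"
  then show "\<exists>X<W. \<forall>i<7. slot X i = f i"
    unfolding W_def slot_def by (rule digits_exist[OF D])
qed (use U on_less on_unit in auto)

lemma slot_less: "slot X i < D" using D by (simp add: slot_def)

text \<open>A mixed-radix number. A single counter below \<open>S\<close> thus runs through all
  parameters that any edge rule needs.\<close>

definition enc :: "nat \<Rightarrow> nat \<Rightarrow> nat \<Rightarrow> nat \<Rightarrow> nat \<Rightarrow> nat" where
  "enc a b c X Y = a + N * b + N ^ 2 * c + N ^ 3 * (X + W * Y)"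

definition dA where "dA e = e mod N"
definition dB where "dB e = e div N mod N"
definition dC where "dC e = e div N ^ 2 mod N"
definition dX where "dX e = e div N ^ 3 mod W"
definition dY where "dY e = e div N ^ 3 div W"

lemmas d_defs = dA_def dB_def dC_def dX_def dY_def

lemma enc_nested: "enc a b c X Y = a + N * (b + N * (c + N * (X + W * Y)))"
  by (simp add: enc_def algebra_simps power2_eq_square power3_eq_cube)

lemma dec_enc:
  assumes "a < N" "b < N" "c < N" "X < W" "Y < W"
  shows "dA (enc a b c X Y) = a" "dB (enc a b c X Y) = b" "dC (enc a b c X Y) = c"
    "dX (enc a b c X Y) = X" "dY (enc a b c X Y) = Y" "enc a b c X Y < S"
proof -
  let ?e = "enc a b c X Y"
  have 1: "?e div N = b + N * (c + N * (X + W * Y))" using assms by (simp add: enc_nested)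
  have 2: "?e div N ^ 2 = c + N * (X + W * Y)"
    using assms 1 by (simp add: power2_eq_square div_mult2_eq)
  have 3: "?e div N ^ 3 = X + W * Y"
    using assms 2 by (simp add: power3_eq_cube power2_eq_square div_mult2_eq)
  show "dA ?e = a" using assms by (simp add: dA_def enc_nested)
  show "dB ?e = b" "dC ?e = c" "dX ?e = X" "dY ?e = Y"
    using assms 1 2 3 by (simp_all add: d_defs)
  have step: "x + k * y < k * l" if "x < k" "y < l" for x y k l :: nat
  proof -
    have "x + k * y < k + k * y" "k * (y + 1) \<le> k * l"
      using that mult_le_mono2[of "y + 1" l k] by auto
    then show ?thesis by simp
  qed
  have "?e < N * (N * (N * (W * W)))"
    unfolding enc_nested by (intro step assms)
  then show "?e < S" by (simp add: S_def power3_eq_cube mult.assoc)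
qed

lemma enc_dec:
  "enc (dA e) (dB e) (dC e) (dX e) (dY e) = e"
proof -
  have 2: "e div N ^ 2 = e div N div N" "e div N ^ 3 = e div N div N div N"
    by (simp_all add: power2_eq_square power3_eq_cube div_mult2_eq mult.assoc)
  show ?thesis unfolding enc_nested d_defs 2
    by (simp add: mod_mult_div_eq mult_div_mod_eq add.commute)
qed

lemma dec_less:
  assumes "e < S"
  shows "dA e < N" "dB e < N" "dC e < N" "dX e < W" "dY e < W"
proof -
  have "e < W * W * N ^ 3" using assms by (simp add: S_def algebra_simps)
  then have "e div N ^ 3 < W * W" by (rule less_mult_imp_div_less)
  then show "dY e < W" unfolding dY_def by (rule less_mult_imp_div_less)
qed (use N W_pos in \<open>auto simp: d_defs\<close>)

lemma payload_less:
  "\<lbrakk>a < N; b < N; X < W\<rbrakk> \<Longrightarrow> a + N * b + N ^ 3 * X < S"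
  "\<lbrakk>a < N; b < N; c < N\<rbrakk> \<Longrightarrow> a + N * b + N ^ 2 * c < S"
  using dec_enc(6)[of a b 0 X 0] dec_enc(6)[of a b c 0 0] N W_pos by (simp_all add: enc_def)

text \<open>The first eight entries are the rules between proper vertices, with \<open>HP\<close>
  split by hub. The others use \<open>e\<close> as an offset into each of the four blocks of codes
  and attach the vertex to both hubs if it is junk.\<close>

definition cands :: "nat \<Rightarrow> (bool \<times> nat \<times> nat) list" where
  "cands e = (let a = dA e; b = dB e; c = dC e; X = dX e; Y = dY e in
     [(okP a b X \<and> okT c X, code (PV a b X), code (TV a b c)),
      (okP a b X \<and> okM a c X, code (PV a b X), code (MV a c X)),
      (okP a b X \<and> okM c a Y \<and> reversed X Y, code (PV a b X), code (MV c a Y)),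
      (okP a b X \<and> okP a b Y \<and> X < Y, code (PV a b X), code (PV a b Y)),
      (okP a b X \<and> okM a b Y \<and> slot X 0 = slot Y 3, code (PV a b X), code (MV a b Y)),
      (okM U a X \<and> flat X, of_bool (marked a), code (MV U a X)),
      (okP U U X \<and> flat X, 0, code (PV U U X)),
      (okP U U X \<and> flat X, 1, code (PV U U X)),
      (2 \<le> e, 0, 0 * S + e), (2 \<le> e, 1, 0 * S + e),
      (\<not> (c = 0 \<and> Y = 0 \<and> okP a b X), 0, 1 * S + e),
      (\<not> (c = 0 \<and> Y = 0 \<and> okP a b X), 1, 1 * S + e),
      (\<not> (c = 0 \<and> Y = 0 \<and> okM a b X), 0, 2 * S + e),
      (\<not> (c = 0 \<and> Y = 0 \<and> okM a b X), 1, 2 * S + e),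
      (N ^ 3 \<le> e, 0, 3 * S + e), (N ^ 3 \<le> e, 1, 3 * S + e)])"

lemma S_ge2: "2 \<le> S"
proof -
  have "2 \<le> W" using D D_le_W by linarith
  also have "W \<le> N ^ 3 * W" using N by simp
  also have "\<dots> \<le> N ^ 3 * W * W" using W_pos by simp
  finally show ?thesis by (simp add: S_def)
qed

lemma tag_inj:
  assumes "e < S" "e' < S" "k * S + e = k' * S + e'"
  shows "k = k' \<and> e = e'"
proof -
  have "(k * S + e) div S = k" "(k * S + e) mod S = e" "(k' * S + e') div S = k'" "(k' * S + e') mod S = e'"
    using assms(1,2) by auto
  then show ?thesis using assms(3) by metis
qed

lemma code_enc:
  "code (PV a b X) = 1 * S + enc a b 0 X 0" "code (MV a b X) = 2 * S + enc a b 0 X 0"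
  "code (TV a b c) = 3 * S + enc a b c 0 0" "code (HB g) = 0 * S + of_bool g"
  by (simp_all add: enc_def)

lemma enc_inj:
  assumes "a < N" "b < N" "c < N" "X < W" "Y < W" "a' < N" "b' < N" "c' < N" "X' < W" "Y' < W"
  shows "enc a b c X Y = enc a' b' c' X' Y' \<longleftrightarrow> a = a' \<and> b = b' \<and> c = c' \<and> X = X' \<and> Y = Y'"
  using dec_enc[OF assms(1-5)] dec_enc[OF assms(6-10)] by metis

lemma core_cases:
  assumes "x \<in> core"
  obtains (HB) g where "x = HB g"
  | (PV) a b X where "x = PV a b X" "a < N" "b < N" "X < W" "okP a b X"
  | (MV) a b X where "x = MV a b X" "a < N" "b < N" "X < W" "okM a b X"
  | (TV) a b c where "x = TV a b c" "a < N" "b < N" "c < N"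
  using assms unfolding core_def by auto

lemma of_bool_less_S: "of_bool g < S" using S_ge2 by (cases g) auto

lemma code_less: "x \<in> core \<Longrightarrow> code x < 4 * S"
proof (erule core_cases)
  fix g assume "x = HB g"
  then show ?thesis using of_bool_less_S[of g] by simp
next
  fix a b X assume "x = PV a b X" "a < N" "b < N" "X < W"
  then show ?thesis using payload_less(1)[of a b X] by simp
next
  fix a b X assume "x = MV a b X" "a < N" "b < N" "X < W"
  then show ?thesis using payload_less(1)[of a b X] by simp
next
  fix a b c assume "x = TV a b c" "a < N" "b < N" "c < N"
  then show ?thesis using payload_less(2)[of a b c] by simp
qed

definition tag :: "vtx \<Rightarrow> nat" where
  "tag x = (case x of HB g \<Rightarrow> 0 | PV a b X \<Rightarrow> 1 | MV a b X \<Rightarrow> 2 | TV a b c \<Rightarrow> 3 | JV j \<Rightarrow> 0)"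

definition payload :: "vtx \<Rightarrow> nat" where
  "payload x = (case x of HB g \<Rightarrow> of_bool g | PV a b X \<Rightarrow> enc a b 0 X 0 | MV a b X \<Rightarrow> enc a b 0 X 0
     | TV a b c \<Rightarrow> enc a b c 0 0 | JV j \<Rightarrow> j)"

lemma code_core: "x \<in> core \<Longrightarrow> code x = tag x * S + payload x \<and> payload x < S"
  by (erule core_cases) (use N W_pos of_bool_less_S in \<open>auto simp: tag_def payload_def code_enc dec_enc simp del: code.simps\<close>)

lemma inj_code: "inj_on code vertices"
proof -
  have V: "vertices = core \<union> JV ` junk" unfolding vertices_def core_def by simp
  have "inj_on code core"
  proof (rule inj_onI)
    fix x y assume xy: "x \<in> core" "y \<in> core" "code x = code y"
    then have "tag x = tag y" "payload x = payload y" using tag_inj code_core by metis+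
    then show "x = y" using xy(1,2)
      by (elim core_cases) (use N W_pos in \<open>auto simp: tag_def payload_def enc_inj of_bool_def split: if_splits\<close>)
  qed
  moreover have "inj_on code (JV ` junk)" by (auto simp: inj_on_def)
  moreover have "code ` core \<inter> code ` JV ` junk = {}" by (auto simp: junk_def)
  ultimately show ?thesis unfolding V inj_on_Un by blast
qed

lemma code_vertices: "code ` vertices = {..<4 * S}"
proof -
  have V: "vertices = core \<union> JV ` junk" unfolding vertices_def core_def by simp
  have "code ` JV ` junk = junk" by (auto simp: image_image)
  then show ?thesis unfolding V image_Un using code_less by (auto simp: junk_def)
qed

lemma not_junk:
  assumes "e < S" "k < 4"
  shows "k * S + e \<notin> junk \<longleftrightarrow> (\<exists>x\<in>core. tag x = k \<and> payload x = e)"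
proof -
  have "k * S \<le> 3 * S" using assms(2) by (intro mult_le_mono1) simp
  then have "k * S + e < 4 * S" using assms(1) by linarith
  moreover have "k * S + e \<in> code ` core \<longleftrightarrow> (\<exists>x\<in>core. code x = k * S + e)"
    by (metis imageE image_eqI)
  ultimately have "k * S + e \<notin> junk \<longleftrightarrow> (\<exists>x\<in>core. code x = k * S + e)" by (simp add: junk_def)
  also have "\<dots> \<longleftrightarrow> (\<exists>x\<in>core. tag x = k \<and> payload x = e)"
    using code_core tag_inj[OF _ assms(1)] by metis
  finally show ?thesis .
qed

lemma core_tags:
  "(\<exists>x\<in>core. tag x = 0 \<and> payload x = e) \<longleftrightarrow> (\<exists>g. e = of_bool g)" (is "?A0 = ?B0")
  "(\<exists>x\<in>core. tag x = 1 \<and> payload x = e) \<longleftrightarrow>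
    (\<exists>a b X. a < N \<and> b < N \<and> X < W \<and> okP a b X \<and> enc a b 0 X 0 = e)" (is "?A1 = ?B1")
  "(\<exists>x\<in>core. tag x = 2 \<and> payload x = e) \<longleftrightarrow>
    (\<exists>a b X. a < N \<and> b < N \<and> X < W \<and> okM a b X \<and> enc a b 0 X 0 = e)" (is "?A2 = ?B2")
  "(\<exists>x\<in>core. tag x = 3 \<and> payload x = e) \<longleftrightarrow>
    (\<exists>a b c. a < N \<and> b < N \<and> c < N \<and> enc a b c 0 0 = e)" (is "?A3 = ?B3")
proof -
  have fwd0: ?B0 if "x \<in> core" "tag x = 0" "payload x = e" for x
    using that(1)
  proof (cases rule: core_cases)
    case (HB g)
    then show ?thesis using that by (intro exI[of _ g]) (simp add: payload_def)
  qed (use that in \<open>simp_all add: tag_def\<close>)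
  have fwd1: ?B1 if "x \<in> core" "tag x = 1" "payload x = e" for x
    using that(1)
  proof (cases rule: core_cases)
    case (PV a b X)
    then show ?thesis using that by (intro exI[of _ a] exI[of _ b] exI[of _ X]) (simp add: payload_def)
  qed (use that in \<open>simp_all add: tag_def\<close>)
  have fwd2: ?B2 if "x \<in> core" "tag x = 2" "payload x = e" for x
    using that(1)
  proof (cases rule: core_cases)
    case (MV a b X)
    then show ?thesis using that by (intro exI[of _ a] exI[of _ b] exI[of _ X]) (simp add: payload_def)
  qed (use that in \<open>simp_all add: tag_def\<close>)
  have fwd3: ?B3 if "x \<in> core" "tag x = 3" "payload x = e" for x
    using that(1)
  proof (cases rule: core_cases)
    case (TV a b c)
    then show ?thesis using that by (intro exI[of _ a] exI[of _ b] exI[of _ c]) (simp add: payload_def)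
  qed (use that in \<open>simp_all add: tag_def\<close>)
  have mem: "HB g \<in> core" "a < N \<Longrightarrow> b < N \<Longrightarrow> X < W \<Longrightarrow> okP a b X \<Longrightarrow> PV a b X \<in> core"
    "a < N \<Longrightarrow> b < N \<Longrightarrow> X < W \<Longrightarrow> okM a b X \<Longrightarrow> MV a b X \<in> core"
    "a < N \<Longrightarrow> b < N \<Longrightarrow> c < N \<Longrightarrow> TV a b c \<in> core" for g a b c X
    unfolding core_def by blast+
  have tp: "tag (HB g) = 0" "tag (PV a b X) = 1" "tag (MV a b X) = 2" "tag (TV a b c) = 3"
    "payload (HB g) = of_bool g" "payload (PV a b X) = enc a b 0 X 0"
    "payload (MV a b X) = enc a b 0 X 0" "payload (TV a b c) = enc a b c 0 0" for g a b c X
    by (simp_all add: tag_def payload_def)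
  show "?A0 = ?B0"
  proof
    assume ?B0
    then obtain g where "e = of_bool g" by blast
    then show ?A0 by (intro bexI[of _ "HB g"]) (simp_all add: tp mem)
  qed (use fwd0 in blast)
  show "?A1 = ?B1"
  proof
    assume ?B1
    then obtain a b X where "a < N" "b < N" "X < W" "okP a b X" "enc a b 0 X 0 = e" by blast
    then show ?A1 by (intro bexI[of _ "PV a b X"]) (simp_all add: tp mem)
  qed (use fwd1 in blast)
  show "?A2 = ?B2"
  proof
    assume ?B2
    then obtain a b X where "a < N" "b < N" "X < W" "okM a b X" "enc a b 0 X 0 = e" by blast
    then show ?A2 by (intro bexI[of _ "MV a b X"]) (simp_all add: tp mem)
  qed (use fwd2 in blast)
  show "?A3 = ?B3"
  proof
    assume ?B3
    then obtain a b c where "a < N" "b < N" "c < N" "enc a b c 0 0 = e" by blast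
    then show ?A3 by (intro bexI[of _ "TV a b c"]) (simp_all add: tp mem)
  qed (use fwd3 in blast)
qed

lemma junk_iff:
  assumes e: "e < S"
  shows "0 * S + e \<in> junk \<longleftrightarrow> 2 \<le> e"
    "1 * S + e \<in> junk \<longleftrightarrow> \<not> (dC e = 0 \<and> dY e = 0 \<and> okP (dA e) (dB e) (dX e))"
    "2 * S + e \<in> junk \<longleftrightarrow> \<not> (dC e = 0 \<and> dY e = 0 \<and> okM (dA e) (dB e) (dX e))"
    "3 * S + e \<in> junk \<longleftrightarrow> N ^ 3 \<le> e"
proof -
  have d: "dA e < N" "dB e < N" "dC e < N" "dX e < W" "dY e < W" using dec_less[OF e] by auto
  have "(\<exists>x\<in>core. tag x = 0 \<and> payload x = e) \<longleftrightarrow> (\<exists>g. e = of_bool g)"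
    by (rule core_tags)
  also have "\<dots> \<longleftrightarrow> \<not> 2 \<le> e"
  proof
    assume "\<not> 2 \<le> e"
    then have "e = of_bool (e = 1)" by (cases e) auto
    then show "\<exists>g. e = of_bool g" by blast
  qed (auto simp: of_bool_def split: if_splits)
  finally show "0 * S + e \<in> junk \<longleftrightarrow> 2 \<le> e" using not_junk[OF e, of 0] by auto
  \<comment> \<open>Shared by the two kinds of vertices with an array; \<open>Q\<close> stands for
    either incidence test.\<close>
  have P: "(\<exists>a b X. a < N \<and> b < N \<and> X < W \<and> Q a b X \<and> enc a b 0 X 0 = e) \<longleftrightarrow>
    dC e = 0 \<and> dY e = 0 \<and> Q (dA e) (dB e) (dX e)" for Q
  proof
    assume "dC e = 0 \<and> dY e = 0 \<and> Q (dA e) (dB e) (dX e)"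
    then show "\<exists>a b X. a < N \<and> b < N \<and> X < W \<and> Q a b X \<and> enc a b 0 X 0 = e"
      using d enc_dec[of e] by metis
  qed (use dec_enc N W_pos in auto)
  have "(\<exists>x\<in>core. tag x = 1 \<and> payload x = e) \<longleftrightarrow> (\<exists>a b X. a < N \<and> b < N \<and> X < W \<and> okP a b X \<and> enc a b 0 X 0 = e)"
    by (rule core_tags)
  also note P
  finally have *: "(\<exists>x\<in>core. tag x = 1 \<and> payload x = e) \<longleftrightarrow> dC e = 0 \<and> dY e = 0 \<and> okP (dA e) (dB e) (dX e)" .
  have "(1 :: nat) < 4" by simp
  from not_junk[OF e this] show "1 * S + e \<in> junk \<longleftrightarrow> \<not> (dC e = 0 \<and> dY e = 0 \<and> okP (dA e) (dB e) (dX e))"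
    unfolding * by blast
  have "(\<exists>x\<in>core. tag x = 2 \<and> payload x = e) \<longleftrightarrow> (\<exists>a b X. a < N \<and> b < N \<and> X < W \<and> okM a b X \<and> enc a b 0 X 0 = e)"
    by (rule core_tags)
  also note P
  finally have *: "(\<exists>x\<in>core. tag x = 2 \<and> payload x = e) \<longleftrightarrow> dC e = 0 \<and> dY e = 0 \<and> okM (dA e) (dB e) (dX e)" .
  have "(2 :: nat) < 4" by simp
  from not_junk[OF e this] show "2 * S + e \<in> junk \<longleftrightarrow> \<not> (dC e = 0 \<and> dY e = 0 \<and> okM (dA e) (dB e) (dX e))"
    unfolding * by blast
  have "(\<exists>x\<in>core. tag x = 3 \<and> payload x = e) \<longleftrightarrow> (\<exists>a b c. a < N \<and> b < N \<and> c < N \<and> enc a b c 0 0 = e)"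
    by (rule core_tags)
  also have "\<dots> \<longleftrightarrow> dX e = 0 \<and> dY e = 0"
  proof
    assume "dX e = 0 \<and> dY e = 0"
    then show "\<exists>a b c. a < N \<and> b < N \<and> c < N \<and> enc a b c 0 0 = e"
      using d enc_dec[of e] by metis
  qed (use dec_enc W_pos in auto)
  also have "\<dots> \<longleftrightarrow> \<not> N ^ 3 \<le> e"
  proof -
    have "dX e = 0 \<and> dY e = 0 \<longleftrightarrow> e div N ^ 3 = 0"
      unfolding dX_def dY_def using W_pos by (metis div_0 mod_0 mult_div_mod_eq add_0 mult_0_right)
    then show ?thesis using N by (simp add: div_eq_0_iff not_le)
  qed
  finally show "3 * S + e \<in> junk \<longleftrightarrow> N ^ 3 \<le> e" using not_junk[OF e, of 3] by auto
qed

lemma cands_edge: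
  assumes "e < S" "(True, u, v) \<in> set (cands e)"
  shows "\<exists>x y. edge x y \<and> u = code x \<and> v = code y"
proof -
  note d = dec_less[OF assms(1)] and J = junk_iff[OF assms(1)]
  have H: "code (HB False) = 0" "code (HB True) = 1" "code (HB (marked (dA e))) = of_bool (marked (dA e))" by auto
  show ?thesis
    using assms(2) unfolding cands_def Let_def list.set insert_iff empty_iff prod.inject
    apply (elim disjE conjE)
    subgoal using edge.PT[OF d(1,2,3,4)] by blast
    subgoal using edge.PM[OF d(1,2,3,4)] by blast
    subgoal using edge.PM_rev[OF d(1,2,3,4,5)] by blast
    subgoal using edge.PP[OF d(1,2,4,5)] by blast
    subgoal using edge.PM_switch[OF d(1,2,4,5)] by blast
    subgoal using edge.HM[OF d(1,4)] H by metis
    subgoal using edge.HP[OF d(4), of False] H by metis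
    subgoal using edge.HP[OF d(4), of True] H by metis
    subgoal using edge.HJ[of "0 * S + e" False] J H by (metis code.simps(5))
    subgoal using edge.HJ[of "0 * S + e" True] J H by (metis code.simps(5))
    subgoal using edge.HJ[of "1 * S + e" False] J H by (metis code.simps(5))
    subgoal using edge.HJ[of "1 * S + e" True] J H by (metis code.simps(5))
    subgoal using edge.HJ[of "2 * S + e" False] J H by (metis code.simps(5))
    subgoal using edge.HJ[of "2 * S + e" True] J H by (metis code.simps(5))
    subgoal using edge.HJ[of "3 * S + e" False] J H by (metis code.simps(5))
    subgoal using edge.HJ[of "3 * S + e" True] J H by (metis code.simps(5))
    by simp
qed

text \<open>Parameters that a rule does not mention are set to 0. An edge to a junk vertex is found
  at the offset of that vertex in its block.\<close>

lemma edge_cands: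
  assumes "edge x y"
  shows "\<exists>e<S. (True, code x, code y) \<in> set (cands e)"
  using assms
proof cases
  case (PT a b c X)
  then show ?thesis using N W_pos dec_enc[of a b c X 0]
    by (intro exI[of _ "enc a b c X 0"]) (auto simp: cands_def Let_def)
next
  case (PM a b c X)
  then show ?thesis using N W_pos dec_enc[of a b c X 0]
    by (intro exI[of _ "enc a b c X 0"]) (auto simp: cands_def Let_def)
next
  case (PM_rev a b c X Y)
  then show ?thesis using dec_enc[of a b c X Y]
    by (intro exI[of _ "enc a b c X Y"]) (auto simp: cands_def Let_def)
next
  case (PP a b X Y)
  then show ?thesis using N dec_enc[of a b 0 X Y]
    by (intro exI[of _ "enc a b 0 X Y"]) (auto simp: cands_def Let_def)
next
  case (PM_switch a b X Y)
  then show ?thesis using N dec_enc[of a b 0 X Y]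
    by (intro exI[of _ "enc a b 0 X Y"]) (auto simp: cands_def Let_def)
next
  case (HM a X)
  then show ?thesis using N W_pos dec_enc[of a 0 0 X 0]
    by (intro exI[of _ "enc a 0 0 X 0"]) (auto simp: cands_def Let_def)
next
  case (HP X g)
  then show ?thesis using N W_pos dec_enc[of 0 0 0 X 0]
    by (intro exI[of _ "enc 0 0 0 X 0"]) (cases g, auto simp: cands_def Let_def)
next
  case (HJ j g)
  then have j: "j < 4 * S" by (simp add: junk_def)
  define k e where "k = j div S" and "e = j mod S"
  have e: "e < S" using S_pos by (simp add: e_def)
  have k: "j = k * S + e" unfolding k_def e_def by (rule div_mult_mod_eq[symmetric])
  have "k < 4" using j unfolding k_def by (intro less_mult_imp_div_less) (simp add: mult.commute)
  then consider "k = 0" | "k = 1" | "k = 2" | "k = 3" by linarith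
  then have "(True, of_bool g, j) \<in> set (cands e)"
    using HJ junk_iff[OF e] unfolding k by cases (cases g; simp add: cands_def Let_def)+
  then show ?thesis using HJ e by auto
qed

lemma code_PV_less: "\<lbrakk>a < N; b < N; X < W\<rbrakk> \<Longrightarrow> code (PV a b X) < 2 * S"
  using payload_less(1)[of a b X] by simp

text \<open>The blocks are ordered so that every rule leads upwards, and \<open>PP\<close> orders
  its arrays. Junk codes exceed the hub codes, since 0 and 1 are taken by the hubs
  themselves.\<close>

lemma cands_less:
  assumes "e < S" "(True, u, v) \<in> set (cands e)"
  shows "u < v \<and> v < Nv"
proof -
  obtain x y where xy: "edge x y" "u = code x" "v = code y" using cands_edge[OF assms] by blast
  have "v < Nv" using edge_vertices[OF xy(1)] code_vertices xy(3) by (auto simp: Nv_def)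
  moreover have "u < v"
    using xy(1) unfolding xy(2,3)
  proof cases
    case (PP a b X Y)
    then show "code x < code y" using N by simp
  next
    case (HJ j g)
    have "HB g' \<in> core" for g' by (simp add: core_def)
    then have "code (HB g') \<noteq> j" for g' using HJ unfolding junk_def by blast
    from this[of False] this[of True] show "code x < code y" using HJ by (cases g) auto
  next
    case (HM a X)
    have "of_bool (marked a) < 2 * S" using of_bool_less_S[of "marked a"] by linarith
    then show "code x < code y" using HM by simp
  next
    case (HP X g)
    have "of_bool g < S" by (rule of_bool_less_S)
    then show "code x < code y" using HP by simp
  next
    case (PT a b c X)
    then show "code x < code y" using code_PV_less[of a b X] by simp
  next
    case (PM a b c X)
    then show "code x < code y" using code_PV_less[of a b X] by simp
  next
    case (PM_rev a b c X Y)
    then show "code x < code y" using code_PV_less[of a b X] by simp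
  next
    case (PM_switch a b X Y)
    then show "code x < code y" using code_PV_less[of a b X] by simp
  qed
  ultimately show ?thesis by simp
qed

definition edges :: "nat \<Rightarrow> (nat \<times> nat) list" where
  "edges k = fold add_edge (concat (map cands [0..<k])) []"

lemma edges_Suc: "edges (Suc k) = fold add_edge (cands k) (edges k)"
  by (simp add: edges_def)

lemma set_edges: "set (edges S) = {(code x, code y) | x y. edge x y}"
  unfolding edges_def set_fold_add_edge using cands_edge edge_cands by fastforce

lemma distinct_edges: "distinct (edges k)"
  unfolding edges_def by (rule distinct_fold_add_edge) simp

lemma length_edges: "length (edges k) \<le> 16 * k"
proof (induction k)
  case (Suc k)
  have "length (cands k) = 16" by (simp add: cands_def Let_def)
  then show ?case using length_fold_add_edge[of "cands k" "edges k"] Suc by (simp add: edges_Suc)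
qed (simp add: edges_def)

end

section \<open>Code that generates the edge candidates\<close>

definition on_expr :: "nat \<Rightarrow> nat \<Rightarrow> expr" where
  "on_expr a x = Ld (Op ADD (Vr 14) (Op ADD (Op MUL (Vr a) (Vr 6)) (Vr x)))"

definition on_exprs :: "nat \<Rightarrow> nat \<Rightarrow> nat list \<Rightarrow> expr" where
  "on_exprs a k is = conj_expr (map (\<lambda>i. on_expr a (k + i)) is)"

definition okP_expr where
  "okP_expr a b k = Op BAND (on_exprs a k [0,1,2,3,4]) (on_exprs b k [0,1,2,3,5])"

definition okM_expr where
  "okM_expr a b k = Op BAND (on_exprs a k [0,1,2,3,4]) (on_exprs b k [2,3,4,5,6])"

definition okT_expr where "okT_expr c k = on_exprs c k [0,1,2]"

definition flat_expr where
  "flat_expr k = conj_expr (map (\<lambda>i. eq_expr (Vr (k + i)) (Vr k)) [0,1,2,3,4,5,6])"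

definition reversed_expr where
  "reversed_expr k l = conj_expr (map (\<lambda>i. eq_expr (Vr (l + i)) (Vr (k + (6 - i)))) [0,1,2,3,4,5,6])"

definition marked_expr where
  "marked_expr a = eq_expr (Op SHR (Vr a) (Vr 4)) (Cn 3)"

definition tagged :: "nat \<Rightarrow> expr \<Rightarrow> expr" where
  "tagged t e = Op ADD (Op MUL (Cn t) (Vr 10)) e"

definition id_expr where
  "id_expr t a b X = tagged t (Op ADD (Op ADD (Vr a) (Op MUL (Vr 5) (Vr b))) (Op MUL (Vr 9) (Vr X)))"

definition idT_expr where
  "idT_expr a b c = tagged 3 (Op ADD (Op ADD (Vr a) (Op MUL (Vr 5) (Vr b))) (Op MUL (Vr 8) (Vr c)))"

definition junk_expr where
  "junk_expr ok = not_expr (Op BAND (Op BAND (eq_expr (Vr 25) (Cn 0)) (eq_expr (Vr 27) (Cn 0))) ok)"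

definition cand_exprs :: "(expr \<times> expr \<times> expr) list" where
  "cand_exprs =
     [(Op BAND (okP_expr 23 24 40) (okT_expr 25 40), id_expr 1 23 24 26, idT_expr 23 24 25),
      (Op BAND (okP_expr 23 24 40) (okM_expr 23 25 40), id_expr 1 23 24 26, id_expr 2 23 25 26),
      (Op BAND (okP_expr 23 24 40) (Op BAND (okM_expr 25 23 50) (reversed_expr 40 50)),
        id_expr 1 23 24 26, id_expr 2 25 23 27),
      (Op BAND (okP_expr 23 24 40) (Op BAND (okP_expr 23 24 50) (less_expr (Vr 26) (Vr 27))),
        id_expr 1 23 24 26, id_expr 1 23 24 27),
      (Op BAND (okP_expr 23 24 40) (Op BAND (okM_expr 23 24 50) (eq_expr (Vr 40) (Vr 53))),
        id_expr 1 23 24 26, id_expr 2 23 24 27),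
      (Op BAND (okM_expr 16 23 40) (flat_expr 40), marked_expr 23, id_expr 2 16 23 26),
      (Op BAND (okP_expr 16 16 40) (flat_expr 40), Cn 0, id_expr 1 16 16 26),
      (Op BAND (okP_expr 16 16 40) (flat_expr 40), Cn 1, id_expr 1 16 16 26),
      (less_expr (Cn 1) (Vr 17), Cn 0, tagged 0 (Vr 17)), (less_expr (Cn 1) (Vr 17), Cn 1, tagged 0 (Vr 17)),
      (junk_expr (okP_expr 23 24 40), Cn 0, tagged 1 (Vr 17)), (junk_expr (okP_expr 23 24 40), Cn 1, tagged 1 (Vr 17)),
      (junk_expr (okM_expr 23 24 40), Cn 0, tagged 2 (Vr 17)), (junk_expr (okM_expr 23 24 40), Cn 1, tagged 2 (Vr 17)),
      (not_expr (less_expr (Vr 17) (Vr 9)), Cn 0, tagged 3 (Vr 17)),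
      (not_expr (less_expr (Vr 17) (Vr 9)), Cn 1, tagged 3 (Vr 17))]"

definition digits_code :: "nat \<Rightarrow> nat \<Rightarrow> com list" where
  "digits_code k x = map (\<lambda>i. Assign (k + i) (Op MOD (Op DIV (Vr x) (pow_expr (Vr 6) i)) (Vr 6))) [0,1,2,3,4,5,6]"

definition decode_code :: "com list" where
  "decode_code =
     [Assign 23 (Op MOD (Vr 17) (Vr 5)), Assign 24 (Op MOD (Op DIV (Vr 17) (Vr 5)) (Vr 5)),
      Assign 25 (Op MOD (Op DIV (Vr 17) (Vr 8)) (Vr 5)), Assign 26 (Op MOD (Op DIV (Vr 17) (Vr 9)) (Vr 7)),
      Assign 27 (Op DIV (Op DIV (Vr 17) (Vr 9)) (Vr 7))]"

lemma loopfree_seqs [simp]: "loopfree (seqs cs) \<longleftrightarrow> (\<forall>c\<in>set cs. loopfree c)"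
  by (induction cs) auto

lemma den_seqs_append: "den w (seqs (cs @ ds)) p = den w (seqs ds) (den w (seqs cs) p)"
proof (induction cs arbitrary: p)
  case (Cons c cs)
  then show ?case by (cases p) simp
next
  case Nil
  then show ?case by (cases p) simp
qed

context reduction begin

text \<open>Free of loops, so each of the \<open>S\<close> rounds has the same constant cost bound;
  this makes the listing linear in the number of vertices.\<close>

definition enum_body :: com where
  "enum_body = seqs (decode_code @ digits_code 40 26 @ digits_code 50 27 @ map emit cand_exprs @
     [Assign 17 (Op ADD (Vr 17) (Cn 1))])"

definition decoded :: "nat \<Rightarrow> store \<Rightarrow> bool" where
  "decoded e s \<longleftrightarrow> base s \<and> e < S \<and> s 17 = e \<and> s 23 = dA e \<and> s 24 = dB e \<and> s 25 = dC e \<and> s 26 = dX e \<and>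
     s 27 = dY e \<and> (\<forall>i<7. s (40 + i) = slot (dX e) i \<and> s (50 + i) = slot (dY e) i)"

lemma keeps_decoded: "keeps (decoded e)"
  unfolding keeps_def decoded_def base_def by auto

lemma w1': "1 \<le> w" using w_ge by simp

lemma slot_bound: "slot X i < 2 ^ w"
proof -
  have "1 * D \<le> N * D" using N by (intro mult_le_mono1) simp
  then show ?thesis using slot_less[of X i] ND_le S_less(3) by linarith
qed

lemma less_w: "x \<le> S \<Longrightarrow> x < 2 ^ w" using S_less by linarith

lemma N_le_S: "N \<le> S" "N ^ 3 \<le> S" "W \<le> S"
proof -
  have "N ^ 3 * 1 \<le> N ^ 3 * (W * W)" "1 * W \<le> (N ^ 3 * W) * W"
    by (intro mult_le_mono; use W_pos N in simp)+
  moreover have "N \<le> N ^ 3" using N by (intro self_le_power) auto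
  ultimately show "N \<le> S" "N ^ 3 \<le> S" "W \<le> S" unfolding S_def mult.assoc by linarith+
qed

lemma small_w: "c < 64 \<Longrightarrow> (c :: nat) < 2 ^ w"
  using power_increasing[OF w_ge, of "2 :: nat"] by simp

context
  fixes e s m es
  assumes dec: "decoded e s" and laid: "laid es m"
begin

lemma vars: "s 4 = h" "s 5 = N" "s 6 = D" "s 8 = N ^ 2" "s 9 = N ^ 3" "s 10 = S" "s 14 = 2 * Z" "s 16 = U"
  "s 17 = e" "s 23 = dA e" "s 24 = dB e" "s 25 = dC e" "s 26 = dX e" "s 27 = dY e" "e < S"
  using dec by (auto simp: decoded_def base_def)

lemma slots: "i < 7 \<Longrightarrow> s (40 + i) = slot (dX e) i" "i < 7 \<Longrightarrow> s (50 + i) = slot (dY e) i"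
  using dec by (auto simp: decoded_def)

lemma ev_on:
  assumes "s a < N" "s x < D"
  shows "ev w s m (on_expr a x) = of_bool (on (s a) (s x))"
proof -
  have less: "s a * D + s x < N * D"
  proof -
    have "s a * D + s x < s a * D + D" "(s a + 1) * D \<le> N * D"
      using assms mult_le_mono1[of "s a + 1" N D] by auto
    then show ?thesis by simp
  qed
  then have bound: "s a * D + s x < Z" "2 * Z + (s a * D + s x) < 2 ^ w"
    using ND_le S_less Z_less by linarith+
  have "ev w s m (Op ADD (Vr 14) (Op ADD (Op MUL (Vr a) (Vr 6)) (Vr x))) = 2 * Z + (s a * D + s x)"
    using bound by (subst ev_poly) (auto simp: vars)
  moreover have "m (2 * Z + (s a * D + s x)) = of_bool (on (s a) (s x))"
    using laid bound(1) less assms(2) by (simp add: laid_def lay_def)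
  ultimately show ?thesis by (simp add: on_expr_def)
qed

lemma ev_conj_map:
  "(\<And>i. i \<in> set is \<Longrightarrow> ev w s m (f i) = of_bool (P i)) \<Longrightarrow> ev w s m (conj_expr (map f is)) = of_bool (\<forall>i\<in>set is. P i)"
  using ev_conj_expr[OF w1', of s m "map f is" "map P is"] by (simp add: list_all2_conv_all_nth)

lemma ev_on_exprs:
  assumes "s a < N" "\<And>i. i < 7 \<Longrightarrow> s (k + i) = slot X i" "\<forall>i\<in>set is. i < 7"
  shows "ev w s m (on_exprs a k is) = of_bool (\<forall>i\<in>set is. on (s a) (slot X i))"
  unfolding on_exprs_def using assms slot_less by (intro ev_conj_map) (simp add: ev_on)

lemma ev_ok:
  assumes "\<And>i. i < 7 \<Longrightarrow> s (k + i) = slot X i" "s a < N" "s c < N"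
  shows "ev w s m (okP_expr a c k) = of_bool (okP (s a) (s c) X)"
    "ev w s m (okM_expr a c k) = of_bool (okM (s a) (s c) X)"
    "ev w s m (okT_expr a k) = of_bool (okT (s a) X)"
proof -
  note a = ev_on_exprs[OF assms(2,1)] and c = ev_on_exprs[OF assms(3,1)]
  have a': "ev w s m (on_exprs a k [0,1,2,3,4]) = of_bool (\<forall>i\<in>{0,1,2,3,4}. on (s a) (slot X i))"
    "ev w s m (on_exprs a k [0,1,2]) = of_bool (\<forall>i\<in>{0,1,2}. on (s a) (slot X i))"
    using a[of "[0,1,2,3,4]"] a[of "[0,1,2]"] by simp_all
  have c': "ev w s m (on_exprs c k [0,1,2,3,5]) = of_bool (\<forall>i\<in>{0,1,2,3,5}. on (s c) (slot X i))"
    "ev w s m (on_exprs c k [2,3,4,5,6]) = of_bool (\<forall>i\<in>{2,3,4,5,6}. on (s c) (slot X i))"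
    using c[of "[0,1,2,3,5]"] c[of "[2,3,4,5,6]"] by simp_all
  show "ev w s m (okP_expr a c k) = of_bool (okP (s a) (s c) X)"
    unfolding okP_expr_def okP_def by (intro ev_and a' c')
  show "ev w s m (okM_expr a c k) = of_bool (okM (s a) (s c) X)"
    unfolding okM_expr_def okM_def by (intro ev_and a' c')
  show "ev w s m (okT_expr a k) = of_bool (okT (s a) X)"
    unfolding okT_expr_def okT_def by (rule a')
qed

lemma ev_flat: "ev w s m (flat_expr 40) = of_bool (flat (dX e))"
proof -
  have "ev w s m (flat_expr 40) = of_bool (\<forall>i\<in>set [0,1,2,3,4,5,6]. slot (dX e) i = slot (dX e) 0)"
    unfolding flat_expr_def
  proof (rule ev_conj_map)
    fix i :: nat assume "i \<in> set [0,1,2,3,4,5,6]"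
    then have "i < 7" by auto
    then show "ev w s m (eq_expr (Vr (40 + i)) (Vr 40)) = of_bool (slot (dX e) i = slot (dX e) 0)"
      using ev_eq_expr[OF w1', of s m "Vr (40 + i)" "Vr 40"] slots(1)[of i] slots(1)[of 0] slot_bound by simp
  qed
  then show ?thesis unfolding flat_def all_less_7 by simp
qed

lemma ev_reversed: "ev w s m (reversed_expr 40 50) = of_bool (reversed (dX e) (dY e))"
proof -
  have "ev w s m (reversed_expr 40 50) = of_bool (\<forall>i\<in>set [0,1,2,3,4,5,6]. slot (dY e) i = slot (dX e) (6 - i))"
    unfolding reversed_expr_def
  proof (rule ev_conj_map)
    fix i :: nat assume "i \<in> set [0,1,2,3,4,5,6]"
    then have "i < 7" "6 - i < 7" by auto
    then show "ev w s m (eq_expr (Vr (50 + i)) (Vr (40 + (6 - i)))) = of_bool (slot (dY e) i = slot (dX e) (6 - i))"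
      using ev_eq_expr[OF w1', of s m "Vr (50 + i)" "Vr (40 + (6 - i))"] slots(2)[of i] slots(1)[of "6 - i"] slot_bound
      by simp
  qed
  then show ?thesis unfolding reversed_def all_less_7 by simp
qed

lemma d_less: "dA e < N" "dB e < N" "dC e < N" "dX e < W" "dY e < W"
  using dec_less[of e] vars by auto

lemma ev_marked: "ev w s m (marked_expr 23) = of_bool (marked (dA e))"
proof -
  have "drop_bit h (dA e) \<le> dA e" by (simp add: drop_bit_eq_div)
  then have "drop_bit h (dA e) < 2 ^ w" using d_less N_le_S less_w by (meson le_trans less_imp_le)
  moreover have "ev w s m (Cn 3) = 3" by (rule ev_Cn) simp
  moreover have "ev w s m (Op SHR (Vr 23) (Vr 4)) = drop_bit h (dA e)" by (simp add: vars)
  ultimately have "ev w s m (marked_expr 23) = of_bool (drop_bit h (dA e) = 3)"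
    unfolding marked_expr_def using small_w[of 3]
    by (subst ev_eq_expr[OF w1']) (simp_all del: ev.simps)
  then show ?thesis by (simp add: marked_def drop_bit_eq_div)
qed

lemma ev_tagged:
  assumes "poly_expr pe" "nev s pe < S" "t < 4"
  shows "ev w s m (tagged t pe) = t * S + nev s pe"
proof -
  have "t * S \<le> 3 * S" using assms(3) by (intro mult_le_mono1) simp
  then have "t * S + nev s pe < 2 ^ w" using assms(2) S_less Z_less by linarith
  then show ?thesis unfolding tagged_def using assms(1) by (subst ev_poly) (auto simp: vars)
qed

lemma ev_id:
  assumes "s a < N" "s c < N" "s x < W" "t < 4"
  shows "ev w s m (id_expr t a c x) = t * S + (s a + N * s c + N ^ 3 * s x)"
  unfolding id_expr_def using payload_less(1)[OF assms(1-3)] assms(4) by (subst ev_tagged) (auto simp: vars)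

lemma ev_idT:
  "ev w s m (idT_expr 23 24 25) = 3 * S + (dA e + N * dB e + N ^ 2 * dC e)"
  unfolding idT_expr_def using payload_less(2)[OF d_less(1-3)] by (subst ev_tagged) (auto simp: vars)

lemma ev_junk:
  assumes "ev w s m ok = of_bool p"
  shows "ev w s m (junk_expr ok) = of_bool (\<not> (dC e = 0 \<and> dY e = 0 \<and> p))"
proof -
  have "dC e < 2 ^ w" "dY e < 2 ^ w" using d_less N_le_S less_w by (meson le_trans less_imp_le)+
  then have "ev w s m (eq_expr (Vr 25) (Cn 0)) = of_bool (dC e = 0)"
    "ev w s m (eq_expr (Vr 27) (Cn 0)) = of_bool (dY e = 0)"
    using ev_eq_expr[OF w1', of s m "Vr 25" "Cn 0"] ev_eq_expr[OF w1', of s m "Vr 27" "Cn 0"] by (simp_all add: vars)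
  from ev_not_expr[OF w1' ev_and[OF ev_and[OF this] assms]] show ?thesis
    unfolding junk_expr_def by simp
qed

lemma ev_less_var:
  "ev w s m (less_expr (Cn 1) (Vr 17)) = of_bool (2 \<le> e)"
  "ev w s m (not_expr (less_expr (Vr 17) (Vr 9))) = of_bool (N ^ 3 \<le> e)"
  "ev w s m (less_expr (Vr 26) (Vr 27)) = of_bool (dX e < dY e)"
  "ev w s m (eq_expr (Vr 40) (Vr 53)) = of_bool (slot (dX e) 0 = slot (dY e) 3)"
proof -
  have one: "ev w s m (Cn 1) = 1" by (rule ev_Cn) simp
  have b: "e < 2 ^ w" "N ^ 3 < 2 ^ w" "dX e < 2 ^ w" "dY e < 2 ^ w"
    using vars d_less N_le_S less_w by (meson le_trans less_imp_le)+
  show "ev w s m (less_expr (Cn 1) (Vr 17)) = of_bool (2 \<le> e)"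
  proof -
    have "ev w s m (Cn 1) < 2 ^ w" "ev w s m (Vr 17) < 2 ^ w"
      unfolding one ev.simps(2) vars(9) using b(1) small_w[of 1] by simp_all
    from ev_less_expr[OF w1' this] have "ev w s m (less_expr (Cn 1) (Vr 17)) = of_bool (1 < e)"
      unfolding one ev.simps(2) vars(9) .
    moreover have "1 < e \<longleftrightarrow> 2 \<le> e" by linarith
    ultimately show ?thesis by simp
  qed
  have "ev w s m (less_expr (Vr 17) (Vr 9)) = of_bool (e < N ^ 3)"
    using ev_less_expr[OF w1', of s m "Vr 17" "Vr 9"] b by (simp add: vars)
  from ev_not_expr[OF w1' this] show "ev w s m (not_expr (less_expr (Vr 17) (Vr 9))) = of_bool (N ^ 3 \<le> e)"
    by (simp add: not_less)
  show "ev w s m (less_expr (Vr 26) (Vr 27)) = of_bool (dX e < dY e)"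
    using ev_less_expr[OF w1', of s m "Vr 26" "Vr 27"] b by (simp add: vars)
  show "ev w s m (eq_expr (Vr 40) (Vr 53)) = of_bool (slot (dX e) 0 = slot (dY e) 3)"
    using ev_eq_expr[OF w1', of s m "Vr 40" "Vr 53"] slots(1)[of 0] slots(2)[of 3] slot_bound by simp
qed

lemma cand_exprs_at:
  "list_all2 (\<lambda>(pe, ue, ve) (p, u, v). ev w s m pe = of_bool p \<and> ev w s m ue = u \<and> ev w s m ve = v)
    cand_exprs (cands e)"
proof -
  have X: "\<And>i. i < 7 \<Longrightarrow> s (40 + i) = slot (dX e) i" and Y: "\<And>i. i < 7 \<Longrightarrow> s (50 + i) = slot (dY e) i"
    using slots by auto
  note ok_vars = vars d_less U
  have ok: "ev w s m (okP_expr 23 24 40) = of_bool (okP (dA e) (dB e) (dX e))"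
    "ev w s m (okT_expr 25 40) = of_bool (okT (dC e) (dX e))"
    "ev w s m (okM_expr 23 25 40) = of_bool (okM (dA e) (dC e) (dX e))"
    "ev w s m (okM_expr 25 23 50) = of_bool (okM (dC e) (dA e) (dY e))"
    "ev w s m (okP_expr 23 24 50) = of_bool (okP (dA e) (dB e) (dY e))"
    "ev w s m (okM_expr 23 24 50) = of_bool (okM (dA e) (dB e) (dY e))"
    "ev w s m (okM_expr 16 23 40) = of_bool (okM U (dA e) (dX e))"
    "ev w s m (okP_expr 16 16 40) = of_bool (okP U U (dX e))"
    "ev w s m (okM_expr 23 24 40) = of_bool (okM (dA e) (dB e) (dX e))"
    using ev_ok[OF X, of 23 24] ev_ok(3)[OF X, of 25 25] ev_ok(2)[OF X, of 23 25] ev_ok(2)[OF Y, of 25 23]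
      ev_ok[OF Y, of 23 24] ev_ok(2)[OF X, of 16 23] ev_ok(1)[OF X, of 16 16]
    by (simp_all add: ok_vars)
  have ids: "ev w s m (id_expr 1 23 24 26) = code (PV (dA e) (dB e) (dX e))"
    "ev w s m (id_expr 2 23 25 26) = code (MV (dA e) (dC e) (dX e))"
    "ev w s m (id_expr 2 25 23 27) = code (MV (dC e) (dA e) (dY e))"
    "ev w s m (id_expr 1 23 24 27) = code (PV (dA e) (dB e) (dY e))"
    "ev w s m (id_expr 2 23 24 27) = code (MV (dA e) (dB e) (dY e))"
    "ev w s m (id_expr 2 16 23 26) = code (MV U (dA e) (dX e))"
    "ev w s m (id_expr 1 16 16 26) = code (PV U U (dX e))"
    "ev w s m (idT_expr 23 24 25) = code (TV (dA e) (dB e) (dC e))"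
    using ev_id[of 23 24 26 1] ev_id[of 23 25 26 2] ev_id[of 25 23 27 2] ev_id[of 23 24 27 1]
      ev_id[of 23 24 27 2] ev_id[of 16 23 26 2] ev_id[of 16 16 26 1] ev_idT
    by (simp_all add: ok_vars)
  have tags: "ev w s m (tagged 0 (Vr 17)) = 0 * S + e" "ev w s m (tagged 1 (Vr 17)) = 1 * S + e"
    "ev w s m (tagged 2 (Vr 17)) = 2 * S + e" "ev w s m (tagged 3 (Vr 17)) = 3 * S + e"
    using ev_tagged[of "Vr 17" 0] ev_tagged[of "Vr 17" 1] ev_tagged[of "Vr 17" 2] ev_tagged[of "Vr 17" 3]
    by (simp_all add: vars)
  have bits: "ev w s m (Cn 0) = 0" "ev w s m (Cn 1) = 1" by (rule ev_Cn, simp)+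
  show ?thesis
    unfolding cand_exprs_def cands_def Let_def list_all2_Cons prod.case list_all2_Nil
    by (intro conjI ev_and ok ids tags bits ev_less_var ev_flat ev_reversed ev_marked ev_junk TrueI refl)
qed

end

lemma cand_exprs_correct:
  assumes "e < S"
  shows "list_all2 (\<lambda>(pe, ue, ve) (p, u, v). \<forall>s m es. decoded e s \<longrightarrow> laid es m \<longrightarrow> ev w s m pe = of_bool p \<and>
      (p \<longrightarrow> u < Nv \<and> v < Nv \<and> ev w s m ue = u \<and> ev w s m ve = v)) cand_exprs (cands e)"
  unfolding list_all2_conv_all_nth
proof (intro conjI allI impI)
  show "length cand_exprs = length (cands e)" by (simp add: cand_exprs_def cands_def Let_def)
  fix i assume i: "i < length cand_exprs"
  obtain pe ue ve p u v where eq: "cand_exprs ! i = (pe, ue, ve)" "cands e ! i = (p, u, v)"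
    by (metis prod_cases3)
  have "ev w s m pe = of_bool p \<and> ev w s m ue = u \<and> ev w s m ve = v" if "decoded e s" "laid es m" for s m es
    using list_all2_nthD[OF cand_exprs_at[OF that] i] by (simp add: eq)
  moreover have "u < v \<and> v < Nv" if p
  proof -
    have "cands e ! i \<in> set (cands e)" using i by (intro nth_mem) (simp add: cand_exprs_def cands_def Let_def)
    then show ?thesis using cands_less[OF assms, of u v] that eq by simp
  qed
  ultimately show "(\<lambda>(pe, ue, ve) (p, u, v). \<forall>s m es. decoded e s \<longrightarrow> laid es m \<longrightarrow>
      ev w s m pe = of_bool p \<and> (p \<longrightarrow> u < Nv \<and> v < Nv \<and> ev w s m ue = u \<and> ev w s m ve = v))
      (cand_exprs ! i) (cands e ! i)"
    unfolding eq prod.case by fastforce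
qed

lemma ev_pow_D: "s 6 = D \<Longrightarrow> i < 7 \<Longrightarrow> ev w s m (pow_expr (Vr 6) i) = D ^ i"
proof -
  assume a: "s 6 = D" "i < 7"
  have "D ^ i \<le> W" unfolding W_def using D a(2) by (intro power_increasing) auto
  then have "D ^ i < 2 ^ w" using N_le_S(3) less_w by (meson le_trans)
  then show ?thesis using a by (subst ev_poly) auto
qed

lemma decode_correct:
  assumes "base s" "s 17 = e" "e < S"
  shows "\<exists>s'. den w (seqs (decode_code @ digits_code 40 26 @ digits_code 50 27)) (s, m) = (s', m) \<and>
    decoded e s' \<and> s' 31 = s 31"
proof -
  have b: "s 0 = 0" "s 1 = 0" "s 4 = h" "s 5 = N" "s 6 = D" "s 7 = W" "s 8 = N ^ 2" "s 9 = N ^ 3"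
     "s 10 = S" "s 11 = Nv" "s 12 = 2 ^ w1 - 1" "s 13 = Z" "s 14 = 2 * Z" "s 15 = 3 * Z" "s 16 = U"
    using assms(1) by (auto simp: base_def)
  define s1 where "s1 = s(23 := dA e, 24 := dB e, 25 := dC e, 26 := dX e, 27 := dY e)"
  have 1: "den w (seqs decode_code) (s, m) = (s1, m)"
    by (simp add: decode_code_def s1_def d_defs b assms)
  define s2 where "s2 = s1(40 := slot (dX e) 0, 41 := slot (dX e) 1, 42 := slot (dX e) 2, 43 := slot (dX e) 3,
    44 := slot (dX e) 4, 45 := slot (dX e) 5, 46 := slot (dX e) 6)"
  have s1: "s1 6 = D" "s1 26 = dX e" "s1 27 = dY e" by (simp_all add: s1_def b)
  have 2: "den w (seqs (digits_code 40 26)) (s1, m) = (s2, m)"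
    by (simp add: digits_code_def s2_def s1 ev_pow_D slot_def del: pow_expr.simps power_0 power_one_right One_nat_def)
  define s3 where "s3 = s2(50 := slot (dY e) 0, 51 := slot (dY e) 1, 52 := slot (dY e) 2, 53 := slot (dY e) 3,
    54 := slot (dY e) 4, 55 := slot (dY e) 5, 56 := slot (dY e) 6)"
  have s2: "s2 6 = D" "s2 27 = dY e" by (simp_all add: s2_def s1)
  have 3: "den w (seqs (digits_code 50 27)) (s2, m) = (s3, m)"
    by (simp add: digits_code_def s3_def s2 ev_pow_D slot_def del: pow_expr.simps power_0 power_one_right One_nat_def)
  have "decoded e s3"
    unfolding decoded_def base_def all_less_7 s3_def s2_def s1_def using assms(2,3)
    by (simp add: b b(2)[unfolded One_nat_def])
  moreover have "s3 31 = s 31" by (simp add: s3_def s2_def s1_def)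
  ultimately show ?thesis using 1 2 3 by (simp add: den_seqs_append)
qed

definition enum_inv :: "nat \<Rightarrow> store \<Rightarrow> store \<Rightarrow> bool" where
  "enum_inv e s m \<longleftrightarrow> base s \<and> s 17 = e \<and> laid (edges e) m \<and> s 31 = length (edges e)"

lemma loopfree_enum_body: "loopfree enum_body"
  by (auto simp: enum_body_def decode_code_def digits_code_def)

lemma enum_body_correct:
  assumes inv: "enum_inv e s m" and e: "e < S"
  shows "wp w enum_body (cost enum_body) (enum_inv (Suc e)) s m"
proof -
  obtain s1 where 1: "den w (seqs (decode_code @ digits_code 40 26 @ digits_code 50 27)) (s, m) = (s1, m)"
    "decoded e s1" "s1 31 = s 31"
    using decode_correct[of s e m] inv e by (auto simp: enum_inv_def)
  have "length (cands e) = 16" by (simp add: cands_def Let_def)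
  moreover have "length (edges e) \<le> 4 * Nv"
    using length_edges[of e] e by (simp add: Nv_def)
  \<comment> \<open>At most \<open>4 * Nv\<close> edges so far and 16 further candidates amount to
    \<open>2 * (4 * Nv + 16) + 4\<close>.\<close>
  moreover have "8 * Nv + 36 < Z"
  proof -
    have "8 \<le> Nv" using S_ge2 by (simp add: Nv_def)
    then have "64 * Nv \<le> Nv * Nv * Nv" using mult_le_mono[OF mult_le_mono[of 8 Nv 8 Nv], of Nv Nv] by simp
    then show ?thesis using Nv_less_Z(1) \<open>8 \<le> Nv\<close> unfolding power3_eq_cube by linarith
  qed
  ultimately have size: "2 * (length (edges e) + length (cands e)) + 4 < Z" by simp
  obtain s2 m2 where 2: "den w (seqs (map emit cand_exprs)) (s1, m) = (s2, m2)" "decoded e s2"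
    "laid (edges (Suc e)) m2" "s2 31 = length (edges (Suc e))"
    using emits_correct[where I = "decoded e" and ces = cand_exprs and cs = "cands e" and s = s1 and m = m
        and es = "edges e", OF keeps_decoded cand_exprs_correct[OF e] 1(2) _ _ size] inv 1(3)
    by (auto simp: enum_inv_def edges_Suc)
  have "ev w s2 m2 (Op ADD (Vr 17) (Cn 1)) = Suc e"
    using 2(2) S_less e by (subst ev_poly) (auto simp: decoded_def)
  then have 3: "den w (seqs [Assign 17 (Op ADD (Vr 17) (Cn 1))]) (s2, m2) = (s2(17 := Suc e), m2)"
    by (simp del: ev.simps)
  have "den w enum_body (s, m) = (s2(17 := Suc e), m2)"
    unfolding enum_body_def using 1(1) 2(1) 3 by (simp add: den_seqs_append del: seqs_simps)
  moreover have "enum_inv (Suc e) (s2(17 := Suc e)) m2"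
    using 2 by (auto simp: enum_inv_def decoded_def base_def)
  ultimately show ?thesis using loopfree_enum_body by (intro wp_den) auto
qed

text \<open>The header of the encoding comes last because it contains the number of edges. It is
  masked like the entries, to match the truncated input of the simulated machine.\<close>

definition enum_code :: com where
  "enum_code = Seq (While (less_expr (Vr 17) (Vr 10)) enum_body)
     (seqs [Sto (Vr 13) (Op BAND (Vr 11) (Vr 12)), Sto (Op ADD (Vr 13) (Cn 1)) (Op BAND (Vr 31) (Vr 12))])"

lemma enum_code_correct:
  assumes inv: "enum_inv 0 s m"
  shows "wp w enum_code (S * (cost enum_body + 100) + 100) (\<lambda>s m. base s \<and>
      (\<forall>i<2 ^ w1. m (Z + i) = mem (init_state w1 (encode_graph Nv (edges S))) i)) s m"
proof -
  let ?g = "less_expr (Vr 17) (Vr 10)"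
  let ?c = "seqs [Sto (Vr 13) (Op BAND (Vr 11) (Vr 12)), Sto (Op ADD (Vr 13) (Cn 1)) (Op BAND (Vr 31) (Vr 12))]"
  have len: "elen ?g \<le> 50" by (simp add: less_expr_def not_expr_def eq_expr_def)
  have costc: "cost ?c \<le> 40" by simp
  have guard: "ev w s m ?g = of_bool (e < S)" if "enum_inv e s m" "e \<le> S" for e s m
  proof -
    have "s 17 = e" "s 10 = S" using that by (auto simp: enum_inv_def base_def)
    then show ?thesis using ev_less_expr[OF w1', of s m "Vr 17" "Vr 10"] that(2) less_w by auto
  qed
  have loop: "wp w (While ?g enum_body) (S * (cost enum_body + elen ?g + 3) + elen ?g + 2) (enum_inv S) s m"
  proof (rule wp_While)
    fix i s m assume i: "i < S" "enum_inv i s m"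
    then show "ev w s m ?g \<noteq> 0 \<and> wp w enum_body (cost enum_body) (enum_inv (Suc i)) s m"
      using guard[OF i(2)] enum_body_correct by simp
  next
    fix s m assume "enum_inv S s m"
    then show "ev w s m ?g = 0" using guard[of S s m] by simp
  qed (rule inv)
  have fin: "wp w ?c 40 (\<lambda>s m. base s \<and>
      (\<forall>i<2 ^ w1. m (Z + i) = mem (init_state w1 (encode_graph Nv (edges S))) i)) s m" if "enum_inv S s m" for s m
  proof -
    have b: "s 11 = Nv" "s 12 = 2 ^ w1 - 1" "s 13 = Z" "s 31 = length (edges S)" and base: "base s"
      and laid: "laid (edges S) m"
      using that by (auto simp: enum_inv_def base_def)
    have Z1: "ev w s m' (Op ADD (Vr 13) (Cn 1)) = Z + 1" for m'
      using Z_less S_less(2) by (subst ev_poly) (auto simp: b)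
    let ?m = "m(Z := take_bit w1 Nv, Z + 1 := take_bit w1 (length (edges S)))"
    have "den w ?c (s, m) = (s, ?m)"
      using Z1 by (simp add: b and_mask del: ev.simps(1) Nat.add_0_right One_nat_def)
    moreover have "?m (Z + i) = mem (init_state w1 (encode_graph Nv (edges S))) i" if "i < 2 ^ w1" for i
    proof -
      have enc: "encode_graph Nv (edges S) = Nv # length (edges S) # flatten (edges S)"
        by (simp add: encode_graph_def flatten_def)
      consider "i = 0" | "i = 1" | "2 \<le> i" by linarith
      then show ?thesis
      proof cases
        case 3
        have "m (Z + i) = lay (edges S) (Z + i)" using laid by (simp add: laid_def)
        moreover have "Z + i < 2 * Z" using that w1_le_Z by simp
        moreover obtain j where "i = Suc (Suc j)" using 3 by (metis add_2_eq_Suc le_Suc_ex)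
        ultimately show ?thesis by (auto simp: enc init_state_def lay_def)
      qed (auto simp: enc init_state_def)
    qed
    ultimately show ?thesis using base costc by (intro wp_den) auto
  qed
  have total: "wp w enum_code ((S * (cost enum_body + elen ?g + 3) + elen ?g + 2) + 40) (\<lambda>s m. base s \<and>
      (\<forall>i<2 ^ w1. m (Z + i) = mem (init_state w1 (encode_graph Nv (edges S))) i)) s m"
    unfolding enum_code_def by (rule wp_Seq[OF loop fin])
  have "S * (cost enum_body + elen ?g + 3) \<le> S * (cost enum_body + 100)"
    using len by (intro mult_le_mono2) simp
  then have "(S * (cost enum_body + elen ?g + 3) + elen ?g + 2) + 40 \<le> S * (cost enum_body + 100) + 100"
    using len by linarith
  then show ?thesis by (rule wp_mono[OF total])
qed

end

section \<open>The numbered graph and its diameter\<close>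

context reduction begin

definition graph :: "nat pair_pre_digraph" where
  "graph = \<lparr>pverts = {0..<Nv}, parcs = set (edges S) \<union> (set (edges S))\<inverse>\<rparr>"

lemma edge_list_less: "(u, v) \<in> set (edges S) \<Longrightarrow> u < v \<and> v < Nv"
  using cands_less unfolding edges_def set_fold_add_edge by force

lemma pair_graph_graph: "pair_graph graph"
proof
  show "finite (pverts graph)" "finite (parcs graph)" by (simp_all add: graph_def)
  show "symmetric (with_proj graph)"
    by (auto simp: symmetric_def graph_def sym_def)
  fix e assume "e \<in> parcs graph"
  then obtain u v where "e = (u, v)" "u < v \<and> v < Nv \<or> v < u \<and> u < Nv"
    using edge_list_less by (cases e) (auto simp: graph_def)
  then show "fst e \<in> pverts graph" "snd e \<in> pverts graph" "fst e \<noteq> snd e"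
    by (auto simp: graph_def)
qed

lemma wf_graph: "wf_digraph (with_proj graph)"
proof -
  interpret pair_graph graph by (rule pair_graph_graph)
  show ?thesis by unfold_locales
qed

lemma pverts_graph: "pverts graph = code ` vertices"
  unfolding code_vertices graph_def by (auto simp: Nv_def)

lemma parcs_graph: "parcs graph = (\<lambda>(x, y). (code x, code y)) ` adj"
  unfolding graph_def set_edges adj_def by auto

text \<open>All listed pairs are increasing, so no edge occurs in both orientations.\<close>

lemma lists_edges_graph: "lists_edges graph (edges S)"
proof -
  have "inj_on (\<lambda>(u, v). {u, v}) (set (edges S))"
  proof (rule inj_onI, clarify)
    fix u v u' v' assume *: "(u, v) \<in> set (edges S)" "(u', v') \<in> set (edges S)" "{u, v} = {u', v'}"
    then have "u < v" "u' < v'" using edge_list_less by blast+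
    then show "u = u' \<and> v = v'" using *(3) by (auto simp: doubleton_eq_iff)
  qed
  then show ?thesis
    unfolding lists_edges_def uedges_def using distinct_edges[of S]
    by (auto simp: distinct_map graph_def image_Un insert_commute)
qed

lemma card_uedges: "card (uedges graph) \<le> 4 * Nv"
proof -
  have "uedges graph = set (map (\<lambda>(u, v). {u, v}) (edges S))"
    using lists_edges_graph by (simp add: lists_edges_def)
  then have "card (uedges graph) \<le> length (edges S)" by (metis card_length length_map)
  then show ?thesis using length_edges[of S] by (simp add: Nv_def)
qed

lemma walk_code: "(x, y) \<in> adj ^^ k \<Longrightarrow> (code x, code y) \<in> parcs graph ^^ k"
proof (induction k arbitrary: y)
  case (Suc k)
  then obtain z where "(x, z) \<in> adj ^^ k" "(z, y) \<in> adj" by auto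
  then show ?case using Suc.IH by (auto simp: parcs_graph intro!: relcompI)
qed auto

lemma adj_vertices: "(x, y) \<in> adj \<Longrightarrow> x \<in> vertices \<and> y \<in> vertices"
  using edge_vertices by (auto simp: adj_def)

lemma walk_decode:
  "x \<in> vertices \<Longrightarrow> (code x, v) \<in> parcs graph ^^ k \<Longrightarrow> \<exists>y\<in>vertices. v = code y \<and> (x, y) \<in> adj ^^ k"
proof (induction k arbitrary: v)
  case (Suc k)
  then obtain u where u: "(code x, u) \<in> parcs graph ^^ k" "(u, v) \<in> parcs graph" by auto
  then obtain y where y: "y \<in> vertices" "u = code y" "(x, y) \<in> adj ^^ k" using Suc by blast
  obtain y' z where z: "(y', z) \<in> adj" "u = code y'" "v = code z" using u(2) by (auto simp: parcs_graph)
  then have "y' = y" using y inj_code adj_vertices by (metis inj_onD)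
  then show ?case using y z adj_vertices by (auto intro!: relcompI bexI[of _ z])
qed auto

lemma diam_le_4:
  assumes "\<And>a b c d. \<lbrakk>a < N; b < N; c < N; d < N\<rbrakk> \<Longrightarrow> \<exists>x. on a x \<and> on b x \<and> on c x \<and> on d x"
  shows "diam graph \<le> 4"
proof -
  have "\<exists>k\<le>4. (u, v) \<in> parcs graph ^^ k" if "u \<in> pverts graph" "v \<in> pverts graph" for u v
    using near_4[OF assms] that walk_code unfolding pverts_graph near_def by blast
  then have "diam graph \<le> ereal (real 4)"
    using Nv_ge by (intro diam_le[OF wf_graph]) (auto simp: graph_def)
  then show ?thesis by simp
qed

lemma diam_ge_7:
  assumes "\<And>x. \<not> (on a x \<and> on b x \<and> on c x \<and> on d x)"
    and "a < N" "b < N" "c < N" "d < N"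
    and "a \<noteq> b" "a \<noteq> c" "a \<noteq> d" "b \<noteq> c" "b \<noteq> d" "c \<noteq> d" "a \<noteq> U" "d \<noteq> U"
    and "marked a \<noteq> marked d"
  shows "7 \<le> diam graph"
proof -
  have V: "TV a b c \<in> vertices" "TV d c b \<in> vertices" using assms(2-5) by (auto simp: vertices_def)
  have "(code (TV a b c), code (TV d c b)) \<notin> parcs graph ^^ k" if "k < 7" for k
  proof
    assume "(code (TV a b c), code (TV d c b)) \<in> parcs graph ^^ k"
    then obtain y where "y \<in> vertices" "code (TV d c b) = code y" "(TV a b c, y) \<in> adj ^^ k"
      using walk_decode[OF V(1)] by blast
    then have "(TV a b c, TV d c b) \<in> adj ^^ k" using inj_code V(2) by (metis inj_onD)
    then show False using far[OF assms(1,6-14) that] by blast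
  qed
  then have "ereal (real 7) \<le> diam graph"
    using V by (intro diam_ge[OF wf_graph, of "code (TV a b c)" "code (TV d c b)"])
      (auto simp: pverts_graph simp del: code.simps, simp add: pverts_graph[symmetric] graph_def)
  then show ?thesis by simp
qed

end

section \<open>The incidence table\<close>

text \<open>The index \<open>a\<close> of a vector has the number of its group in the upper bits and
  the values of the \<open>h\<close> variables of that group in the lower ones; \<open>l\<close> is
  an encoded literal.\<close>

definition lit_sat :: "nat \<Rightarrow> nat \<Rightarrow> nat \<Rightarrow> bool" where
  "lit_sat h a l \<longleftrightarrow> l div 2 div h = a div 2 ^ h \<and> a div 2 ^ (l div 2 mod h) mod 2 = l mod 2"

text \<open>Address of the length field of clause \<open>x\<close> in the input; the summand 2 skips
  the header.\<close>

definition pos :: "cnf \<Rightarrow> nat \<Rightarrow> nat" where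
  "pos F x = 2 + length (concat (map (\<lambda>C. length C # map encode_literal C) (take x F)))"

lemma pos_0 [simp]: "pos F 0 = 2"
  by (simp add: pos_def)

lemma pos_Suc: "x < length F \<Longrightarrow> pos F (Suc x) = pos F x + 1 + length (F ! x)"
  by (simp add: pos_def take_Suc_conv_app_nth)

lemma pos_mono: "x \<le> y \<Longrightarrow> pos F x \<le> pos F y"
proof -
  assume "x \<le> y"
  then obtain k where "y = x + k" using le_Suc_ex by blast
  then show ?thesis by (simp add: pos_def take_add)
qed

lemma pos_length: "pos F (length F) = length (encode_cnf n F)"
  by (simp add: pos_def encode_cnf_def)

lemma encode_cnf_nth:
  assumes "x < length F" "k \<le> length (F ! x)"
  shows "encode_cnf n F ! (pos F x + k) = (length (F ! x) # map encode_literal (F ! x)) ! k"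
proof -
  let ?g = "\<lambda>C. length C # map encode_literal C"
  have "concat (map ?g F) = concat (map ?g (take x F)) @ ?g (F ! x) @ concat (map ?g (drop (Suc x) F))"
    using arg_cong[OF id_take_nth_drop[OF assms(1)], of "\<lambda>F. concat (map ?g F)"]
    by (simp only: map_append list.map concat_append concat.simps append_assoc)
  then have "encode_cnf n F ! (pos F x + k) = (?g (F ! x) @ concat (map ?g (drop (Suc x) F))) ! k"
    by (simp add: encode_cnf_def pos_def nth_append)
  also have "\<dots> = ?g (F ! x) ! k" using assms(2) by (cases k) (simp_all add: nth_append)
  finally show ?thesis .
qed

definition sat_expr :: expr where
  "sat_expr = Op BAND (eq_expr (Op DIV (Op DIV (Vr 21) (Cn 2)) (Vr 4)) (Op SHR (Vr 23) (Vr 4)))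
     (eq_expr (Op MOD (Op SHR (Vr 23) (Op MOD (Op DIV (Vr 21) (Cn 2)) (Vr 4))) (Cn 2)) (Op MOD (Vr 21) (Cn 2)))"

definition scan_body :: com where
  "scan_body = seqs [Assign 21 (Ld (Vr 18)), Assign 18 (Op ADD (Vr 18) (Cn 1)),
     Assign 19 (Op BOR (Vr 19) sat_expr), Assign 20 (Op ADD (Vr 20) (Cn 1))]"

definition scan_code :: com where
  "scan_code = Seq (seqs [Assign 22 (Ld (Vr 18)), Assign 18 (Op ADD (Vr 18) (Cn 1)), Assign 19 (Cn 0), Assign 20 (Cn 0)])
     (Seq (While (less_expr (Vr 20) (Vr 22)) scan_body) (Sto (Op ADD (Vr 14) (Vr 17)) (eq_expr (Vr 19) (Cn 0))))"

text \<open>Guard \<open>g\<close> sits at coordinate \<open>m + g\<close>, with \<open>m\<close>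
  the number of clauses, and is off for the vectors of group \<open>g\<close> only. The coordinates
  from \<open>m + 4\<close> up to \<open>D\<close> are padding and off for all vectors.\<close>

definition guard_code :: com where
  "guard_code = Sto (Op ADD (Vr 14) (Vr 17)) (Op BAND (less_expr (Vr 24) (Op ADD (Vr 3) (Cn 4)))
     (not_expr (eq_expr (Vr 24) (Op ADD (Vr 3) (Op SHR (Vr 23) (Vr 4))))))"

text \<open>Each row visits the clauses in the order of the input, so the read pointer 18 moves
  along without searching and is reset to 2 at the start of a row.\<close>

definition table_body :: com where
  "table_body = Seq (seqs [Assign 23 (Op DIV (Vr 17) (Vr 6)), Assign 24 (Op MOD (Vr 17) (Vr 6)),
     If (eq_expr (Vr 24) (Cn 0)) (Assign 18 (Cn 2)) Skip])
     (Seq (If (less_expr (Vr 24) (Vr 3)) scan_code guard_code) (Assign 17 (Op ADD (Vr 17) (Cn 1))))"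

text \<open>The shift by \<open>h + 3\<close> provides eight groups of vectors: four for
  assignments, a fifth that starts with the dominating vector \<open>U\<close>, and three more to
  reach a power of two.\<close>

definition prologue1 :: com where
  "prologue1 = seqs [Assign 2 (Ld (Cn 0)), Assign 3 (Ld (Cn 1)), Assign 4 (Op ADD (Op DIV (Vr 2) (Cn 4)) (Cn 1)),
     Assign 5 (Op SHL (Cn 1) (Op ADD (Vr 4) (Cn 3))), Assign 16 (Op SHL (Cn 1) (Op ADD (Vr 4) (Cn 2))),
     Assign 6 (Cn 1), Assign 34 (Op ADD (Vr 3) (Cn 4))]"

text \<open>Doubling finds the least power of two with room for all clauses and the four
  guards.\<close>

definition prologue2 :: com where
  "prologue2 = While (less_expr (Vr 6) (Vr 34)) (Assign 6 (Op ADD (Vr 6) (Vr 6)))"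

definition prologue3 :: "nat \<Rightarrow> com" where
  "prologue3 b = seqs [Assign 7 (pow_expr (Vr 6) 7), Assign 8 (pow_expr (Vr 5) 2), Assign 9 (pow_expr (Vr 5) 3),
     Assign 10 (Op MUL (Op MUL (Vr 9) (Vr 7)) (Vr 7)), Assign 11 (Op MUL (Cn 4) (Vr 10)),
     Assign 12 (Op SUB (pow_expr (Vr 11) b) (Cn 1)), Assign 13 (pow_expr (Vr 11) (b + 3)),
     Assign 14 (Op MUL (Cn 2) (Vr 13)), Assign 15 (Op MUL (Cn 3) (Vr 13)), Assign 33 (Op MUL (Vr 5) (Vr 6))]"

definition table_code :: com where
  "table_code = While (less_expr (Vr 17) (Vr 33)) table_body"

section \<open>Correctness of the table program\<close>

locale tabling = reduction w w1 bw h N D U on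
  for w w1 bw h N D U :: nat and on :: "nat \<Rightarrow> nat \<Rightarrow> bool" +
  fixes n t k :: nat and F :: cnf
  assumes on_eq: "a < N \<Longrightarrow> on a x \<longleftrightarrow> (if x < length F then \<forall>l\<in>set (F ! x). \<not> lit_sat h a (encode_literal l)
      else x < length F + 4 \<and> x \<noteq> length F + a div 2 ^ h)"
    and h_eq: "h = n div 4 + 1" and N_eq: "N = 2 ^ (h + 3)" and U_eq: "U = 2 ^ (h + 2)"
    and D_eq: "D = 2 ^ t" and t: "length F + 4 \<le> 2 ^ t" "\<And>i. i < t \<Longrightarrow> 2 ^ i < length F + 4"
    and clause_len: "\<And>C. C \<in> set F \<Longrightarrow> length C \<le> k"
    and lit_less: "\<And>C l. C \<in> set F \<Longrightarrow> l \<in> set C \<Longrightarrow> encode_literal l < 2 ^ w"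
    and input_len: "length (encode_cnf n F) \<le> Z" and n_less: "n + 8 < 2 ^ w"
begin

definition input :: "nat \<Rightarrow> nat" where
  "input = mem (init_state w (encode_cnf n F))"

lemma D_less: "length F + 4 \<le> D" using t(1) by (simp add: D_eq)
lemma D_less_w: "D \<le> S" "length F + 4 < 2 ^ w"
proof -
  have "1 * D \<le> N * D" using N by (intro mult_le_mono1) simp
  then show "D \<le> S" using ND_le by linarith
  then show "length F + 4 < 2 ^ w" using D_less less_w by (meson le_trans)
qed

lemma input_0: "input 0 = n" "input 1 = length F"
  using n_less D_less_w by (simp_all add: input_def init_state_def encode_cnf_def take_bit_nat_eq_self)

lemma input_high: "Z \<le> a \<Longrightarrow> input a = 0"
  using input_len by (simp add: input_def init_state_def)

lemma pos_less: "x < length F \<Longrightarrow> i \<le> length (F ! x) \<Longrightarrow> pos F x + i < length (encode_cnf n F)"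
  using pos_mono[of "Suc x" "length F" F] pos_Suc[of x F] pos_length[of F n] by linarith

lemma input_pos:
  assumes "x < length F"
  shows "input (pos F x) = length (F ! x)"
    and "i < length (F ! x) \<Longrightarrow> input (pos F x + 1 + i) = encode_literal (F ! x ! i)"
proof -
  have "length (F ! x) < 2 ^ w"
    using pos_less[OF assms order_refl] input_len Z_less by linarith
  then show "input (pos F x) = length (F ! x)"
    using pos_less[OF assms, of 0] encode_cnf_nth[OF assms, of 0]
    by (simp add: input_def init_state_def take_bit_nat_eq_self)
  assume i: "i < length (F ! x)"
  then have "encode_literal (F ! x ! i) < 2 ^ w" using lit_less assms by (meson nth_mem)
  then show "input (pos F x + 1 + i) = encode_literal (F ! x ! i)"
    using pos_less[OF assms, of "1 + i"] encode_cnf_nth[OF assms, of "1 + i"] i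
    by (simp add: input_def init_state_def take_bit_nat_eq_self)
qed

definition base2 :: "store \<Rightarrow> bool" where
  "base2 s \<longleftrightarrow> base s \<and> s 3 = length F \<and> s 33 = N * D \<and> s 31 = 0"

definition table_mem :: "nat \<Rightarrow> store \<Rightarrow> bool" where
  "table_mem i m \<longleftrightarrow> (\<forall>y<N * D. m (2 * Z + y) = (if y < i then of_bool (on (y div D) (y mod D)) else 0)) \<and>
     (\<forall>a. a < 2 * Z \<or> 2 * Z + N * D \<le> a \<longrightarrow> m a = input a)"

definition table_inv :: "nat \<Rightarrow> store \<Rightarrow> store \<Rightarrow> bool" where
  "table_inv i s m \<longleftrightarrow> base2 s \<and> s 17 = i \<and> table_mem i m \<and>
     (i mod D \<noteq> 0 \<and> i mod D \<le> length F \<longrightarrow> s 18 = pos F (i mod D))"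

definition row_inv :: "nat \<Rightarrow> store \<Rightarrow> bool" where
  "row_inv i s \<longleftrightarrow> base2 s \<and> s 17 = i \<and> s 23 = i div D \<and> s 24 = i mod D"

definition scan_inv :: "nat \<Rightarrow> nat \<Rightarrow> store \<Rightarrow> store \<Rightarrow> bool" where
  "scan_inv i j s m \<longleftrightarrow> row_inv i s \<and> table_mem i m \<and> s 22 = length (F ! (i mod D)) \<and> s 20 = j \<and>
     s 18 = pos F (i mod D) + 1 + j \<and>
     s 19 = of_bool (\<exists>l\<in>set (take j (F ! (i mod D))). lit_sat h (i div D) (encode_literal l))"

lemma ND_less: "N * D < 2 ^ w" "N * D \<le> Z" "N \<le> S" "h + 8 < 2 ^ w"
proof -
  show "N * D < 2 ^ w" using ND_le less_w by blast
  show "N * D \<le> Z" using ND_le S_less by linarith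
  show "N \<le> S" by (rule N_le_S)
  have "h < 2 ^ h" by simp
  moreover have "N = 8 * 2 ^ h" by (simp add: N_eq power_add)
  ultimately have "h + 8 \<le> N" by linarith
  then show "h + 8 < 2 ^ w" using N_le_S less_w by (meson le_trans)
qed

lemma scan_body_correct:
  assumes inv: "scan_inv i j s m" and i: "i < N * D" "i mod D < length F" and j: "j < length (F ! (i mod D))"
  shows "wp w scan_body (cost scan_body) (scan_inv i (Suc j)) s m"
proof -
  let ?x = "i mod D" and ?a = "i div D" and ?l = "encode_literal (F ! (i mod D) ! j)"
  have s: "base s" "s 3 = length F" "s 33 = N * D" "s 31 = 0" "s 17 = i" "s 23 = ?a" "s 24 = ?x" "table_mem i m"
    "s 22 = length (F ! ?x)" "s 20 = j" "s 18 = pos F ?x + 1 + j" "s 4 = h"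
    "s 19 = of_bool (\<exists>l\<in>set (take j (F ! ?x)). lit_sat h ?a (encode_literal l))"
    using inv by (auto simp: scan_inv_def row_inv_def base2_def base_def)
  have p: "pos F ?x + 1 + j < Z" using pos_less[OF i(2), of "1 + j"] j input_len by simp
  then have lit: "m (pos F ?x + 1 + j) = ?l"
    using s(8) input_pos(2)[OF i(2) j] by (simp add: table_mem_def)
  have l: "?l < 2 ^ w" using lit_less i(2) j by (meson nth_mem)
  have a: "?a < N" using i(1) by (simp add: less_mult_imp_div_less)
  then have aw: "?a < 2 ^ w" using ND_less(3) less_w by (meson le_trans less_imp_le)
  define s1 where "s1 = s(21 := ?l, 18 := pos F ?x + 1 + Suc j)"
  have two: "ev w s1 m (Cn 2) = 2" by (rule ev_Cn) simp
  have bounds: "?l div 2 div h < 2 ^ w" "?a div 2 ^ h < 2 ^ w" "?a div 2 ^ (?l div 2 mod h) mod 2 < 2 ^ w" "?l mod 2 < 2 ^ w"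
    using l aw by (meson div_le_dividend le_less_trans mod_less_eq_dividend)+
  have s1: "s1 4 = h" "s1 23 = ?a" "s1 21 = ?l" using s by (simp_all add: s1_def)
  have e1: "ev w s1 m (Op DIV (Op DIV (Vr 21) (Cn 2)) (Vr 4)) = ?l div 2 div h"
    "ev w s1 m (Op SHR (Vr 23) (Vr 4)) = ?a div 2 ^ h"
    "ev w s1 m (Op MOD (Op SHR (Vr 23) (Op MOD (Op DIV (Vr 21) (Cn 2)) (Vr 4))) (Cn 2)) = ?a div 2 ^ (?l div 2 mod h) mod 2"
    "ev w s1 m (Op MOD (Vr 21) (Cn 2)) = ?l mod 2"
    using two by (simp_all add: s1 drop_bit_eq_div del: ev.simps(1))
  have "ev w s1 m sat_expr = of_bool (lit_sat h ?a ?l)"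
    unfolding sat_expr_def lit_sat_def
  proof (rule ev_and)
    show "ev w s1 m (eq_expr (Op DIV (Op DIV (Vr 21) (Cn 2)) (Vr 4)) (Op SHR (Vr 23) (Vr 4))) =
        of_bool (?l div 2 div h = ?a div 2 ^ h)"
      using ev_eq_expr[OF w1', of s1 m "Op DIV (Op DIV (Vr 21) (Cn 2)) (Vr 4)" "Op SHR (Vr 23) (Vr 4)"]
      unfolding e1 using bounds by blast
    show "ev w s1 m (eq_expr (Op MOD (Op SHR (Vr 23) (Op MOD (Op DIV (Vr 21) (Cn 2)) (Vr 4))) (Cn 2))
        (Op MOD (Vr 21) (Cn 2))) = of_bool (?a div 2 ^ (?l div 2 mod h) mod 2 = ?l mod 2)"
      using ev_eq_expr[OF w1', of s1 m "Op MOD (Op SHR (Vr 23) (Op MOD (Op DIV (Vr 21) (Cn 2)) (Vr 4))) (Cn 2)"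
          "Op MOD (Vr 21) (Cn 2)"]
      unfolding e1 using bounds by blast
  qed
  then have sat: "ev w s1 m (Op BOR (Vr 19) sat_expr) =
      of_bool ((\<exists>l\<in>set (take j (F ! ?x)). lit_sat h ?a (encode_literal l)) \<or> lit_sat h ?a ?l)"
    using s(13) by (auto simp: s1_def)
  have add: "ev w s' m (Op ADD (Vr y) (Cn 1)) = s' y + 1" if "s' y < Z" for s' y
    using that Z_less by (subst ev_poly) auto
  have jZ: "j < Z" "pos F ?x + 1 + j < Z" using p by auto
  let ?v = "of_bool ((\<exists>l\<in>set (take j (F ! ?x)). lit_sat h ?a (encode_literal l)) \<or> lit_sat h ?a ?l) :: nat"
  let ?s = "s1(19 := ?v, 20 := Suc j)"
  have c1: "ev w s m (Ld (Vr 18)) = ?l" by (simp add: s(11) lit[simplified])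
  have c2: "ev w (s(21 := ?l)) m (Op ADD (Vr 18) (Cn 1)) = pos F ?x + 1 + Suc j"
    using add[of "s(21 := ?l)" 18] jZ by (simp add: s(11))
  have c4: "ev w (s1(19 := ?v)) m (Op ADD (Vr 20) (Cn 1)) = Suc j"
    using add[of "s1(19 := ?v)" 20] jZ by (simp add: s1_def s(10))
  have "den w scan_body (s, m) = (?s, m)"
    unfolding scan_body_def seqs_simps den.simps c1 c2 s1_def[symmetric] sat c4 by (rule refl)
  moreover have "scan_inv i (Suc j) ?s m"
    using s j by (auto simp: scan_inv_def row_inv_def base2_def base_def s1_def take_Suc_conv_app_nth)
  ultimately show ?thesis by (intro wp_den) (auto simp: scan_body_def)
qed

lemma ev_succ: "s y < Z \<Longrightarrow> ev w s m (Op ADD (Vr y) (Cn 1)) = s y + 1"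
  using Z_less by (subst ev_poly) auto

lemma ev_less_vars: "s x < 2 ^ w \<Longrightarrow> s y < 2 ^ w \<Longrightarrow> ev w s m (less_expr (Vr x) (Vr y)) = of_bool (s x < s y)"
  using ev_less_expr[OF w1', of s m "Vr x" "Vr y"] by simp

lemma table_mem_step:
  assumes "table_mem i m" "i < N * D"
  shows "table_mem (Suc i) (m(2 * Z + i := of_bool (on (i div D) (i mod D))))"
  using assms by (auto simp: table_mem_def less_Suc_eq)

lemma ev_table_addr: "base s \<Longrightarrow> s 17 = i \<Longrightarrow> i < N * D \<Longrightarrow> ev w s m (Op ADD (Vr 14) (Vr 17)) = 2 * Z + i"
  using Z_less ND_less(2) by (subst ev_poly) (auto simp: base_def)

text \<open>Clauses have at most \<open>k\<close> literals, so an entry of the table costs a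
  constant once \<open>k\<close> is fixed.\<close>

definition scan_cost :: nat where "scan_cost = k * (cost scan_body + 50) + 200"

definition stored :: "nat \<Rightarrow> store \<Rightarrow> store \<Rightarrow> bool" where
  "stored i s m \<longleftrightarrow> row_inv i s \<and> table_mem (Suc i) m \<and> (i mod D < length F \<longrightarrow> s 18 = pos F (Suc (i mod D)))"

lemma scan_code_correct:
  assumes row: "row_inv i s" and mem: "table_mem i m" and ptr: "s 18 = pos F (i mod D)"
    and i: "i < N * D" "i mod D < length F"
  shows "wp w scan_code scan_cost (stored i) s m"
proof -
  let ?x = "i mod D" and ?a = "i div D"
  let ?init = "seqs [Assign 22 (Ld (Vr 18)), Assign 18 (Op ADD (Vr 18) (Cn 1)), Assign 19 (Cn 0), Assign 20 (Cn 0)]"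
  let ?g = "less_expr (Vr 20) (Vr 22)"
  let ?fin = "Sto (Op ADD (Vr 14) (Vr 17)) (eq_expr (Vr 19) (Cn 0))"
  have p: "pos F ?x < Z" using pos_less[OF i(2), of 0] input_len by simp
  then have len: "m (pos F ?x) = length (F ! ?x)"
    using mem input_pos(1)[OF i(2)] by (simp add: table_mem_def)
  have lenZ: "length (F ! ?x) < Z" using pos_less[OF i(2) order_refl] input_len by linarith
  have lenk: "length (F ! ?x) \<le> k" using clause_len i(2) by simp
  have a: "?a < N" using i(1) by (simp add: less_mult_imp_div_less)
  have start: "wp w ?init (cost ?init) (scan_inv i 0) s m"
  proof -
    let ?s = "s(22 := length (F ! ?x), 18 := pos F ?x + 1, 19 := 0, 20 := 0)"
    have "den w ?init (s, m) = (?s, m)"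
      using ev_succ[of "s(22 := length (F ! ?x))" 18] p by (simp add: ptr len del: ev.simps(3))
    moreover have "scan_inv i 0 ?s m"
      using row mem by (auto simp: scan_inv_def row_inv_def base2_def base_def)
    ultimately show ?thesis by (intro wp_den) auto
  qed
  have guard: "ev w s m ?g = of_bool (j < length (F ! ?x))" if "scan_inv i j s m" "j \<le> length (F ! ?x)" for j s m
    using that lenZ Z_less by (subst ev_less_vars) (auto simp: scan_inv_def)
  have loop: "wp w (While ?g scan_body) (length (F ! ?x) * (cost scan_body + elen ?g + 3) + elen ?g + 2)
      (scan_inv i (length (F ! ?x))) s m" if "scan_inv i 0 s m" for s m
  proof (rule wp_While)
    fix j s m assume "j < length (F ! ?x)" "scan_inv i j s m"
    then show "ev w s m ?g \<noteq> 0 \<and> wp w scan_body (cost scan_body) (scan_inv i (Suc j)) s m"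
      using guard[of j s m] scan_body_correct i by simp
  next
    fix s m assume "scan_inv i (length (F ! ?x)) s m"
    then show "ev w s m ?g = 0" using guard[of "length (F ! ?x)" s m] by simp
  qed (rule that)
  have fin: "wp w ?fin (cost ?fin) (stored i) s m" if inv: "scan_inv i (length (F ! ?x)) s m" for s m
  proof -
    have s: "base s" "row_inv i s" "s 17 = i" "table_mem i m" "s 18 = pos F (Suc ?x)"
      "s 19 = of_bool (\<exists>l\<in>set (F ! ?x). lit_sat h ?a (encode_literal l))"
      using inv i(2) by (auto simp: scan_inv_def row_inv_def base2_def pos_Suc)
    have "(1 :: nat) < 2 ^ w" by (rule small_w) simp
    then have "ev w s m (eq_expr (Vr 19) (Cn 0)) = of_bool (s 19 = 0)"
      using ev_eq_expr[OF w1', of s m "Vr 19" "Cn 0"] s(6) by simp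
    also have "\<dots> = of_bool (on ?a ?x)" using on_eq[OF a, of ?x] i(2) s(6) by simp
    finally have "den w ?fin (s, m) = (s, m(2 * Z + i := of_bool (on ?a ?x)))"
      using ev_table_addr[OF s(1,3) i(1)] by simp
    then show ?thesis
      using s table_mem_step[OF s(4) i(1)] by (intro wp_den) (auto simp: stored_def)
  qed
  have total: "wp w scan_code (cost ?init + ((length (F ! ?x) * (cost scan_body + elen ?g + 3) + elen ?g + 2) + cost ?fin))
      (stored i) s m"
    unfolding scan_code_def by (rule wp_Seq[OF start wp_Seq[OF loop fin]])
  have g: "elen ?g \<le> 47" "cost ?init + cost ?fin \<le> 100"
    by (simp_all add: less_expr_def not_expr_def eq_expr_def)
  have "length (F ! ?x) * (cost scan_body + elen ?g + 3) \<le> k * (cost scan_body + 50)"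
    using lenk g by (intro mult_le_mono) auto
  then have "cost ?init + ((length (F ! ?x) * (cost scan_body + elen ?g + 3) + elen ?g + 2) + cost ?fin) \<le> scan_cost"
    unfolding scan_cost_def using g by linarith
  then show ?thesis by (rule wp_mono[OF total])
qed

lemma guard_code_correct:
  assumes row: "row_inv i s" and mem: "table_mem i m" and i: "i < N * D" "length F \<le> i mod D"
  shows "wp w guard_code (cost guard_code) (stored i) s m"
proof -
  let ?x = "i mod D" and ?a = "i div D"
  have a: "?a < N" using i(1) by (simp add: less_mult_imp_div_less)
  have s: "base s" "s 17 = i" "s 3 = length F" "s 24 = ?x" "s 23 = ?a" "s 4 = h"
    using row by (auto simp: row_inv_def base2_def base_def)
  have x: "?x < 2 ^ w" using D_less_w less_w D by (meson less_trans mod_less_divisor order_less_le_trans zero_less_one)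
  have Dg: "length F + ?a div 2 ^ h < 2 ^ w"
  proof -
    have "?a div 2 ^ h < N" using a by (meson div_le_dividend le_less_trans)
    then have "length F + ?a div 2 ^ h < S + S" using D_less D_less_w(1) ND_less(3) by linarith
    then show ?thesis using S_less Z_less by linarith
  qed
  have e1: "ev w s m (Op ADD (Vr 3) (Cn 4)) = length F + 4"
    using D_less_w by (subst ev_poly) (auto simp: s)
  have e2: "ev w s m (Op ADD (Vr 3) (Op SHR (Vr 23) (Vr 4))) = length F + ?a div 2 ^ h"
    using Dg by (simp add: s drop_bit_eq_div take_bit_nat_eq_self)
  have "ev w s m (less_expr (Vr 24) (Op ADD (Vr 3) (Cn 4))) = of_bool (?x < length F + 4)"
    using ev_less_expr[OF w1', of s m "Vr 24" "Op ADD (Vr 3) (Cn 4)"] unfolding e1 ev.simps(2) s(4)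
    using x D_less_w(2) by blast
  moreover have "ev w s m (eq_expr (Vr 24) (Op ADD (Vr 3) (Op SHR (Vr 23) (Vr 4)))) = of_bool (?x = length F + ?a div 2 ^ h)"
    using ev_eq_expr[OF w1', of s m "Vr 24" "Op ADD (Vr 3) (Op SHR (Vr 23) (Vr 4))"] unfolding e2 ev.simps(2) s(4)
    using x Dg by blast
  ultimately have val: "ev w s m (Op BAND (less_expr (Vr 24) (Op ADD (Vr 3) (Cn 4)))
     (not_expr (eq_expr (Vr 24) (Op ADD (Vr 3) (Op SHR (Vr 23) (Vr 4)))))) = of_bool (on ?a ?x)"
    using ev_and ev_not_expr[OF w1'] on_eq[OF a, of ?x] i(2) by (simp del: ev.simps)
  have "den w guard_code (s, m) = (s, m(2 * Z + i := of_bool (on ?a ?x)))"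
    unfolding guard_code_def using ev_table_addr[OF s(1,2) i(1)] val by (simp del: ev.simps)
  then show ?thesis
    using row i table_mem_step[OF mem i(1)] by (intro wp_den) (auto simp: stored_def guard_code_def)
qed

definition table_cost :: nat where "table_cost = scan_cost + cost guard_code + 200"

lemma table_body_correct:
  assumes inv: "table_inv i s m" and i: "i < N * D"
  shows "wp w table_body table_cost (table_inv (Suc i)) s m"
proof -
  let ?x = "i mod D" and ?a = "i div D"
  let ?init = "seqs [Assign 23 (Op DIV (Vr 17) (Vr 6)), Assign 24 (Op MOD (Vr 17) (Vr 6)),
     If (eq_expr (Vr 24) (Cn 0)) (Assign 18 (Cn 2)) Skip]"
  let ?g = "less_expr (Vr 24) (Vr 3)"
  have s: "base2 s" "s 17 = i" "s 6 = D" "table_mem i m"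
    using inv by (auto simp: table_inv_def base2_def base_def)
  have x: "?x < 2 ^ w" using D_less_w less_w D by (meson less_trans mod_less_divisor order_less_le_trans zero_less_one)
  let ?s1 = "s(23 := ?a, 24 := ?x)"
  let ?s = "if ?x = 0 then ?s1(18 := 2) else ?s1"
  have eq: "ev w ?s1 m (eq_expr (Vr 24) (Cn 0)) = of_bool (?x = 0)"
    using ev_eq_expr[OF w1', of ?s1 m "Vr 24" "Cn 0"] x by simp
  have two: "ev w s' m (Cn 2) = 2" for s' by (rule ev_Cn) simp
  have "den w ?init (s, m) = (?s, m)"
    using eq two by (simp add: s del: ev.simps(1) fun_upd_apply)
      (simp add: s)
  moreover have row: "row_inv i ?s" using s by (auto simp: row_inv_def base2_def base_def)
  moreover have ptr: "?x < length F \<Longrightarrow> ?s 18 = pos F ?x" using inv by (auto simp: table_inv_def)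
  ultimately have start: "wp w ?init (cost ?init) (\<lambda>s' m'. row_inv i s' \<and> m' = m \<and> (?x < length F \<longrightarrow> s' 18 = pos F ?x)) s m"
    by (intro wp_den) auto
  have mid: "wp w (If ?g scan_code guard_code) (elen ?g + 3 + (scan_cost + cost guard_code)) (stored i) s' m'"
    if "row_inv i s' \<and> m' = m \<and> (?x < length F \<longrightarrow> s' 18 = pos F ?x)" for s' m'
  proof -
    have s': "row_inv i s'" "s' 24 = ?x" "s' 3 = length F" using that by (auto simp: row_inv_def base2_def)
    have g: "ev w s' m ?g = of_bool (?x < length F)"
      using s' x D_less_w by (subst ev_less_vars) auto
    show ?thesis
    proof (cases "?x < length F")
      case True
      then show ?thesis using that g scan_code_correct[OF s'(1) s(4) _ i True] by (intro wp_IfT) auto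
    next
      case False
      then show ?thesis using that g guard_code_correct[OF s'(1) s(4) i] by (intro wp_IfF) auto
    qed
  qed
  have fin: "wp w (Assign 17 (Op ADD (Vr 17) (Cn 1))) 4 (table_inv (Suc i)) s' m'" if "stored i s' m'" for s' m'
  proof -
    have 17: "s' 17 = i" "base2 s'" "table_mem (Suc i) m'" using that by (auto simp: stored_def row_inv_def)
    have "i < Z" using i ND_less by linarith
    then have den: "den w (Assign 17 (Op ADD (Vr 17) (Cn 1))) (s', m') = (s'(17 := Suc i), m')"
      using ev_succ[of s' 17 m'] 17 by simp
    have "s' 18 = pos F (Suc i mod D)" if "Suc i mod D \<noteq> 0" "Suc i mod D \<le> length F"
    proof -
      have "Suc i mod D = Suc ?x" using that(1) by (metis mod_Suc)
      then show ?thesis using that(2) \<open>stored i s' m'\<close> by (auto simp: stored_def)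
    qed
    then have "table_inv (Suc i) (s'(17 := Suc i)) m'"
      using 17 by (auto simp: table_inv_def base2_def base_def)
    then show ?thesis using den by (intro wp_den) auto
  qed
  have total: "wp w table_body (cost ?init + ((elen ?g + 3 + (scan_cost + cost guard_code)) + 4)) (table_inv (Suc i)) s m"
    unfolding table_body_def by (rule wp_Seq[OF start wp_Seq[OF mid fin]])
  have "cost ?init + ((elen ?g + 3 + (scan_cost + cost guard_code)) + 4) \<le> table_cost"
    unfolding table_cost_def by (simp add: less_expr_def not_expr_def eq_expr_def)
  then show ?thesis by (rule wp_mono[OF total])
qed

lemma table_code_correct:
  assumes "table_inv 0 s m"
  shows "wp w table_code (S * (table_cost + 50) + 50) (table_inv (N * D)) s m"
proof -
  let ?g = "less_expr (Vr 17) (Vr 33)"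
  have guard: "ev w s m ?g = of_bool (i < N * D)" if "table_inv i s m" "i \<le> N * D" for i s m
    using that ND_less(1) by (subst ev_less_vars) (auto simp: table_inv_def base2_def)
  have loop: "wp w table_code (N * D * (table_cost + elen ?g + 3) + elen ?g + 2) (table_inv (N * D)) s m"
    unfolding table_code_def
  proof (rule wp_While)
    fix i s m assume "i < N * D" "table_inv i s m"
    then show "ev w s m ?g \<noteq> 0 \<and> wp w table_body table_cost (table_inv (Suc i)) s m"
      using guard[of i s m] table_body_correct by simp
  next
    fix s m assume "table_inv (N * D) s m"
    then show "ev w s m ?g = 0" using guard[of "N * D" s m] by simp
  qed (rule assms)
  have g: "elen ?g \<le> 47" by (simp add: less_expr_def not_expr_def eq_expr_def)
  then have "N * D * (table_cost + elen ?g + 3) \<le> S * (table_cost + 50)"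
    using ND_le by (intro mult_le_mono) auto
  then have "N * D * (table_cost + elen ?g + 3) + elen ?g + 2 \<le> S * (table_cost + 50) + 50" using g by linarith
  then show ?thesis by (rule wp_mono[OF loop])
qed

definition prologue_inv :: "nat \<Rightarrow> store \<Rightarrow> store \<Rightarrow> bool" where
  "prologue_inv i s m \<longleftrightarrow> m = input \<and> s 0 = 0 \<and> s 1 = 0 \<and> s 3 = length F \<and> s 4 = h \<and> s 5 = N \<and> s 16 = U \<and>
     s 34 = length F + 4 \<and> s 6 = 2 ^ i \<and> s 17 = 0 \<and> s 31 = 0"

lemma prologue1_correct: "wp w prologue1 (cost prologue1) (prologue_inv 0) (\<lambda>_. 0) input"
proof -
  have hs: "n div 4 + 1 = h" "h < 2 ^ w" "h + 3 < 2 ^ w" "h + 2 < 2 ^ w" using h_eq ND_less(4) by auto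
  have N': "push_bit (h + 3) (1 :: nat) = N" "push_bit (h + 2) (1 :: nat) = U" "N < 2 ^ w" "U < 2 ^ w"
    using N_eq U_eq U N_le_S less_w by (auto simp: push_bit_eq_mult)
  have c: "take_bit w 0 = (0 :: nat)" "take_bit w 1 = (1 :: nat)" "take_bit w 2 = (2 :: nat)"
    "take_bit w 3 = (3 :: nat)" "take_bit w 4 = (4 :: nat)"
    using small_w[of 1] small_w[of 2] small_w[of 3] small_w[of 4] w_ge
    by (simp_all only: take_bit_nat_eq_self take_bit_of_0)
  have t: "take_bit w (h + 3) = h + 3" "take_bit w (h + 2) = h + 2" "take_bit w h = h" "take_bit w N = N"
    "take_bit w U = U" "take_bit w (length F + 4) = length F + 4"
    using hs N' D_less_w by (simp_all only: take_bit_nat_eq_self)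
  let ?s1 = "(\<lambda>_. 0)(2 := n) :: nat \<Rightarrow> nat" let ?s2 = "?s1(3 := length F)" let ?s3 = "?s2(4 := h)"
  let ?s4 = "?s3(5 := N)" let ?s5 = "?s4(16 := U)" let ?s6 = "?s5(6 := 1)" let ?s = "?s6(34 := length F + 4)"
  have v: "?s2 2 = n" "?s3 4 = h" "?s4 4 = h" "?s6 3 = length F" by simp_all
  have e1: "ev w (\<lambda>_. 0) input (Ld (Cn 0)) = n" "ev w ?s1 input (Ld (Cn 1)) = length F"
    unfolding ev.simps c by (rule input_0)+
  have e3: "ev w ?s2 input (Op ADD (Op DIV (Vr 2) (Cn 4)) (Cn 1)) = h"
    unfolding ev.simps binop_val.simps c v hs(1) by (rule t)
  have e4: "ev w ?s3 input (Op SHL (Cn 1) (Op ADD (Vr 4) (Cn 3))) = N"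
    unfolding ev.simps binop_val.simps c v t N' by (rule refl)
  have e5: "ev w ?s4 input (Op SHL (Cn 1) (Op ADD (Vr 4) (Cn 2))) = U"
    unfolding ev.simps binop_val.simps c v t N' by (rule refl)
  have e6: "ev w ?s5 input (Cn 1) = 1" unfolding ev.simps by (rule c)
  have e7: "ev w ?s6 input (Op ADD (Vr 3) (Cn 4)) = length F + 4"
    unfolding ev.simps binop_val.simps c v by (rule t)
  have "den w prologue1 (\<lambda>_. 0, input) = (?s, input)"
    unfolding prologue1_def seqs_simps den.simps e1 e3 e4 e5 e6 e7 by (rule refl)
  moreover have "prologue_inv 0 ?s input" by (simp add: prologue_inv_def)
  ultimately show ?thesis by (intro wp_den) (auto simp: prologue1_def)
qed

lemma prologue2_correct:
  assumes "prologue_inv 0 s m"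
  shows "wp w prologue2 (S * 60 + 50) (prologue_inv t) s m"
proof -
  let ?g = "less_expr (Vr 6) (Vr 34)" and ?b = "Assign 6 (Op ADD (Vr 6) (Vr 6))"
  have small: "2 ^ i \<le> S" if "i \<le> t" for i
  proof -
    have "2 ^ i \<le> D" unfolding D_eq using that by (intro power_increasing) auto
    then show ?thesis using D_less_w(1) by linarith
  qed
  have guard: "ev w s m ?g = of_bool (2 ^ i < length F + 4)" if "prologue_inv i s m" "i \<le> t" for i s m
    using that small less_w D_less_w by (subst ev_less_vars) (auto simp: prologue_inv_def)
  have loop: "wp w prologue2 (t * (cost ?b + elen ?g + 3) + elen ?g + 2) (prologue_inv t) s m"
    unfolding prologue2_def
  proof (rule wp_While)
    fix i s m assume i: "i < t" "prologue_inv i s m"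
    have "ev w s m (Op ADD (Vr 6) (Vr 6)) = 2 ^ Suc i"
      using i small[of "Suc i"] less_w by (subst ev_poly) (auto simp: prologue_inv_def)
    then have "den w ?b (s, m) = (s(6 := 2 ^ Suc i), m)" by (simp del: ev.simps)
    moreover have "prologue_inv (Suc i) (s(6 := 2 ^ Suc i)) m" using i by (auto simp: prologue_inv_def)
    ultimately have "wp w ?b (cost ?b) (prologue_inv (Suc i)) s m" by (intro wp_den) auto
    then show "ev w s m ?g \<noteq> 0 \<and> wp w ?b (cost ?b) (prologue_inv (Suc i)) s m"
      using guard[of i s m] i t(2)[of i] by simp
  next
    fix s m assume "prologue_inv t s m"
    then show "ev w s m ?g = 0" using guard[of t s m] t(1) by simp
  qed (rule assms)
  have g: "elen ?g \<le> 47" "cost ?b \<le> 5" by (simp_all add: less_expr_def not_expr_def eq_expr_def)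
  have "t < 2 ^ t" by simp
  then have "t \<le> S" by (rule order_trans[OF less_imp_le small[OF order_refl]])
  then have "t * (cost ?b + elen ?g + 3) \<le> S * 60" using g by (intro mult_le_mono) auto
  then have "t * (cost ?b + elen ?g + 3) + elen ?g + 2 \<le> S * 60 + 50" using g by linarith
  then show ?thesis by (rule wp_mono[OF loop])
qed

lemma prologue3_correct:
  assumes inv: "prologue_inv t s m"
  shows "wp w (prologue3 bw) (cost (prologue3 bw)) (table_inv 0) s m"
proof -
  have s: "s 0 = 0" "s 1 = 0" "s 3 = length F" "s 4 = h" "s 5 = N" "s 16 = U" "s 6 = D" "s 17 = 0" "s 31 = 0" "m = input"
    using inv D_eq by (auto simp: prologue_inv_def)
  let ?s1 = "s(7 := W)" let ?s2 = "?s1(8 := N ^ 2)" let ?s3 = "?s2(9 := N ^ 3)" let ?s4 = "?s3(10 := S)"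
  let ?s5 = "?s4(11 := Nv)" let ?s6 = "?s5(12 := 2 ^ w1 - 1)" let ?s7 = "?s6(13 := Z)"
  let ?s8 = "?s7(14 := 2 * Z)" let ?s9 = "?s8(15 := 3 * Z)" let ?s10 = "?s9(33 := N * D)"
  have N2: "N ^ 2 \<le> N ^ 3" using N by (intro power_increasing) auto
  have e1: "ev w s m (pow_expr (Vr 6) 7) = W"
    using N_le_S less_w by (subst ev_poly) (auto simp: s W_def)
  have e2: "ev w ?s1 m (pow_expr (Vr 5) 2) = N ^ 2"
    using N2 N_le_S less_w by (subst ev_poly) (auto simp: s simp del: pow_expr.simps)
  have e3: "ev w ?s2 m (pow_expr (Vr 5) 3) = N ^ 3"
    using N_le_S less_w by (subst ev_poly) (auto simp: s)
  have e4: "ev w ?s3 m (Op MUL (Op MUL (Vr 9) (Vr 7)) (Vr 7)) = S"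
    using less_w[of S] by (subst ev_poly) (auto simp: S_def)
  have e5: "ev w ?s4 m (Op MUL (Cn 4) (Vr 10)) = Nv"
    using S_less Z_less by (subst ev_poly) (auto simp: Nv_def)
  have p: "ev w ?s5 m (pow_expr (Vr 11) bw) = 2 ^ w1"
    using w1_le_Z Z_less by (subst ev_poly) (auto simp: w1_eq)
  have e6: "ev w ?s5 m (Op SUB (pow_expr (Vr 11) bw) (Cn 1)) = 2 ^ w1 - 1"
  proof -
    have one: "ev w ?s5 m (Cn 1) = 1" by (rule ev_Cn) simp
    \<comment> \<open>\<open>SUB\<close> adds \<open>2 ^ w\<close> before subtracting; truncation
      removes it again.\<close>
    have eq: "2 ^ w + 2 ^ w1 - 1 = 2 ^ w + (2 ^ w1 - 1 :: nat)" by simp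
    have "take_bit w (2 ^ w + q) = q" if "q < 2 ^ w" for q :: nat
      using that by (simp add: take_bit_eq_mod)
    moreover have "2 ^ w1 - 1 < (2 ^ w :: nat)" using w1_le_Z Z_less by linarith
    ultimately have "take_bit w (2 ^ w + 2 ^ w1 - 1) = (2 ^ w1 - 1 :: nat)" unfolding eq by blast
    then show ?thesis unfolding ev.simps(3) p one binop_val.simps .
  qed
  have e7: "ev w ?s6 m (pow_expr (Vr 11) (bw + 3)) = Z"
    using Z_less by (subst ev_poly) (auto simp: Z_def simp del: pow_expr.simps)
  have e8: "ev w ?s7 m (Op MUL (Cn 2) (Vr 13)) = 2 * Z" using Z_less by (subst ev_poly) auto
  have e9: "ev w ?s8 m (Op MUL (Cn 3) (Vr 13)) = 3 * Z" using Z_less by (subst ev_poly) auto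
  have e10: "ev w ?s9 m (Op MUL (Vr 5) (Vr 6)) = N * D" using ND_less(1) by (subst ev_poly) (auto simp: s)
  have "den w (prologue3 bw) (s, m) = (?s10, m)"
    unfolding prologue3_def seqs_simps den.simps e1 e2 e3 e4 e5 e6 e7 e8 e9 e10 by (rule refl)
  moreover have "table_inv 0 ?s10 m"
    using input_high by (auto simp: table_inv_def base2_def base_def table_mem_def s s(2)[unfolded One_nat_def])
  moreover have "loopfree (prologue3 bw)" by (simp add: prologue3_def)
  ultimately show ?thesis by (intro wp_den) auto
qed

text \<open>Only \<open>bw\<close> survives as a parameter outside the locale: one program serves
  all formulas. In the same way \<open>prepare_cost\<close> depends on \<open>bw\<close> and
  \<open>k\<close> alone.\<close>

definition prepare :: com where
  "prepare = Seq prologue1 (Seq prologue2 (Seq (prologue3 bw) (Seq table_code (Seq (Assign 17 (Cn 0)) enum_code))))"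

definition prepare_cost :: nat where
  "prepare_cost = cost prologue1 + 110 + cost (prologue3 bw) + (table_cost + 100) + 10 + (cost enum_body + 200)"

lemma prepare_correct:
  "wp w prepare (S * prepare_cost) (\<lambda>s m. base s \<and>
     (\<forall>i<2 ^ w1. m (Z + i) = mem (init_state w1 (encode_graph Nv (edges S))) i)) (\<lambda>_. 0) input"
proof -
  have reset: "wp w (Assign 17 (Cn 0)) 2 (enum_inv 0) s m" if "table_inv (N * D) s m" for s m
  proof -
    have tm: "table_mem (N * D) m" and b: "base2 s" using that by (auto simp: table_inv_def)
    have "m a = lay [] a" if "Z \<le> a" for a
    proof (cases "2 * Z \<le> a \<and> a < 2 * Z + N * D")
      case True
      then obtain y where y: "a = 2 * Z + y" "y < N * D" by (metis add_less_cancel_left le_Suc_ex)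
      then have "a < 3 * Z" using ND_less(2) by simp
      then show ?thesis using tm y by (simp add: table_mem_def lay_def)
    next
      case False
      then have "m a = 0" using tm input_high[OF that] by (auto simp: table_mem_def)
      then show ?thesis using False ND_less(2) by (auto simp: lay_def)
    qed
    then have "laid [] m" by (simp add: laid_def)
    then have "enum_inv 0 (s(17 := 0)) m"
      using b by (auto simp: enum_inv_def base2_def base_def edges_def)
    then show ?thesis by (intro wp_den) auto
  qed
  have total: "wp w prepare (cost prologue1 + ((S * 60 + 50) + (cost (prologue3 bw) + ((S * (table_cost + 50) + 50) +
      (2 + (S * (cost enum_body + 100) + 100)))))) (\<lambda>s m. base s \<and>
     (\<forall>i<2 ^ w1. m (Z + i) = mem (init_state w1 (encode_graph Nv (edges S))) i)) (\<lambda>_. 0) input"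
    unfolding prepare_def
    by (intro wp_Seq[OF prologue1_correct] wp_Seq[OF prologue2_correct] wp_Seq[OF prologue3_correct]
        wp_Seq[OF table_code_correct] wp_Seq[OF reset] enum_code_correct)
  have le: "x \<le> S * x" for x using S_pos by simp
  have "cost prologue1 + ((S * 60 + 50) + (cost (prologue3 bw) + ((S * (table_cost + 50) + 50) +
      (2 + (S * (cost enum_body + 100) + 100))))) \<le> S * prepare_cost"
    unfolding prepare_cost_def add_mult_distrib2
    using le[of "cost prologue1"] le[of "cost (prologue3 bw)"] S_pos by linarith
  then show ?thesis by (rule wp_mono[OF total])
qed

end

section \<open>Satisfiability and orthogonal vectors\<close>

definition incident :: "nat \<Rightarrow> cnf \<Rightarrow> nat \<Rightarrow> nat \<Rightarrow> bool" where
  "incident h F a x \<longleftrightarrow> (if x < length F then \<forall>l\<in>set (F ! x). \<not> lit_sat h a (encode_literal l)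
      else x < length F + 4 \<and> x \<noteq> length F + a div 2 ^ h)"

lemma lit_sat_encode:
  "lit_sat h a (encode_literal (v, s)) \<longleftrightarrow> v div h = a div 2 ^ h \<and> (a div 2 ^ (v mod h) mod 2 = 1) = s"
proof -
  have "(2 * v + of_bool s) div 2 = v" "(2 * v + of_bool s) mod 2 = of_bool s" by (cases s; simp)+
  moreover have "y mod 2 = of_bool s \<longleftrightarrow> (y mod 2 = 1) = s" for y :: nat by (cases s) auto
  ultimately show ?thesis by (simp add: lit_sat_def encode_literal_def)
qed

text \<open>\<open>y g\<close> is the satisfying assignment restricted to group \<open>g\<close>. A
  true literal switches its clause off for the group of its variable, and guard \<open>g\<close> is
  off for \<open>y g\<close>.\<close>

lemma satisfiable_imp_orthogonal:
  assumes vars: "\<forall>C\<in>set F. \<forall>(v, s)\<in>set C. v < 4 * h" and sat: "satisfiable F" and h: "0 < h"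
  obtains y where "\<And>g. g < 4 \<Longrightarrow> y g div 2 ^ h = g"
    "\<And>x. \<not> (incident h F (y 0) x \<and> incident h F (y 1) x \<and> incident h F (y 2) x \<and> incident h F (y 3) x)"
proof -
  obtain \<sigma> :: "nat \<Rightarrow> bool" where \<sigma>: "\<forall>C\<in>set F. \<exists>(v, s)\<in>set C. \<sigma> v = s"
    using sat by (auto simp: satisfiable_def)
  have "\<exists>r<2 ^ h. \<forall>i<h. r div 2 ^ i mod 2 = (of_bool (\<sigma> (g * h + i)) :: nat)" for g
    by (rule digits_exist) auto
  then have "\<forall>g. \<exists>r. r < 2 ^ h \<and> (\<forall>i<h. r div 2 ^ i mod 2 = (of_bool (\<sigma> (g * h + i)) :: nat))" by blast
  from choice[OF this] obtain r :: "nat \<Rightarrow> nat" where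
    r: "\<And>g. r g < 2 ^ h" "\<And>g i. i < h \<Longrightarrow> r g div 2 ^ i mod 2 = of_bool (\<sigma> (g * h + i))"
    by blast
  define y where "y g = r g + g * 2 ^ h" for g
  have yg: "y g div 2 ^ h = g" for g using r(1)[of g] by (simp add: y_def)
  have bit: "y g div 2 ^ i mod 2 = of_bool (\<sigma> (g * h + i))" if i: "i < h" for g i
  proof -
    obtain l where l: "h = Suc (i + l)" using i less_iff_Suc_add by auto
    have eq: "g * 2 ^ h = (g * 2 ^ l * 2) * 2 ^ i" by (simp add: l power_add algebra_simps)
    have "y g div 2 ^ i = g * 2 ^ l * 2 + r g div 2 ^ i"
      unfolding y_def eq by (rule div_mult_self1) simp
    then show ?thesis using r(2)[OF i] by simp
  qed
  have orth: "\<exists>g<4. \<not> incident h F (y g) x" for x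
  proof (cases "x < length F")
    case True
    then obtain v s where vs: "(v, s) \<in> set (F ! x)" "\<sigma> v = s" using \<sigma> by (fastforce dest: nth_mem)
    then have "v < 4 * h" using vars True by (fastforce dest: nth_mem)
    then have "v div h < 4" by (simp add: less_mult_imp_div_less)
    moreover have "lit_sat h (y (v div h)) (encode_literal (v, s))"
      unfolding lit_sat_encode using yg bit[of "v mod h" "v div h"] h vs(2) by simp
    ultimately show ?thesis using vs(1) True by (auto simp: incident_def)
  next
    case False
    show ?thesis
    proof (cases "x < length F + 4")
      case True
      then show ?thesis using False yg by (intro exI[of _ "x - length F"]) (auto simp: incident_def)
    next
      case F2: False
      then show ?thesis using False by (intro exI[of _ 0]) (auto simp: incident_def)
    qed
  qed
  show ?thesis
  proof (rule that[of y])
    fix x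
    obtain g where "g < 4" "\<not> incident h F (y g) x" using orth by blast
    moreover from this(1) have "g = 0 \<or> g = 1 \<or> g = 2 \<or> g = 3" by linarith
    ultimately show "\<not> (incident h F (y 0) x \<and> incident h F (y 1) x \<and> incident h F (y 2) x \<and> incident h F (y 3) x)"
      by auto
  qed (rule yg)
qed

text \<open>Guard \<open>g\<close> is off only in group \<open>g\<close>, so the at most four
  vectors hit all four groups and hence each exactly once: together they form one assignment. A
  vector that is off at a clause satisfies a literal of it, and the variable of this literal lies in
  the group of that vector.\<close>

lemma orthogonal_imp_satisfiable:
  assumes vars: "\<forall>C\<in>set F. \<forall>(v, s)\<in>set C. v < 4 * h"
    and orth: "\<And>x. \<not> (incident h F a x \<and> incident h F b x \<and> incident h F c x \<and> incident h F d x)"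
  shows "satisfiable F"
proof -
  define A where "A = {a, b, c, d}"
  have orthA: "\<exists>y\<in>A. \<not> incident h F y x" for x using orth by (auto simp: A_def)
  define grp where "grp y = y div 2 ^ h" for y :: nat
  have ex: "\<exists>y\<in>A. grp y = g" if "g < 4" for g
    using orthA[of "length F + g"] that by (auto simp: incident_def grp_def)
  have "inj_on grp A"
  proof (rule eq_card_imp_inj_on)
    show "finite A" by (simp add: A_def)
    then have "card (grp ` A) \<le> card A" by (rule card_image_le)
    moreover have "{..<4} \<subseteq> grp ` A" using ex by force
    then have "card {..<4 :: nat} \<le> card (grp ` A)" by (rule card_mono[rotated]) (simp add: A_def)
    moreover have "card A \<le> 4" using card_length[of "[a, b, c, d]"] by (simp add: A_def)
    ultimately show "card (grp ` A) = card A" by simp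
  qed
  then have inj: "\<And>y z. y \<in> A \<Longrightarrow> z \<in> A \<Longrightarrow> grp y = grp z \<Longrightarrow> y = z" by (auto dest: inj_onD)
  obtain y where y: "\<And>g. g < 4 \<Longrightarrow> y g \<in> A \<and> grp (y g) = g" using ex by metis
  define \<sigma> where "\<sigma> v = (y (v div h) div 2 ^ (v mod h) mod 2 = 1)" for v
  have "\<exists>(v, s)\<in>set C. \<sigma> v = s" if C: "C \<in> set F" for C
  proof -
    obtain x where x: "x < length F" "C = F ! x" using C by (metis in_set_conv_nth)
    obtain z where z: "z \<in> A" "\<not> incident h F z x" using orthA by blast
    then obtain v s where vs: "(v, s) \<in> set C" "lit_sat h z (encode_literal (v, s))"
      using x by (auto simp: incident_def)
    then have "v < 4 * h" using vars C by blast
    then have "v div h < 4" by (simp add: less_mult_imp_div_less)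
    moreover have "grp z = v div h" using vs(2) by (simp add: lit_sat_encode grp_def)
    ultimately have "y (v div h) = z" using y inj z(1) by metis
    then show ?thesis using vs unfolding lit_sat_encode by (intro bexI[of _ "(v, s)"]) (auto simp: \<sigma>_def)
  qed
  then show ?thesis unfolding satisfiable_def by blast
qed

section \<open>Size of k-CNF formulas and growth rates\<close>

lemma sum_powers_le: "(\<Sum>i\<le>k. x ^ i) \<le> (x + 1 :: nat) ^ k"
proof (induction k)
  case (Suc k)
  have "x ^ k \<le> (x + 1) ^ k" by (rule power_mono) auto
  then have "x * x ^ k \<le> x * (x + 1) ^ k" by (rule mult_le_mono2)
  with Suc have "(\<Sum>i\<le>k. x ^ i) + x * x ^ k \<le> (x + 1) ^ k + x * (x + 1) ^ k" by (rule add_mono)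
  then show ?case by (simp add: algebra_simps)
qed simp

text \<open>Clauses differ as sets, and each set is represented by a list of at most
  \<open>k\<close> out of \<open>2 * n\<close> literals.\<close>

lemma kcnf_length:
  assumes "kcnf k n F"
  shows "length F \<le> (2 * n + 1) ^ k"
proof -
  define L where "L = {..<n} \<times> (UNIV :: bool set)"
  have L: "finite L" "card L = 2 * n" by (simp_all add: L_def card_cartesian_product)
  have "set (map set F) \<subseteq> set ` {xs. set xs \<subseteq> L \<and> length xs \<le> k}"
    using assms by (fastforce simp: kcnf_def L_def)
  then have "card (set (map set F)) \<le> card {xs. set xs \<subseteq> L \<and> length xs \<le> k}"
    using finite_lists_length_le[OF L(1)] by (meson card_image_le card_mono finite_imageI order_trans)
  also have "\<dots> = (\<Sum>i\<le>k. (2 * n) ^ i)" using card_lists_length_le[OF L(1)] L(2) by simp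
  also have "\<dots> \<le> (2 * n + 1) ^ k" by (rule sum_powers_le)
  finally show ?thesis using assms distinct_card[of "map set F"] by (simp add: kcnf_def)
qed

lemma kcnf_clause_length:
  assumes "kcnf k n F" "C \<in> set F"
  shows "length C \<le> 2 * n" "length C \<le> k" "\<And>v s. (v, s) \<in> set C \<Longrightarrow> v < n"
proof -
  have "set C \<subseteq> {..<n} \<times> (UNIV :: bool set)" "distinct C" using assms by (auto simp: kcnf_def)
  then have "card (set C) \<le> card ({..<n} \<times> (UNIV :: bool set))" by (intro card_mono) auto
  then show "length C \<le> 2 * n" using distinct_card[OF \<open>distinct C\<close>] by (simp add: card_cartesian_product)
qed (use assms in \<open>auto simp: kcnf_def\<close>)

lemma poly_times_exp_bigo:
  fixes q r :: real
  assumes "0 < q" "q < r"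
  shows "(\<lambda>n. (2 * real n + 1) ^ K * q ^ n) \<in> O(\<lambda>n. r ^ n)"
proof -
  have "ln (q / r) < 0" using assms by simp
  then have "(\<lambda>n. (2 * real n + 1) ^ K * exp (ln (q / r) * real n)) \<in> O(\<lambda>n. 1)"
    by real_asymp
  moreover have "exp (ln (q / r) * real n) = q ^ n / r ^ n" for n
    using assms by (simp add: mult.commute exp_of_nat_mult power_divide)
  ultimately have "(\<lambda>n. (2 * real n + 1) ^ K * (q ^ n / r ^ n)) \<in> O(\<lambda>n. 1)" by simp
  then have "(\<lambda>n. r ^ n * ((2 * real n + 1) ^ K * (q ^ n / r ^ n))) \<in> O(\<lambda>n. r ^ n * 1)"
    by (intro landau_o.big.mult) auto
  then show ?thesis using assms by (simp add: field_simps)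
qed

section \<open>The reduction\<close>

text \<open>Nonzero iff the output fraction exceeds 4; a denominator 0 stands for infinity.\<close>

definition decide_expr :: expr where
  "decide_expr = Op BOR (Op DIV (Vr 0) (Op ADD (Op MUL (Cn 4) (Vr 1)) (Cn 1))) (Op DIV (Cn 1) (Op ADD (Vr 1) (Cn 1)))"

text \<open>Variables 12 and 13 hold the mask and the memory offset of the simulation. The output
  registers 0 and 1 of \<open>P\<close> coincide with variables 0 and 1, so the final assignment
  reads the fraction directly.\<close>

definition solver :: "nat \<Rightarrow> nat \<Rightarrow> program \<Rightarrow> program" where
  "solver b K P = (let c = tabling.prepare b in comp K 0 c @ sim_prog K (clen c) 12 13 P @
     comp K (clen c + 2 * length P) (Assign 0 decide_expr))"

lemma run_state_mono:
  assumes "reach P w t (init_state w xs) st" "halted P st" "t \<le> T"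
  shows "run_state P w T xs = st"
proof -
  obtain j where j: "T = j + t" using assms(3) by (metis le_add_diff_inverse2)
  have "(step P w ^^ j) st = st" using assms(2) by (induction j) (simp_all add: step_def)
  then show ?thesis using assms(1) by (simp add: run_state_def reach_def j funpow_add)
qed

lemma computes_within_mono:
  assumes "computes_within P w t xs Q" "t \<le> T"
  shows "computes_within P w T xs Q"
  using run_state_mono[of P w t xs "run_state P w t xs" T] assms
  by (simp add: computes_within_def reach_def run_state_def)

context tabling
begin

lemma pverts_eq: "pverts graph = {0..<Nv}"
  by (simp add: graph_def)

text \<open>The first quotient is positive exactly if the numerator is at least four times the
  denominator plus one, the second only for denominator 0. Outputs are below \<open>Z\<close> and
  \<open>4 * Z < 2 ^ w\<close>, so neither divisor overflows.\<close>

lemma decide_expr_nonzero: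
  assumes "s 0 < Z" "s 1 < Z"
  shows "ev w s m decide_expr \<noteq> 0 \<longleftrightarrow> s 1 = 0 \<or> 4 * s 1 < s 0"
proof -
  have e1: "ev w s m (Op ADD (Op MUL (Cn 4) (Vr 1)) (Cn 1)) = 4 * s 1 + 1"
    using assms Z_less by (subst ev_poly) auto
  have e2: "ev w s m (Op ADD (Vr 1) (Cn 1)) = s 1 + 1"
    using assms Z_less by (subst ev_poly) auto
  have one: "ev w s m (Cn 1) = 1" by (rule ev_Cn) simp
  have or: "x OR y = 0 \<longleftrightarrow> x = 0 \<and> y = (0 :: nat)" for x y
    by (simp add: or_eq_0_iff)
  have op: "ev w s m (Op BOR (Op DIV a b) (Op DIV c d)) = (ev w s m a div ev w s m b) OR (ev w s m c div ev w s m d)"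
    for a b c d by simp
  have "ev w s m decide_expr = 0 \<longleftrightarrow> s 0 div (4 * s 1 + 1) = 0 \<and> 1 div (s 1 + 1) = 0"
    unfolding decide_expr_def op e1 e2 one or ev.simps(2) by (rule refl)
  also have "\<dots> \<longleftrightarrow> s 0 < 4 * s 1 + 1 \<and> s 1 \<noteq> 0"
    by (auto simp: div_eq_0_iff)
  finally show ?thesis by auto
qed

lemma solver_correct:
  assumes K: "2 \<le> K" "\<forall>i\<in>set P. instr_regs i \<subseteq> {..<K}"
    and run: "computes_within P w1 T (encode_graph Nv (edges S)) (\<lambda>R. Q (R 0) (R 1))"
  obtains p q where "Q p q" "computes_within (solver bw K P) w (S * prepare_cost + 2 * T + 20) (encode_cnf n F)
    (\<lambda>R. R 0 \<noteq> 0 \<longleftrightarrow> q = 0 \<or> 4 * q < p)"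
proof -
  let ?Q = "solver bw K P" and ?st = "init_state w (encode_cnf n F)" and ?xs = "encode_graph Nv (edges S)"
  let ?p1 = "clen prepare" and ?p2 = "clen prepare + 2 * length P"
  have eq: "?Q = comp K 0 prepare @ sim_prog K ?p1 12 13 P @ comp K ?p2 (Assign 0 decide_expr)"
    by (simp add: solver_def Let_def)
  have code: "code_at ?Q 0 (comp K 0 prepare)" "code_at ?Q ?p1 (sim_prog K ?p1 12 13 P)"
    "code_at ?Q ?p2 (comp K ?p2 (Assign 0 decide_expr))"
    using code_at_self[of "[]" "comp K 0 prepare" "sim_prog K ?p1 12 13 P @ comp K ?p2 (Assign 0 decide_expr)"]
      code_at_self[of "comp K 0 prepare" "sim_prog K ?p1 12 13 P" "comp K ?p2 (Assign 0 decide_expr)"]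
      code_at_self[of "comp K 0 prepare @ sim_prog K ?p1 12 13 P" "comp K ?p2 (Assign 0 decide_expr)" "[]"]
    unfolding eq by simp_all
  have len: "length ?Q = ?p2 + elen decide_expr + 1" unfolding eq by simp
  obtain t1 s1 m1 where 1: "big w prepare (\<lambda>_. 0) input t1 s1 m1" "t1 \<le> S * prepare_cost" "base s1"
    "\<And>i. i < 2 ^ w1 \<Longrightarrow> m1 (Z + i) = mem (init_state w1 ?xs) i"
    using prepare_correct unfolding wp_def by blast
  have "\<exists>st1. com_result K ?Q w t1 prepare s1 m1 ?st st1"
    by (rule comp_correct[OF K(1) 1(1) w1']) (use code in \<open>simp_all add: init_state_def agree_def input_def\<close>)
  then obtain st1 where st1: "reach ?Q w t1 ?st st1" "pc st1 = ?p1" "mem st1 = m1" "agree K s1 (regs st1)"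
    "same_low K (regs ?st) (regs st1)"
    unfolding com_result_def[OF K(1)] by (auto simp: init_state_def)
  \<comment> \<open>The simulated program starts with zero registers: \<open>base\<close> clears
    variables 0 and 1, and the other reserved registers have never been written.\<close>
  have zero: "regs st1 r = 0" if "r < K" for r
  proof -
    consider "r = 0" | "r = 1" | "2 \<le> r" by linarith
    then show ?thesis
    proof cases
      case 1
      then show ?thesis using st1(4) \<open>base s1\<close> by (auto simp: agree_def base_def var_def split: if_splits)
    next
      case 2
      then show ?thesis using st1(4) \<open>base s1\<close> by (auto simp: agree_def base_def var_def split: if_splits)
    next
      case 3
      then show ?thesis using st1(5) that by (simp add: same_low_def init_state_def)
    qed
  qed
  have vars: "regs st1 (var K 12) = 2 ^ w1 - 1" "regs st1 (var K 13) = Z"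
    using st1(4) \<open>base s1\<close> unfolding agree_def base_def by metis+
  have rel: "simrel K ?p1 (length P) 12 13 w1 Z (init_state w1 ?xs) st1"
    unfolding simrel_def using st1(2,3) 1(4) zero vars by (auto simp: init_state_def)
  have "w1 \<le> w"
  proof -
    have "(2 :: nat) ^ w1 \<le> 2 ^ w" using w1_le_Z Z_less by linarith
    then show ?thesis by (simp add: power_le_imp_le_exp)
  qed
  moreover have "Z + 2 ^ w1 \<le> 2 ^ w" using w1_le_Z Z_less by linarith
  ultimately obtain t2 st2 where st2: "t2 \<le> 2 * T" "reach ?Q w t2 st1 st2"
    "simrel K ?p1 (length P) 12 13 w1 Z (run_state P w1 T ?xs) st2"
    using sim_run[OF K(1) _ _ code(2) K(2) _ _ rel, of w T] unfolding run_state_def by auto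
  let ?R = "regs (run_state P w1 T ?xs)"
  have Q: "Q (?R 0) (?R 1)" and halt: "halted P (run_state P w1 T ?xs)" using run by (auto simp: computes_within_def)
  have R: "?R r < 2 ^ w1" "regs st2 r = ?R r" if "r < K" for r using st2(3) that by (auto simp: simrel_def)
  have pc2: "pc st2 = ?p2" using st2(3) halt by (simp add: simrel_def halted_def)
  define s2 where "s2 x = regs st2 (var K x)" for x
  have s2: "s2 0 = ?R 0" "s2 1 = ?R 1" using R K(1) by (simp_all add: s2_def var_def)
  have "\<exists>st3. com_result K ?Q w (elen decide_expr + 1) (Assign 0 decide_expr)
      (s2(0 := ev w s2 (mem st2) decide_expr)) (mem st2) st2 st3"
    by (rule comp_correct[OF K(1) big.Assign w1']) (use code(3) pc2 in \<open>simp_all add: agree_def s2_def del: comp.simps\<close>)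
  then obtain st3 where st3: "reach ?Q w (elen decide_expr + 1) st2 st3" "pc st3 = ?p2 + elen decide_expr + 1"
    "agree K (s2(0 := ev w s2 (mem st2) decide_expr)) (regs st3)"
    unfolding com_result_def[OF K(1)] using pc2 by auto
  have "regs st3 0 = ev w s2 (mem st2) decide_expr"
    using st3(3) unfolding agree_def var_def by (metis fun_upd_same pos2)
  moreover have "s2 0 < Z" "s2 1 < Z" using R(1)[of 0] R(1)[of 1] K(1) s2 w1_le_Z by simp_all
  ultimately have out: "regs st3 0 \<noteq> 0 \<longleftrightarrow> ?R 1 = 0 \<or> 4 * ?R 1 < ?R 0"
    using decide_expr_nonzero s2 by simp
  have "reach ?Q w (t1 + t2 + (elen decide_expr + 1)) ?st st3"
    using reach_trans[OF reach_trans[OF st1(1) st2(2)] st3(1)] .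
  moreover have h3: "halted ?Q st3" using st3(2) len by (simp add: halted_def)
  moreover have "t1 + t2 + (elen decide_expr + 1) \<le> S * prepare_cost + 2 * T + 20"
    using 1(2) st2(1) by (simp add: decide_expr_def)
  ultimately have "run_state ?Q w (S * prepare_cost + 2 * T + 20) (encode_cnf n F) = st3"
    by (rule run_state_mono)
  then show ?thesis by (intro that[OF Q]) (use out h3 in \<open>simp add: computes_within_def\<close>)
qed

end

text \<open>A value in the interval from 0 to 4, multiplied by a factor less than 7/4, stays below
  7, whereas a diameter of at most 4 bounds the value by 4 outright. Hence the threshold 4.\<close>

lemma approx_4_or_7:
  fixes G :: "'a pair_pre_digraph"
  assumes "is_diam_approx (7/4 - \<epsilon>) G (fraction_val p q)" "0 < \<epsilon>"
  shows "7 \<le> diam G \<Longrightarrow> q = 0 \<or> 4 * q < p" and "diam G \<le> 4 \<Longrightarrow> \<not> (q = 0 \<or> 4 * q < p)"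
proof -
  have approx: "fraction_val p q \<le> diam G" "diam G \<le> ereal (7/4 - \<epsilon>) * fraction_val p q"
    using assms(1) by (auto simp: is_diam_approx_def)
  show "q = 0 \<or> 4 * q < p" if "7 \<le> diam G"
  proof (rule ccontr)
    assume "\<not> (q = 0 \<or> 4 * q < p)"
    then have q: "q \<noteq> 0" "p \<le> 4 * q" by auto
    then have D: "0 \<le> real p / real q" "real p / real q \<le> 4" by (auto simp: field_simps)
    have "fraction_val p q = ereal (real p / real q)" using q by (simp add: fraction_val_def)
    then have "ereal 7 \<le> ereal ((7/4 - \<epsilon>) * (real p / real q))"
      using order_trans[OF that approx(2)] by simp
    then have "7 \<le> (7/4 - \<epsilon>) * (real p / real q)" unfolding ereal_less_eq .
    also have "\<dots> = 7/4 * (real p / real q) - \<epsilon> * (real p / real q)" by (simp add: algebra_simps)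
    finally have "7 \<le> 7/4 * (real p / real q) - \<epsilon> * (real p / real q)" .
    moreover have "0 \<le> \<epsilon> * (real p / real q)" using assms(2) D by simp
    ultimately have "real p / real q = 4" "\<epsilon> * (real p / real q) \<le> 0" using D by linarith+
    then show False using assms(2) by simp
  qed
  show "\<not> (q = 0 \<or> 4 * q < p)" if "diam G \<le> 4"
  proof
    assume a: "q = 0 \<or> 4 * q < p"
    have "fraction_val p q \<le> ereal 4" using approx(1) that by (simp add: order_trans)
    then have "q \<noteq> 0" "real p / real q \<le> 4" by (auto simp: fraction_val_def split: if_splits)
    then have "real p \<le> real (4 * q)" by (simp add: field_simps)
    then show False using a \<open>q \<noteq> 0\<close> by linarith
  qed
qed

section \<open>Parameters of the reduction\<close>

definition coord_bits :: "nat \<Rightarrow> nat" where "coord_bits m = (LEAST t. m + 4 \<le> 2 ^ t)"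

lemma coord_bits:
  "m + 4 \<le> 2 ^ coord_bits m" "i < coord_bits m \<Longrightarrow> 2 ^ i < m + 4" "2 ^ coord_bits m \<le> 2 * (m + 4)"
proof -
  have "m + 4 < 2 ^ (m + 4)" by (rule less_exp)
  then have ex: "m + 4 \<le> 2 ^ (m + 4)" by (rule less_imp_le)
  show "m + 4 \<le> 2 ^ coord_bits m" unfolding coord_bits_def by (rule LeastI[of "\<lambda>t. m + 4 \<le> 2 ^ t", OF ex])
  show *: "2 ^ i < m + 4" if "i < coord_bits m" for i
    using not_less_Least[OF that[unfolded coord_bits_def]] by simp
  show "2 ^ coord_bits m \<le> 2 * (m + 4)"
  proof (cases "coord_bits m")
    case (Suc i)
    then show ?thesis using *[of i] by simp
  qed simp
qed

definition group_bits :: "nat \<Rightarrow> nat" where "group_bits n = n div 4 + 1"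

text \<open>The binary logarithm of the number of vertices \<open>4 * N ^ 3 * D ^ 14\<close>; the
  exponent 14 accounts for two arrays of seven slots.\<close>

definition graph_bits :: "nat \<Rightarrow> nat \<Rightarrow> nat" where
  "graph_bits n m = 2 + 3 * (group_bits n + 3) + 14 * coord_bits m"

lemma graph_bits_power:
  "4 * ((2 ^ (group_bits n + 3)) ^ 3 * (2 ^ coord_bits m) ^ 7 * (2 ^ coord_bits m) ^ 7) = (2 :: nat) ^ graph_bits n m"
proof -
  have "(2 :: nat) ^ graph_bits n m = 2 ^ 2 * (2 ^ (3 * (group_bits n + 3)) * 2 ^ (7 * coord_bits m) * 2 ^ (7 * coord_bits m))"
    unfolding graph_bits_def power_add[symmetric] by (simp add: algebra_simps)
  then show ?thesis by (simp only: power_mult[symmetric] mult.commute) simp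
qed

text \<open>Words must address four segments of size \<open>Z\<close>, that is, have more than
  \<open>(b + 3) * B + 2\<close> bits for \<open>2 ^ B\<close> vertices. The second factor comes
  from \<open>graph_bits_le\<close>; \<open>b + 4\<close> absorbs the additive constant.\<close>

definition word_factor :: "nat \<Rightarrow> nat \<Rightarrow> nat" where "word_factor b k = (b + 4) * (14 * k + 80)"

lemma graph_bits_le:
  assumes "m \<le> (2 * n + 1) ^ k"
  shows "graph_bits n m + 2 \<le> (14 * k + 80) * (n + 1)"
proof -
  have base: "2 * n + 1 \<le> 2 ^ (n + 1)"
  proof (induction n)
    case (Suc n)
    have "(2 :: nat) \<le> 2 ^ (n + 1)" by simp
    with Suc have "(2 * n + 1) + 2 \<le> 2 ^ (n + 1) + (2 :: nat) ^ (n + 1)" by (rule add_mono)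
    then show ?case by simp
  qed simp
  have "m \<le> (2 ^ (n + 1)) ^ k" using assms power_mono[OF base, of k] by linarith
  then have m: "m \<le> 2 ^ ((n + 1) * k)" unfolding power_mult .
  have "(2 :: nat) ^ coord_bits m \<le> 2 * (m + 4)" by (rule coord_bits)
  also have "\<dots> \<le> 2 * (2 ^ ((n + 1) * k) + 4)" using m by simp
  also have "\<dots> \<le> 2 * (2 ^ ((n + 1) * k) + 4 * 2 ^ ((n + 1) * k))"
    by (intro mult_le_mono2 add_left_mono) simp
  also have "\<dots> \<le> 2 ^ 4 * 2 ^ ((n + 1) * k)" by simp
  also have "\<dots> = 2 ^ (4 + (n + 1) * k)" by (simp add: power_add)
  finally have "coord_bits m \<le> 4 + (n + 1) * k" by (simp add: power_le_imp_le_exp)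
  then have "graph_bits n m + 2 \<le> 4 + 3 * (n + 4) + 14 * (4 + (n + 1) * k)"
    unfolding graph_bits_def group_bits_def by simp
  also have "\<dots> \<le> (14 * k + 80) * (n + 1)" by (simp add: algebra_simps)
  finally show ?thesis .
qed

lemma tabling_instance:
  assumes F: "kcnf k n F"
  shows "tabling (word_factor b k * (n + 1)) (b * graph_bits n (length F)) b (group_bits n)
    (2 ^ (group_bits n + 3)) (2 ^ coord_bits (length F)) (2 ^ (group_bits n + 2)) (incident (group_bits n) F)
    n (coord_bits (length F)) k F"
proof -
  define h where "h = group_bits n"
  define N :: nat where "N = 2 ^ (h + 3)"
  define t where "t = coord_bits (length F)"
  define D :: nat where "D = 2 ^ t"
  define w where "w = word_factor b k * (n + 1)"
  define B where "B = graph_bits n (length F)"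
  note tl = coord_bits[where m = "length F", folded t_def]
  have hf: "0 < h" "n < 4 * h" "h \<le> n + 1" by (auto simp: h_def group_bits_def)
  have NB: "4 * (N ^ 3 * D ^ 7 * D ^ 7) = 2 ^ B"
    unfolding N_def D_def t_def B_def h_def by (rule graph_bits_power)
  have B: "B + 2 \<le> (14 * k + 80) * (n + 1)" unfolding B_def by (rule graph_bits_le[OF kcnf_length[OF F]])
  have w: "(b + 3) * B + 2 < w"
  proof -
    have "(b + 3) * B + 2 < (b + 4) * (B + 2)" by (simp add: algebra_simps)
    also have "\<dots> \<le> (b + 4) * ((14 * k + 80) * (n + 1))" using B by (rule mult_le_mono2)
    finally show ?thesis unfolding w_def word_factor_def mult.assoc .
  qed
  have nw: "80 * (n + 1) \<le> w"
  proof -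
    have "1 * (80 * (n + 1)) \<le> (b + 4) * ((14 * k + 80) * (n + 1))" by (intro mult_le_mono) auto
    then show ?thesis unfolding w_def word_factor_def mult.assoc mult_1 .
  qed
  have nw2: "2 * n \<le> w" "n + 8 \<le> w" using nw by simp_all
  have hw: "h \<le> w" using hf(3) nw by simp
  have small: "x < 2 ^ w" if "x \<le> w" for x using le_less_trans[OF that less_exp] .
  have D4: "length F + 4 \<le> D" using tl by (simp add: D_def)
  have incN: "incident h F a x \<Longrightarrow> x < length F + 4" for a x
    by (auto simp: incident_def split: if_splits)
  interpret enumeration w "b * B" b h N D "2 ^ (h + 2)" "incident h F"
  proof
    show "0 < N" "1 < D" "(2 :: nat) ^ (h + 2) < N" using D4 by (auto simp: N_def power_add)
    show "2 ^ (b * B) = (4 * (N ^ 3 * D ^ 7 * D ^ 7)) ^ b" unfolding NB by (simp add: power_mult[symmetric] mult.commute)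
    have "(2 ^ B) ^ (b + 3) = (2 :: nat) ^ ((b + 3) * B)" by (simp only: power_mult[symmetric] mult.commute)
    moreover have "4 * 2 ^ x = (2 :: nat) ^ (x + 2)" for x by (simp add: power_add)
    ultimately have "4 * (2 ^ B) ^ (b + 3) = (2 :: nat) ^ ((b + 3) * B + 2)" by presburger
    also have "\<dots> < 2 ^ w" using w by (intro power_strict_increasing) auto
    finally show "4 * (4 * (N ^ 3 * D ^ 7 * D ^ 7)) ^ (b + 3) < 2 ^ w" unfolding NB .
    show "h < 2 ^ w" by (rule small[OF hw])
  qed
  have lits: "v < n" if "C \<in> set F" "(v, s) \<in> set C" for C v s using kcnf_clause_length(3)[OF F that] .
  have enc: "encode_literal l < 2 * n" if "C \<in> set F" "l \<in> set C" for C l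
    using lits[OF that(1), of "fst l" "snd l"] that(2) by (cases l) (auto simp: encode_literal_def)
  show ?thesis
    unfolding w_def[symmetric] B_def[symmetric] h_def[symmetric] N_def[symmetric] t_def[symmetric] D_def[symmetric]
  proof unfold_locales
    fix a x assume a: "a < N" "incident h F a x"
    show "x < D" using incN[OF a(2)] D4 by simp
    \<comment> \<open>The dominating vector has group number 4, which contains no variable and owns
      no guard, so it is on at all clauses and guards.\<close>
    have "\<not> lit_sat h (2 ^ (h + 2)) (encode_literal l)" if "x < length F" "l \<in> set (F ! x)" for l
    proof -
      have "fst l < 4 * h" using lits[of "F ! x" "fst l" "snd l"] that hf by fastforce
      then have "fst l div h < 4" by (simp add: less_mult_imp_div_less)
      then show ?thesis using lit_sat_encode[of h "2 ^ (h + 2)" "fst l" "snd l"] by (simp add: power_add)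
    qed
    then show "incident h F (2 ^ (h + 2)) x"
      using incN[OF a(2)] by (auto simp: incident_def power_add)
  next
    show "h = n div 4 + 1" by (simp add: h_def group_bits_def)
    show "N = 2 ^ (h + 3)" by (rule N_def)
    show "(2 :: nat) ^ (h + 2) = 2 ^ (h + 2)" ..
    show "D = 2 ^ t" by (rule D_def)
    show "length F + 4 \<le> 2 ^ t" by (rule tl)
    show "2 ^ i < length F + 4" if "i < t" for i using tl(2) that .
    show "length C \<le> k" if "C \<in> set F" for C using kcnf_clause_length(2)[OF F that] .
    show "encode_literal l < 2 ^ w" if "C \<in> set F" "l \<in> set C" for C l
      by (rule small[OF order_trans[OF less_imp_le[OF enc[OF that]] nw2(1)]])
    show "n + 8 < 2 ^ w" by (rule small[OF nw2(2)])
    show "incident h F a x \<longleftrightarrow> (if x < length F then \<forall>l\<in>set (F ! x). \<not> lit_sat h a (encode_literal l)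
      else x < length F + 4 \<and> x \<noteq> length F + a div 2 ^ h)" for a x
      by (rule incident_def)
    show "length (encode_cnf n F) \<le> Z"
    proof -
      have "length (concat (map (\<lambda>C. length C # map encode_literal C) F)) = (\<Sum>C\<leftarrow>F. length C + 1)"
        by (simp add: length_concat comp_def)
      also have "\<dots> \<le> (\<Sum>C\<leftarrow>F. 2 * n + 1)"
        using kcnf_clause_length(1)[OF F] by (intro sum_list_mono) auto
      also have "\<dots> = length F * (2 * n + 1)" by (simp add: sum_list_triv)
      also have "\<dots> \<le> D * N"
      proof (rule mult_le_mono)
        have "h + 1 \<le> 2 ^ h" using less_exp[of h] by linarith
        then have N8: "8 * (h + 1) \<le> N" by (simp add: N_def power_add)
        have "2 * n + 1 \<le> 8 * h" using hf(2) by simp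
        also have "\<dots> \<le> 8 * (h + 1)" by simp
        also note N8
        finally show "2 * n + 1 \<le> N" .
      qed (use D4 in simp)
      finally have "length (encode_cnf n F) \<le> 2 + N * D" by (simp add: encode_cnf_def mult.commute)
      then show ?thesis using ND_le S_less S_pos by linarith
    qed
  qed
qed

lemma solver_decides:
  assumes approx: "approximates_diam_sparse 4 (7/4 - \<epsilon>) P b T" and \<epsilon>: "0 < \<epsilon>"
    and K: "2 \<le> K" "\<forall>i\<in>set P. instr_regs i \<subseteq> {..<K}"
    and F: "kcnf k n F"
  shows "computes_within (solver b K P) (word_factor b k * (n + 1))
    (2 ^ graph_bits n (length F) * tabling.prepare_cost b k + 2 * T (2 ^ graph_bits n (length F)) + 20)
    (encode_cnf n F) (\<lambda>R. R 0 \<noteq> 0 \<longleftrightarrow> satisfiable F)"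
proof -
  define h where "h = group_bits n"
  define B where "B = graph_bits n (length F)"
  interpret tabling "word_factor b k * (n + 1)" "b * B" b h "2 ^ (h + 3)" "2 ^ coord_bits (length F)" "2 ^ (h + 2)"
    "incident h F" n "coord_bits (length F)" k F
    unfolding B_def h_def by (rule tabling_instance[OF F])
  have h: "0 < h" "n < 4 * h" by (auto simp: h_def group_bits_def)
  have Nv: "Nv = 2 ^ B"
    unfolding Nv_def S_def W_def unfolding B_def h_def by (rule graph_bits_power)
  have "real (card (uedges graph)) \<le> 4 * real Nv" using card_uedges by (metis of_nat_le_iff of_nat_mult of_nat_numeral)
  \<comment> \<open>There are at most 16 candidates for each of the \<open>Nv / 4\<close> loop
    indices, whence the factor 4; the logarithmic factor is only used through being at least
    1.\<close>
  also have "\<dots> * 1 \<le> 4 * real Nv * log 2 (real Nv) powr 4"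
  proof (intro mult_left_mono ge_one_powr_ge_zero)
    have "log 2 (real Nv) = real B" by (simp add: Nv)
    moreover have "1 \<le> B" by (simp add: B_def graph_bits_def)
    ultimately show "1 \<le> log 2 (real Nv)" by simp
  qed auto
  finally have sparse: "real (card (uedges graph)) \<le> 4 * real Nv * log 2 (real Nv) powr 4" by simp
  have log: "nat \<lceil>log 2 (real Nv)\<rceil> = B" by (simp add: Nv)
  have "computes_within P (b * B) (T Nv) (encode_graph Nv (edges S))
      (\<lambda>R. is_diam_approx (7/4 - \<epsilon>) graph (fraction_val (R 0) (R 1)))"
  proof -
    have "pair_graph graph \<and> pverts graph = {0..<Nv} \<and>
        real (card (uedges graph)) \<le> 4 * real Nv * log 2 (real Nv) powr 4 \<and> lists_edges graph (edges S)"
      by (intro conjI pair_graph_graph lists_edges_graph sparse pverts_eq)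
    moreover have "2 \<le> Nv" using Nv_ge by linarith
    ultimately show ?thesis
      using approx unfolding approximates_diam_sparse_def log[symmetric] by blast
  qed
  then obtain p q where R: "is_diam_approx (7/4 - \<epsilon>) graph (fraction_val p q)"
    "computes_within (solver b K P) (word_factor b k * (n + 1)) (S * prepare_cost + 2 * T Nv + 20)
      (encode_cnf n F) (\<lambda>R. R 0 \<noteq> 0 \<longleftrightarrow> q = 0 \<or> 4 * q < p)"
    by (rule solver_correct[OF K, where Q = "\<lambda>p q. is_diam_approx (7/4 - \<epsilon>) graph (fraction_val p q)"])
  have vars: "\<forall>C\<in>set F. \<forall>(v, s)\<in>set C. v < 4 * h"
    using kcnf_clause_length(3)[OF F] h(2) by fastforce
  have "(q = 0 \<or> 4 * q < p) \<longleftrightarrow> satisfiable F"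
  proof
    assume sat: "satisfiable F"
    obtain y where y: "\<And>g. g < 4 \<Longrightarrow> y g div 2 ^ h = g"
      "\<And>x. \<not> (incident h F (y 0) x \<and> incident h F (y 1) x \<and> incident h F (y 2) x \<and> incident h F (y 3) x)"
      using satisfiable_imp_orthogonal[OF vars sat h(1)] by blast
    have less: "y g < 2 ^ (h + 3)" if "g < 4" for g
    proof -
      have "y g div 2 ^ h < 8" using y(1)[OF that] that by simp
      then show ?thesis by (simp add: div_less_iff_less_mult power_add mult.commute)
    qed
    have ne: "y g \<noteq> y g'" if "g < 4" "g' < 4" "g \<noteq> g'" for g g' using y(1) that by metis
    have U: "y g \<noteq> 2 ^ (h + 2)" if "g < 4" for g
    proof
      assume "y g = 2 ^ (h + 2)"
      then have "y g div 2 ^ h = 4" by (simp add: power_add)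
      then show False using y(1)[OF that] that by simp
    qed
    have "marked (y 0) \<noteq> marked (y 3)" using y(1)[of 0] y(1)[of 3] by (simp add: marked_def)
    then have "7 \<le> diam graph"
      by (intro diam_ge_7[of "y 0" "y 1" "y 2" "y 3"] y(2) less ne U) auto
    then show "q = 0 \<or> 4 * q < p" by (rule approx_4_or_7(1)[OF R(1) \<epsilon>])
  next
    assume big: "q = 0 \<or> 4 * q < p"
    show "satisfiable F"
    proof (rule ccontr)
      assume unsat: "\<not> satisfiable F"
      have "diam graph \<le> 4"
        by (rule diam_le_4) (use orthogonal_imp_satisfiable[OF vars] unsat in blast)
      then show False using approx_4_or_7(2)[OF R(1) \<epsilon>] big by blast
    qed
  qed
  then have "computes_within (solver b K P) (word_factor b k * (n + 1)) (S * prepare_cost + 2 * T Nv + 20)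
      (encode_cnf n F) (\<lambda>R. R 0 \<noteq> 0 \<longleftrightarrow> satisfiable F)" using R(2) by simp
  moreover have "S * prepare_cost + 2 * T Nv + 20 \<le> 2 ^ B * prepare_cost + 2 * T (2 ^ B) + 20"
    using Nv by (simp add: Nv_def[symmetric]) (simp add: Nv_def)
  ultimately show ?thesis unfolding B_def by (rule computes_within_mono)
qed

text \<open>The 16 collects the three extra bits of \<open>N\<close> and the \<open>+ 1\<close> in
  \<open>group_bits\<close>; the 10 comes from \<open>D \<le> 2 * m + 8\<close> with
  \<open>m \<le> (2 * n + 1) ^ k\<close>. Three vectors of \<open>n / 4\<close> bits each give the
  exponent \<open>3 / 4 * n\<close>.\<close>

lemma graph_size_le:
  assumes "m \<le> (2 * n + 1) ^ k"
  shows "real (2 ^ graph_bits n m) \<le> 4 * 16 ^ 3 * 10 ^ 14 * ((2 * real n + 1) ^ (14 * k) * 2 powr (3 / 4 * real n))"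
proof -
  let ?q = "(2 * real n + 1) ^ k"
  have q: "1 \<le> ?q" by (rule one_le_power) simp
  have "real m \<le> real ((2 * n + 1) ^ k)" using assms by (rule of_nat_mono)
  then have m: "real m \<le> ?q" by (simp add: add.commute)
  have "real (2 ^ coord_bits m) \<le> real (2 * (m + 4))" using coord_bits(3) by (rule of_nat_mono)
  then have "2 ^ coord_bits m \<le> 2 * real m + 8" by simp
  then have D: "2 ^ coord_bits m \<le> 10 * ?q" using m q by linarith
  have "(2 :: real) ^ (n div 4) = 2 powr real (n div 4)" by (simp add: powr_realpow)
  also have "\<dots> \<le> 2 powr (real n / 4)"
  proof (rule powr_mono)
    have "4 * (n div 4) \<le> n" by simp
    then show "real (n div 4) \<le> real n / 4" by linarith
  qed simp
  finally have N: "(2 :: real) ^ (group_bits n + 3) \<le> 16 * 2 powr (real n / 4)"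
    by (simp add: group_bits_def power_add)
  have "real (2 ^ graph_bits n m) = 4 * ((2 ^ (group_bits n + 3)) ^ 3 * (2 ^ coord_bits m) ^ 14)"
    unfolding graph_bits_power[symmetric] by simp
  also have "\<dots> \<le> 4 * ((16 * 2 powr (real n / 4)) ^ 3 * (10 * ?q) ^ 14)"
    using N D by (intro mult_left_mono mult_mono power_mono) auto
  also have "(16 * 2 powr (real n / 4)) ^ 3 = 16 ^ 3 * 2 powr (3 / 4 * real n)"
    by (simp add: power_mult_distrib powr_power)
  also have "(10 * ?q) ^ 14 = 10 ^ 14 * (2 * real n + 1) ^ (14 * k)"
    by (simp add: power_mult_distrib power_mult[symmetric] mult.commute)
  finally show ?thesis by (simp only: mult.assoc mult.left_commute mult.commute)
qed

text \<open>The time bound for satisfiability has to hold for every \<open>n\<close>, so the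
  finitely many exceptional values of \<open>T\<close> are put into the constant.\<close>

lemma bigo_nat_bound:
  fixes T :: "nat \<Rightarrow> nat" and g :: "nat \<Rightarrow> real"
  assumes "(\<lambda>n. real (T n)) \<in> O(g)" and pos: "\<And>n. 1 \<le> n \<Longrightarrow> 1 \<le> g n"
  obtains C where "0 \<le> C" "\<And>n. 1 \<le> n \<Longrightarrow> real (T n) \<le> C * g n"
proof -
  obtain c where "0 < c" "eventually (\<lambda>n. norm (real (T n)) \<le> c * norm (g n)) at_top"
    using assms(1) by (auto elim: landau_o.bigE)
  then obtain n0 where n0: "\<And>n. n0 \<le> n \<Longrightarrow> real (T n) \<le> c * norm (g n)"
    by (auto simp: eventually_at_top_linorder)
  define C where "C = c + (\<Sum>i<n0. real (T i))"
  have sum: "0 \<le> (\<Sum>i<n0. real (T i))" by (rule sum_nonneg) simp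
  show ?thesis
  proof (rule that[of C])
    show "0 \<le> C" using \<open>0 < c\<close> sum by (simp add: C_def)
    fix n :: nat assume n: "1 \<le> n"
    show "real (T n) \<le> C * g n"
    proof (cases "n0 \<le> n")
      case True
      have "real (T n) \<le> c * g n" using n0[OF True] pos[OF n] by simp
      also have "\<dots> \<le> C * g n" using sum pos[OF n] by (intro mult_right_mono) (auto simp: C_def)
      finally show ?thesis .
    next
      case False
      then have "real (T n) \<le> (\<Sum>i<n0. real (T i))" by (intro member_le_sum) auto
      also have "\<dots> \<le> C * 1" using \<open>0 < c\<close> by (simp add: C_def)
      also have "\<dots> \<le> C * g n" using \<open>0 < c\<close> sum pos[OF n] by (intro mult_left_mono) (auto simp: C_def)
      finally show ?thesis .
    qed
  qed
qed

theorem theorem1: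
  assumes SETH
  shows "\<forall>\<epsilon>>0. \<exists>c>0. \<forall>\<delta>>0.
    \<not> (\<exists>P b T. approximates_diam_sparse c (7/4 - \<epsilon>) P b T \<and>
        (\<lambda>n. real (T n)) \<in> O(\<lambda>n. real n powr (4/3 - \<delta>)))"
proof (intro allI impI exI[of _ 4] conjI notI)
  fix \<epsilon> \<delta> :: real
  assume \<epsilon>: "0 < \<epsilon>" and \<delta>: "0 < \<delta>"
  assume "\<exists>P b T. approximates_diam_sparse 4 (7/4 - \<epsilon>) P b T \<and>
        (\<lambda>n. real (T n)) \<in> O(\<lambda>n. real n powr (4/3 - \<delta>))"
  then obtain P b T where approx: "approximates_diam_sparse 4 (7/4 - \<epsilon>) P b T"
    and T: "(\<lambda>n. real (T n)) \<in> O(\<lambda>n. real n powr (4/3 - \<delta>))" by blast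
  \<comment> \<open>The maximum of \<open>4/3 - \<delta>\<close> and 1: being at least 1, the
    exponent also pays for listing the edges, and it is still less than 4/3.\<close>
  define \<gamma> where "\<gamma> = 4/3 - min \<delta> (1/3)"
  have \<gamma>: "1 \<le> \<gamma>" "\<gamma> < 4/3" "4/3 - \<delta> \<le> \<gamma>" using \<delta> by (auto simp: \<gamma>_def)
  have "(\<lambda>n. real n powr (4/3 - \<delta>)) \<in> O(\<lambda>n. real n powr \<gamma>)"
  proof (rule landau_o.big_mono)
    show "\<forall>\<^sub>F n in sequentially. norm (real n powr (4/3 - \<delta>)) \<le> norm (real n powr \<gamma>)"
      using eventually_ge_at_top[of 1] by eventually_elim (use \<gamma>(3) in \<open>simp add: powr_mono\<close>)
  qed
  then have "(\<lambda>n. real (T n)) \<in> O(\<lambda>n. real n powr \<gamma>)" using T landau_o.big.trans by blast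
  moreover have "1 \<le> real n powr \<gamma>" if "1 \<le> n" for n
    using that \<gamma>(1) by (intro ge_one_powr_ge_zero) auto
  ultimately obtain C where C: "0 \<le> C" "\<And>n. 1 \<le> n \<Longrightarrow> real (T n) \<le> C * real n powr \<gamma>"
    using bigo_nat_bound by blast
  \<comment> \<open>\<open>q\<close> is the exponential rate of \<open>2 ^ (3 / 4 * n)\<close>
    raised to the power \<open>\<gamma>\<close>. The rate \<open>r\<close> lies strictly between
    \<open>q\<close> and 2, and the gap to \<open>q\<close> absorbs polynomial factors.\<close>
  define q r :: real where "q = 2 powr (3/4 * \<gamma>)" and "r = 2 powr ((3/4 * \<gamma> + 1) / 2)"
  have qr: "0 < q" "q < r" "r < 2" "0 < r"
    using \<gamma> powr_less_mono[of "(3/4 * \<gamma> + 1) / 2" 1 2] by (auto simp: q_def r_def)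
  define \<epsilon>' where "\<epsilon>' = 2 - r"
  have "0 < \<epsilon>'" "\<epsilon>' < 2" "2 - \<epsilon>' = r" using qr by (auto simp: \<epsilon>'_def)
  then obtain k where k: "\<not> (\<exists>P b T. decides_ksat k P b T \<and> (\<lambda>n. real (T n)) \<in> O(\<lambda>n. r ^ n))"
    using assms unfolding SETH_def by metis
  obtain K where K: "2 \<le> K" "\<forall>i\<in>set P. instr_regs i \<subseteq> {..<K}" using regs_bound by blast
  define A :: real where "A = 4 * 16 ^ 3 * 10 ^ 14"
  \<comment> \<open>The degree \<open>28 * k\<close> is twice the degree \<open>14 * k\<close> in
    the size of the graph, since \<open>\<gamma> \<le> 2\<close>.\<close>
  define p where "p n = (2 * real n + 1) ^ (28 * k) * q ^ n" for n
  define A' where "A' = A * real (tabling.prepare_cost b k) + 2 * C * A powr \<gamma> + 20"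
  define T' where "T' n = nat \<lceil>A' * p n\<rceil>" for n
  have A: "1 \<le> A" by (simp add: A_def)
  have p1: "1 \<le> p n" for n
  proof -
    have "1 \<le> q" using \<gamma>(1) by (simp add: q_def ge_one_powr_ge_zero)
    then have "1 * 1 \<le> (2 * real n + 1) ^ (28 * k) * q ^ n" by (intro mult_mono one_le_power) auto
    then show ?thesis by (simp add: p_def)
  qed
  have bound: "2 ^ graph_bits n m * tabling.prepare_cost b k + 2 * T (2 ^ graph_bits n m) + 20 \<le> T' n"
    if m: "m \<le> (2 * n + 1) ^ k" for n m
  proof -
    let ?s = "(2 * real n + 1) ^ (14 * k) * 2 powr (3 / 4 * real n)" and ?B = "2 ^ graph_bits n m :: nat"
    have B: "real ?B \<le> A * ?s" using graph_size_le[OF m] by (simp add: A_def)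
    have pol: "1 \<le> (2 * real n + 1) ^ (14 * k)" by (rule one_le_power) simp
    have s1: "1 \<le> ?s"
    proof -
      have "1 * 1 \<le> ?s" using pol by (intro mult_mono ge_one_powr_ge_zero) auto
      then show ?thesis by simp
    qed
    have q_eq: "(2 powr (3 / 4 * real n)) powr \<gamma> = q ^ n"
      by (simp add: q_def powr_powr powr_realpow[symmetric] mult_ac)
    have sp: "?s powr \<gamma> \<le> p n"
    proof -
      have "?s powr \<gamma> = ((2 * real n + 1) ^ (14 * k)) powr \<gamma> * q ^ n"
        unfolding q_eq[symmetric] by (rule powr_mult)
      also have "((2 * real n + 1) ^ (14 * k)) powr \<gamma> \<le> ((2 * real n + 1) ^ (14 * k)) powr 2"
        using pol \<gamma> by (intro powr_mono) auto
      also have "((2 * real n + 1) ^ (14 * k)) powr 2 = (2 * real n + 1) ^ (28 * k)"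
        using pol by (simp add: powr_numeral power_mult[symmetric])
      finally show ?thesis using qr by (simp add: p_def mult_right_mono)
    qed
    have s_le: "?s \<le> p n"
    proof -
      have "?s powr 1 \<le> ?s powr \<gamma>" using s1 \<gamma> by (intro powr_mono) auto
      then show ?thesis using sp s1 by simp
    qed
    have "real ?B * real (tabling.prepare_cost b k) \<le> (A * p n) * real (tabling.prepare_cost b k)"
    proof (rule mult_right_mono)
      show "real ?B \<le> A * p n" using B s_le A by (meson mult_left_mono order_trans zero_le_one)
    qed simp
    moreover have "real (T ?B) \<le> C * (A powr \<gamma> * p n)"
    proof -
      have "real (T ?B) \<le> C * real ?B powr \<gamma>" by (rule C(2)) simp
      also have "\<dots> \<le> C * (A * ?s) powr \<gamma>"
        using B C(1) \<gamma> by (intro mult_left_mono powr_mono2) auto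
      also have "(A * ?s) powr \<gamma> = A powr \<gamma> * ?s powr \<gamma>" by (rule powr_mult)
      also have "C * (A powr \<gamma> * ?s powr \<gamma>) \<le> C * (A powr \<gamma> * p n)"
        using C(1) sp by (intro mult_left_mono) auto
      finally show ?thesis .
    qed
    ultimately have "real (?B * tabling.prepare_cost b k + 2 * T ?B + 20) \<le> A' * p n"
      using p1[of n] by (simp add: A'_def algebra_simps)
    then show ?thesis unfolding T'_def by linarith
  qed
  have "decides_ksat k (solver b K P) (word_factor b k) T'"
    unfolding decides_ksat_def
  proof (intro allI impI)
    fix n F assume F: "kcnf k n F"
    show "computes_within (solver b K P) (word_factor b k * (n + 1)) (T' n) (encode_cnf n F)
        (\<lambda>R. R 0 \<noteq> 0 \<longleftrightarrow> satisfiable F)"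
      by (rule computes_within_mono[OF solver_decides[OF approx \<epsilon> K F] bound[OF kcnf_length[OF F]]])
  qed
  moreover have "(\<lambda>n. real (T' n)) \<in> O(\<lambda>n. r ^ n)"
  proof -
    have A'0: "0 \<le> A'" using A C(1) by (simp add: A'_def)
    have "(\<lambda>n. real (T' n)) \<in> O(p)"
    proof (rule landau_o.bigI[of "A' + 1"])
      show "\<forall>\<^sub>F n in at_top. norm (real (T' n)) \<le> (A' + 1) * norm (p n)"
      proof (intro always_eventually allI)
        fix n
        have "real (T' n) \<le> A' * p n + 1"
          unfolding T'_def using A'0 p1[of n] by (simp add: of_nat_nat)
        also have "\<dots> \<le> (A' + 1) * p n" using p1[of n] by (simp add: algebra_simps)
        finally show "norm (real (T' n)) \<le> (A' + 1) * norm (p n)" using p1[of n] by simp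
      qed
    qed (use A'0 in simp)
    also have "p \<in> O(\<lambda>n. r ^ n)"
      using poly_times_exp_bigo[OF qr(1,2), of "28 * k"] by (simp add: p_def[abs_def])
    finally show ?thesis .
  qed
  ultimately show False using k by blast
qed simp

end
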